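(* For each $s\in\{226,3388,4390,4986\}$, let $G=G_s$ be the finite directed graph of catalogue row $s$, with edge set $E$, and let $\Pi^*=\Pi_{\mathrm{opp}}(G)$. Then there is an edge partition $\Pi'$ of $E$ such that $$\lambda(\Pi')=\lambda(\Pi^* ),\qquad \Pi'\sim_{\mathcal S_\lambda(E)}\Pi^*\ \text{ (with }\lambda=\lambda(\Pi^* )),\qquad \mathsf H(G,\Pi')=1 .$$ Moreover, every such $\Pi'$ satisfies $\Pi'\neq\Pi^*$, breaks an opposite-diamond generator (some opposite pair of edges of some directed two-step diamond pattern of $G$ is not contained in a single block of $\Pi'$), and lies outside the $\operatorname{Aut}(G)$-orbit of $\Pi^*$.
   Context: **Edge partitions.** $G=(V,E)$ is a finite loopless directed graph without parallel edges. An edge partition $\Pi=\{C_1,\dots,C_q\}$ is an unlabelled collection of nonempty pairwise disjoint subsets (blocks) of $E$ with union $E$. Its profile $\lambda(\Pi)$ is the multiset of block sizes. $\mathcal P_\lambda(E)$ is the set of edge partitions with profile $\lambda$. The graph $\mathcal S_\lambda(E)$ has vertex set $\mathcal P_\lambda(E)$; $\Pi\sim_{\mathcal S_\lambda(E)}\Pi'$ (adjacency) means $\Pi'\ne\Pi$ and $\Pi'$ is obtained from $\Pi$ by choosing distinct blocks $A,B\in\Pi$, $e\in A$, $f\in B$ and replacing $A,B$ by $(A\setminus\{e\})\cup\{f\}$, $(B\setminus\{f\})\cup\{e\}$. $\operatorname{Aut}(G)$ acts on edge partitions through the induced edge bijections. **Opposite-diamond partition.** A directed two-step diamond pattern is a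 quadruple of distinct vertices $(x,a,b,y)$ with $(x,a),(x,b),(a,y),(b,y)\in E$ (additional arcs among them are allowed). Its opposite pairs are $\{(x,a),(b,y)\}$ and $\{(x,b),(a,y)\}$. $\Omega(G)$ is the undirected graph with vertex set $E$ in which two edges of $G$ are adjacent when they form an opposite pair of some pattern. $\Pi_{\mathrm{opp}}(G)$ is the set of connected components of $\Omega(G)$. **Catalogue graphs $G_s$.** Terms are generated by $\mathcal T::=\mathtt A\mid\mathtt V\mid \mathtt P(\mathcal T,\mathcal T)\mid \mathtt R(\mathcal T,\mathcal T)$, with size $|\mathtt A|=|\mathtt V|=1$, $|\mathtt P(s,t)|=|\mathtt R(s,t)|=1+|s|+|t|$. The symbol $\mathtt V$ is a single consistently bound wildcard (placeholder): repeated occurrences in a pattern must match the same term. A state is a finite multiset of terms (components), written canonically as an ASCII string with its components sorted lexicographically, separated by semicolons and enclosed in braces. In a state, any component of the form $\mathtt R(p,q)$ (a represented rule) may be applied to any nonplaceholder occurrence (a subterm occurrence other than $\mathtt V$ itself) matching $p$ in any component; the occurrence is replaced by the corresponding instance of $q$ under the same binding of $\mathtt V$, and the components are sorted again. A state is valid when every non-rule component (outermost symbol not $\mathtt R$) is closed (contains no $\mathtt V$) and no rule contains $\mathtt V$ on its right without $\mathtt V$ on its left. Retain the rewrites leading to valid states whose changed component has size at most 255, and, starting from a seed state, explore all transitions whose source is at distance less than 3 from the seed. The rule signature of a canonical state is the ordered tuple of its components with outermost symbol $\mathtt R$; its data signature is the ordered tuple of the remaining components. A qualifying recurrent core is a cyclic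 strongly connected component of the explored transition graph with at least two distinct rule signatures, at least two distinct data signatures, and an internal transition changing the rule signature. For each row below the selected core is the unique largest qualifying core. The vertices of $G_s$ are the states of that core, numbered $0,1,2,\dots$ in lexicographic order of canonical state strings; the directed edges are the distinct ordered pairs of distinct core states joined by at least one internal one-step rewrite. The seeds are: - row 226: $\mathtt{\{A;R(A,R(A,A));R(V,A)\}}$ ($|V|=20$, $|E|=55$); - row 3388: $\mathtt{\{P(A,A);R(A,P(A,A));R(V,P(A,A))\}}$ ($|V|=29$, $|E|=108$); - row 4390: $\mathtt{\{P(A,A);R(P(A,V),V);R(V,P(A,V))\}}$ ($|V|=22$, $|E|=66$); - row 4986: $\mathtt{\{P(A,A);R(P(V,A),V);R(V,P(V,A))\}}$ ($|V|=22$, $|E|=66$). **Relations.** For a relation $R\subseteq V\times V$ write $R(v)=\{w:(v,w)\in R\}$; composition is $(R\circ S)(v)=\bigcup_{w\in R(v)}S(w)$ ($R$ first). For a block $C\in\Pi$ let $T_C=C$ viewed as a relation on $V$, and for a nonempty word $w=C_1\cdots C_k$ in blocks let $T_w=T_{C_1}\circ\cdots\circ T_{C_k}$. The empty word $\varepsilon$, with $T_\varepsilon=\operatorname{Id}_V$, is admitted only as an offload word. **Behavioural quotient.** $Q_0$ is the indiscrete equivalence on $V$; $u,v$ are $Q_{t+1}$-equivalent iff for every $C\in\Pi$ the sets $\{[w]_{Q_t}:w\in T_C(u)\}$ and $\{[w]_{Q_t}:w\in T_C(v)\}$ agree. $Q$ is the stable equivalence and $\kappa_Q(v)$ the class of $v$.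 **Write-preserve-use (WPU) certificate.** It consists of: (W1, fork) a state $s\in V$, channels $A,B\in\Pi$ (possibly equal), $\ell\in T_A(s)$, $r\in T_B(s)$ with $\kappa_Q(\ell)\ne\kappa_Q(r)$; (W2–W3, offload) a word $o$, possibly $\varepsilon$, with $T_o(\ell)=\{p\}$, $T_o(r)=\{q\}$, $p\ne q$, $\kappa_Q(p)\neq\kappa_Q(q)$, and for each $C\in\{A,B\}$: $T_C(p)\ne\varnothing\iff T_C(q)\ne\varnothing$; (W4, persistent orbit) a nonempty word $z$ with $T_z\ne\operatorname{Id}_V$ such that, for the partial map $T_z^{(2)}(u,v)=(u',v')$ defined when $T_z(u)=\{u'\}$ and $T_z(v)=\{v'\}$, all iterates from $(p,q)$ are defined, the two entries always lie in different $Q$-classes, and at least one iterate differs from its predecessor (the resulting eventually periodic sequence is the persistent pair orbit); (W5, use) a nonempty word $u$ with $T_u\neq\operatorname{Id}_V$ such that, with $\beta_u(v)=\{\kappa_Q(w):w\in T_u(v)\}$, $\beta_u(p)\neq\beta_u(q)$ and $(\beta_u(p),\beta_u(q))\ne(\{\kappa_Q(p)\},\{\kappa_Q(q)\})$. **Record systems (W6).** A WPU certificate has class pair $\{\kappa_Q(p),\kappa_Q(q)\}$ and operational support equal to the set of all states occurring in its persistent pair orbit. A record system is a nonempty finite family of certificates with one common class pair $K$; its support is the union of their operational supports; its representatives in class $k\in K$ are the support states belonging to $k$, and both representative sets must be nonempty. **Translations.** Let $X,Y$ be distinct record systems with class pairs presented as ordered pairs $(x_0,x_1)$, $(y_0,y_1)$.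 A nonempty word $t$ induces a translation $X\to Y$ when for each $i\in\{0,1\}$, $T_t$ is single-valued on every representative of $x_i$, all images lie in the support of $Y$, and all have one common class $y_{\pi(i)}$, where $\pi$ is a permutation of $\{0,1\}$. Its gain in $\mathbb Z_2$ is the parity of $\pi$. **The property $\mathsf H$.** $\mathsf H(G,\Pi)=1$ (a WPU-parity certificate exists) iff there is a finite family of record systems such that: (E1) at least two record systems are present; (E2) some unordered pair $X,Y$ has translations in both directions; (E3) some two supports are strictly nested or have nonempty proper overlap (disjoint or equal supports do not qualify); (E4) there are distinct record systems $X,Y$, a certificate in $X$ whose persistent pair orbit has eventual period $m>1$, a coordinate $j\in\{0,1\}$ and a nonempty word $r$ such that, writing $(p_h,q_h)$, $0\le h<m$, for the periodic part and $x_h=p_h$ if $j=0$, $x_h=q_h$ if $j=1$, for every $h$ one has $T_r(x_h)=\{y_h\}$ with $y_h$ in the support of $Y$ and $\kappa_Q(y_h)$ in its class pair, and $(\kappa_Q(y_h))_{h=0}^{m-1}$ is nonconstant; (E5) the directed multigraph whose vertices are the record systems and whose arcs are translations labelled by gains has a closed directed walk of odd total gain. Otherwise $\mathsf H(G,\Pi)=0$. *)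

theory Defs
  imports
    "HOL-Library.Multiset"
    "HOL-Library.Disjoint_Sets"
    "HOL-Library.List_Lexorder"
    "HOL-Library.Char_ord"
    "HOL-Library.Z2"
    "HOL-Combinatorics.Permutations"
    "Graph_Theory.Graph_Theory"
begin

section \<open>Edge partitions\<close>

text \<open>
  A graph without parallel edges is a \<^typ>\<open>'v pair_pre_digraph\<close>; an edge partition of its edge set
  \<open>E = parcs G\<close> is a set \<open>\<P>\<close> of blocks with \<^term>\<open>partition_on E \<P>\<close>. The same block is used as a
  relation on the vertices, so that \<open>T\<^sub>C(v)\<close> is \<^term>\<open>C `` {v}\<close>.
\<close>

definition profile :: "'e set set \<Rightarrow> nat multiset" where
  "profile \<P> = image_mset card (mset_set \<P>)"

definition edge_partitions :: "nat multiset \<Rightarrow> 'e set \<Rightarrow> 'e set set set" where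
  "edge_partitions lam E = {\<P>. partition_on E \<P> \<and> profile \<P> = lam}"

definition swap_graph :: "nat multiset \<Rightarrow> 'e set \<Rightarrow> 'e set set pair_pre_digraph" where
  "swap_graph lam E =
     \<lparr> pverts = edge_partitions lam E,
       parcs = {(\<P>, \<P>'). \<P> \<in> edge_partitions lam E \<and> \<P>' \<in> edge_partitions lam E \<and> \<P>' \<noteq> \<P> \<and>
         (\<exists>A\<in>\<P>. \<exists>B\<in>\<P>. A \<noteq> B \<and> (\<exists>e\<in>A. \<exists>f\<in>B.
            \<P>' = (\<P> - {A, B}) \<union> {(A - {e}) \<union> {f}, (B - {f}) \<union> {e}}))} \<rparr>"

definition automorphisms :: "'v pair_pre_digraph \<Rightarrow> ('v \<Rightarrow> 'v) set" where
  "automorphisms G = {\<phi>. \<phi> permutes pverts G \<and>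
     (\<forall>u\<in>pverts G. \<forall>v\<in>pverts G. (\<phi> u, \<phi> v) \<in> parcs G \<longleftrightarrow> (u, v) \<in> parcs G)}"

definition aut_orbit :: "'v pair_pre_digraph \<Rightarrow> 'v rel set \<Rightarrow> 'v rel set set" where
  "aut_orbit G \<P> = {(\<lambda>C. map_prod \<phi> \<phi> ` C) ` \<P> |\<phi>. \<phi> \<in> automorphisms G}"

section \<open>The opposite-diamond partition\<close>

definition diamond_pattern :: "'v pair_pre_digraph \<Rightarrow> 'v \<Rightarrow> 'v \<Rightarrow> 'v \<Rightarrow> 'v \<Rightarrow> bool" where
  "diamond_pattern G x a b y \<longleftrightarrow> distinct [x, a, b, y] \<and> {x, a, b, y} \<subseteq> pverts G \<and>
     {(x, a), (x, b), (a, y), (b, y)} \<subseteq> parcs G"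

definition opposite_pairs :: "'v \<Rightarrow> 'v \<Rightarrow> 'v \<Rightarrow> 'v \<Rightarrow> 'v rel set" where
  "opposite_pairs x a b y = {{(x, a), (b, y)}, {(x, b), (a, y)}}"

definition opposite_graph :: "'v pair_pre_digraph \<Rightarrow> ('v \<times> 'v) pair_pre_digraph" where
  "opposite_graph G =
     \<lparr> pverts = parcs G,
       parcs = {(e, f). \<exists>x a b y. diamond_pattern G x a b y \<and> {e, f} \<in> opposite_pairs x a b y} \<rparr>"

text \<open>
  The arc relation of the opposite graph is symmetric, so its strongly connected components are the
  connected components of the undirected graph.
\<close>

definition opposite_partition :: "'v pair_pre_digraph \<Rightarrow> 'v rel set" where
  "opposite_partition G = pre_digraph.sccs_verts (with_proj (opposite_graph G))"

definition breaks_opposite_pair :: "'v pair_pre_digraph \<Rightarrow> 'v rel set \<Rightarrow> bool" where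
  "breaks_opposite_pair G \<P> \<longleftrightarrow>
     (\<exists>x a b y. diamond_pattern G x a b y \<and>
       (\<exists>D\<in>opposite_pairs x a b y. \<not> (\<exists>C\<in>\<P>. D \<subseteq> C)))"

section \<open>Catalogue graphs\<close>

datatype trm = TmA | TmV | TmP trm trm | TmR trm trm

primrec tsize :: "trm \<Rightarrow> nat" where
  "tsize TmA = 1"
| "tsize TmV = 1"
| "tsize (TmP s t) = 1 + tsize s + tsize t"
| "tsize (TmR s t) = 1 + tsize s + tsize t"

primrec has_wildcard :: "trm \<Rightarrow> bool" where
  "has_wildcard TmA = False"
| "has_wildcard TmV = True"
| "has_wildcard (TmP s t) = (has_wildcard s \<or> has_wildcard t)"
| "has_wildcard (TmR s t) = (has_wildcard s \<or> has_wildcard t)"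

fun is_rule :: "trm \<Rightarrow> bool" where
  "is_rule (TmR p q) = True"
| "is_rule _ = False"

primrec bind_wildcard :: "trm \<Rightarrow> trm \<Rightarrow> trm" where
  "bind_wildcard b TmA = TmA"
| "bind_wildcard b TmV = b"
| "bind_wildcard b (TmP s t) = TmP (bind_wildcard b s) (bind_wildcard b t)"
| "bind_wildcard b (TmR s t) = TmR (bind_wildcard b s) (bind_wildcard b t)"

text \<open>
  One application of the rule with sides \<open>p\<close>, \<open>q\<close> at one occurrence inside a term. The wildcard of a
  term being rewritten is an ordinary symbol: \<open>b\<close> may contain it, but an occurrence that is the
  wildcard itself is never rewritten. If \<open>p\<close> lacks the wildcard then \<open>b\<close> is unconstrained; this is
  harmless, since in a valid state \<open>q\<close> then lacks it too.
\<close>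

inductive rewrite_at :: "trm \<Rightarrow> trm \<Rightarrow> trm \<Rightarrow> trm \<Rightarrow> bool" for p q where
  root: "t = bind_wildcard b p \<Longrightarrow> t \<noteq> TmV \<Longrightarrow> rewrite_at p q t (bind_wildcard b q)"
| P_left: "rewrite_at p q s s' \<Longrightarrow> rewrite_at p q (TmP s t) (TmP s' t)"
| P_right: "rewrite_at p q t t' \<Longrightarrow> rewrite_at p q (TmP s t) (TmP s t')"
| R_left: "rewrite_at p q s s' \<Longrightarrow> rewrite_at p q (TmR s t) (TmR s' t)"
| R_right: "rewrite_at p q t t' \<Longrightarrow> rewrite_at p q (TmR s t) (TmR s t')"

type_synonym state = "trm multiset"

primrec term_string :: "trm \<Rightarrow> string" where
  "term_string TmA = ''A''"
| "term_string TmV = ''V''"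
| "term_string (TmP s t) = ''P('' @ term_string s @ '','' @ term_string t @ '')''"
| "term_string (TmR s t) = ''R('' @ term_string s @ '','' @ term_string t @ '')''"

fun join_semicolon :: "string list \<Rightarrow> string" where
  "join_semicolon [] = ''''"
| "join_semicolon [x] = x"
| "join_semicolon (x # y # xs) = x @ '';'' @ join_semicolon (y # xs)"

text \<open>
  Strings are compared by the lexicographic list order over the character order by code.
\<close>

definition component_strings :: "state \<Rightarrow> string list" where
  "component_strings S = sorted_list_of_multiset (image_mset term_string S)"

definition canonical_string :: "state \<Rightarrow> string" where
  "canonical_string S = ''{'' @ join_semicolon (component_strings S) @ ''}''"

definition rule_signature :: "state \<Rightarrow> string list" where
  "rule_signature S = component_strings (filter_mset is_rule S)"

definition data_signature :: "state \<Rightarrow> string list" where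
  "data_signature S = component_strings (filter_mset (\<lambda>c. \<not> is_rule c) S)"

definition valid_state :: "state \<Rightarrow> bool" where
  "valid_state S \<longleftrightarrow>
     (\<forall>c. c \<in># S \<and> \<not> is_rule c \<longrightarrow> \<not> has_wildcard c) \<and>
     (\<forall>p q. TmR p q \<in># S \<and> has_wildcard q \<longrightarrow> has_wildcard p)"

definition retained_rewrites :: "state rel" where
  "retained_rewrites = {(S, S'). \<exists>p q c c'. TmR p q \<in># S \<and> c \<in># S \<and> rewrite_at p q c c' \<and>
     S' = S - {#c#} + {#c'#} \<and> valid_state S' \<and> tsize c' \<le> 255}"

definition explored_transitions :: "state \<Rightarrow> state rel" where
  "explored_transitions seed =
     {(S, S') \<in> retained_rewrites. \<exists>n<3. (seed, S) \<in> retained_rewrites ^^ n}"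

definition transition_graph :: "state \<Rightarrow> state pair_pre_digraph" where
  "transition_graph seed =
     \<lparr> pverts = insert seed (Field (explored_transitions seed)), parcs = explored_transitions seed \<rparr>"

definition qualifying_core :: "state \<Rightarrow> state set \<Rightarrow> bool" where
  "qualifying_core seed C \<longleftrightarrow>
     C \<in> pre_digraph.sccs_verts (with_proj (transition_graph seed)) \<and>
     (\<exists>S\<in>C. (S, S) \<in> (explored_transitions seed)\<^sup>+) \<and>
     2 \<le> card (rule_signature ` C) \<and>
     2 \<le> card (data_signature ` C) \<and>
     (\<exists>S\<in>C. \<exists>S'\<in>C. (S, S') \<in> explored_transitions seed \<and> rule_signature S \<noteq> rule_signature S')"

definition selected_core :: "state \<Rightarrow> state set" where
  "selected_core seed =
     (THE C. qualifying_core seed C \<and> (\<forall>C'. qualifying_core seed C' \<and> C' \<noteq> C \<longrightarrow> card C' < card C))"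

definition state_number :: "state set \<Rightarrow> state \<Rightarrow> nat" where
  "state_number C S = card {S'\<in>C. canonical_string S' < canonical_string S}"

definition core_graph :: "state \<Rightarrow> nat pair_pre_digraph" where
  "core_graph seed = (let C = selected_core seed in
     \<lparr> pverts = state_number C ` C,
       parcs = {(state_number C S, state_number C S') |S S'.
         S \<in> C \<and> S' \<in> C \<and> S \<noteq> S' \<and> (S, S') \<in> explored_transitions seed} \<rparr>)"

definition catalogue_seed :: "nat \<Rightarrow> state" where
  "catalogue_seed s =
     (if s = 226 then {# TmA, TmR TmA (TmR TmA TmA), TmR TmV TmA #}
      else if s = 3388 then {# TmP TmA TmA, TmR TmA (TmP TmA TmA), TmR TmV (TmP TmA TmA) #}
      else if s = 4390 then {# TmP TmA TmA, TmR (TmP TmA TmV) TmV, TmR TmV (TmP TmA TmV) #}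
      else if s = 4986 then {# TmP TmA TmA, TmR (TmP TmV TmA) TmV, TmR TmV (TmP TmV TmA) #}
      else undefined)"

definition catalogue_graph :: "nat \<Rightarrow> nat pair_pre_digraph" where
  "catalogue_graph s = core_graph (catalogue_seed s)"

section \<open>Words and the behavioural quotient\<close>

text \<open>
  \<^const>\<open>relcomp\<close> applies its left argument first. For a nonempty word the trailing identity is
  absorbed, since every block is a relation on the vertices.
\<close>

definition word_rel :: "'v pair_pre_digraph \<Rightarrow> 'v rel list \<Rightarrow> 'v rel" where
  "word_rel G w = foldr (O) w (Id_on (pverts G))"

definition word_over :: "'v rel set \<Rightarrow> 'v rel list \<Rightarrow> bool" where
  "word_over \<P> w \<longleftrightarrow> w \<noteq> [] \<and> set w \<subseteq> \<P>"

primrec behavioural_eq :: "'v pair_pre_digraph \<Rightarrow> 'v rel set \<Rightarrow> nat \<Rightarrow> 'v rel" where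
  "behavioural_eq G \<P> 0 = pverts G \<times> pverts G"
| "behavioural_eq G \<P> (Suc t) =
     {(u, v) \<in> pverts G \<times> pverts G. \<forall>C\<in>\<P>.
        (\<lambda>w. behavioural_eq G \<P> t `` {w}) ` (C `` {u}) =
        (\<lambda>w. behavioural_eq G \<P> t `` {w}) ` (C `` {v})}"

definition stable_eq :: "'v pair_pre_digraph \<Rightarrow> 'v rel set \<Rightarrow> 'v rel" where
  "stable_eq G \<P> =
     behavioural_eq G \<P> (LEAST t. behavioural_eq G \<P> (Suc t) = behavioural_eq G \<P> t)"

definition kappa :: "'v pair_pre_digraph \<Rightarrow> 'v rel set \<Rightarrow> 'v \<Rightarrow> 'v set" where
  "kappa G \<P> v = stable_eq G \<P> `` {v}"

section \<open>Write-preserve-use certificates\<close>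

record 'v certificate =
  fork_state :: 'v
  channel_A :: "'v rel"
  channel_B :: "'v rel"
  fork_l :: 'v
  fork_r :: 'v
  offload_word :: "'v rel list"
  state_p :: 'v
  state_q :: 'v
  orbit_word :: "'v rel list"
  use_word :: "'v rel list"

definition pair_step :: "'v pair_pre_digraph \<Rightarrow> 'v rel list \<Rightarrow> 'v \<times> 'v \<Rightarrow> ('v \<times> 'v) option" where
  "pair_step G z = (\<lambda>(u, v).
     if is_singleton (word_rel G z `` {u}) \<and> is_singleton (word_rel G z `` {v})
     then Some (the_elem (word_rel G z `` {u}), the_elem (word_rel G z `` {v}))
     else None)"

definition pair_orbit :: "'v pair_pre_digraph \<Rightarrow> 'v certificate \<Rightarrow> nat \<Rightarrow> ('v \<times> 'v) option" where
  "pair_orbit G c n =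
     ((\<lambda>x. Option.bind x (pair_step G (orbit_word c))) ^^ n) (Some (state_p c, state_q c))"

definition fork_cond :: "'v pair_pre_digraph \<Rightarrow> 'v rel set \<Rightarrow> 'v certificate \<Rightarrow> bool" where
  "fork_cond G \<P> c \<longleftrightarrow>
     fork_state c \<in> pverts G \<and> channel_A c \<in> \<P> \<and> channel_B c \<in> \<P> \<and>
     fork_l c \<in> channel_A c `` {fork_state c} \<and> fork_r c \<in> channel_B c `` {fork_state c} \<and>
     kappa G \<P> (fork_l c) \<noteq> kappa G \<P> (fork_r c)"

definition offload_cond :: "'v pair_pre_digraph \<Rightarrow> 'v rel set \<Rightarrow> 'v certificate \<Rightarrow> bool" where
  "offload_cond G \<P> c \<longleftrightarrow>
     set (offload_word c) \<subseteq> \<P> \<and>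
     word_rel G (offload_word c) `` {fork_l c} = {state_p c} \<and>
     word_rel G (offload_word c) `` {fork_r c} = {state_q c} \<and>
     state_p c \<noteq> state_q c \<and> kappa G \<P> (state_p c) \<noteq> kappa G \<P> (state_q c) \<and>
     (\<forall>C\<in>{channel_A c, channel_B c}. C `` {state_p c} \<noteq> {} \<longleftrightarrow> C `` {state_q c} \<noteq> {})"

definition orbit_cond :: "'v pair_pre_digraph \<Rightarrow> 'v rel set \<Rightarrow> 'v certificate \<Rightarrow> bool" where
  "orbit_cond G \<P> c \<longleftrightarrow>
     word_over \<P> (orbit_word c) \<and> word_rel G (orbit_word c) \<noteq> Id_on (pverts G) \<and>
     (\<forall>n. \<exists>u v. pair_orbit G c n = Some (u, v) \<and> kappa G \<P> u \<noteq> kappa G \<P> v) \<and>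
     (\<exists>n. pair_orbit G c (Suc n) \<noteq> pair_orbit G c n)"

definition use_profile ::
    "'v pair_pre_digraph \<Rightarrow> 'v rel set \<Rightarrow> 'v rel list \<Rightarrow> 'v \<Rightarrow> 'v set set" where
  "use_profile G \<P> u v = kappa G \<P> ` (word_rel G u `` {v})"

definition use_cond :: "'v pair_pre_digraph \<Rightarrow> 'v rel set \<Rightarrow> 'v certificate \<Rightarrow> bool" where
  "use_cond G \<P> c \<longleftrightarrow> (let p = state_p c; q = state_q c; \<beta> = use_profile G \<P> (use_word c) in
     word_over \<P> (use_word c) \<and> word_rel G (use_word c) \<noteq> Id_on (pverts G) \<and>
     \<beta> p \<noteq> \<beta> q \<and> (\<beta> p, \<beta> q) \<noteq> ({kappa G \<P> p}, {kappa G \<P> q}))"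

definition wpu_certificate :: "'v pair_pre_digraph \<Rightarrow> 'v rel set \<Rightarrow> 'v certificate \<Rightarrow> bool" where
  "wpu_certificate G \<P> c \<longleftrightarrow>
     fork_cond G \<P> c \<and> offload_cond G \<P> c \<and> orbit_cond G \<P> c \<and> use_cond G \<P> c"

definition class_pair :: "'v pair_pre_digraph \<Rightarrow> 'v rel set \<Rightarrow> 'v certificate \<Rightarrow> 'v set set" where
  "class_pair G \<P> c = {kappa G \<P> (state_p c), kappa G \<P> (state_q c)}"

definition operational_support :: "'v pair_pre_digraph \<Rightarrow> 'v certificate \<Rightarrow> 'v set" where
  "operational_support G c = {x. \<exists>n u v. pair_orbit G c n = Some (u, v) \<and> x \<in> {u, v}}"

text \<open>
  Length of the transient part and eventual period (the least one) of the pair orbit.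
\<close>

definition preperiod :: "'v pair_pre_digraph \<Rightarrow> 'v certificate \<Rightarrow> nat" where
  "preperiod G c = (LEAST n. \<exists>m>0. pair_orbit G c (n + m) = pair_orbit G c n)"

definition eventual_period :: "'v pair_pre_digraph \<Rightarrow> 'v certificate \<Rightarrow> nat" where
  "eventual_period G c =
     (LEAST m. 0 < m \<and> pair_orbit G c (preperiod G c + m) = pair_orbit G c (preperiod G c))"

section \<open>Record systems and translations\<close>

type_synonym 'v recsys = "'v certificate set"

definition record_pair :: "'v pair_pre_digraph \<Rightarrow> 'v rel set \<Rightarrow> 'v recsys \<Rightarrow> 'v set set" where
  "record_pair G \<P> X = the_elem (class_pair G \<P> ` X)"

definition record_support :: "'v pair_pre_digraph \<Rightarrow> 'v recsys \<Rightarrow> 'v set" where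
  "record_support G X = (\<Union>c\<in>X. operational_support G c)"

definition representatives :: "'v pair_pre_digraph \<Rightarrow> 'v recsys \<Rightarrow> 'v set \<Rightarrow> 'v set" where
  "representatives G X k = record_support G X \<inter> k"

definition record_system :: "'v pair_pre_digraph \<Rightarrow> 'v rel set \<Rightarrow> 'v recsys \<Rightarrow> bool" where
  "record_system G \<P> X \<longleftrightarrow>
     finite X \<and> X \<noteq> {} \<and> (\<forall>c\<in>X. wpu_certificate G \<P> c) \<and>
     (\<exists>K. (\<forall>c\<in>X. class_pair G \<P> c = K) \<and> (\<forall>k\<in>K. representatives G X k \<noteq> {}))"

definition coord :: "nat \<Rightarrow> 'a \<times> 'a \<Rightarrow> 'a" where
  "coord i x = (if i = 0 then fst x else snd x)"

text \<open>
  An ordered presentation of the class pair of each record system of a family, fixed once for all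
  translations. Re-presenting a system flips the gain of every arc entering or leaving it, so the
  total gain of a closed walk does not depend on the choice.
\<close>

definition presentation ::
    "'v pair_pre_digraph \<Rightarrow> 'v rel set \<Rightarrow> 'v recsys set \<Rightarrow> ('v recsys \<Rightarrow> 'v set \<times> 'v set) \<Rightarrow> bool" where
  "presentation G \<P> F pr \<longleftrightarrow> (\<forall>X\<in>F. {fst (pr X), snd (pr X)} = record_pair G \<P> X)"

definition translation ::
    "'v pair_pre_digraph \<Rightarrow> 'v rel set \<Rightarrow> ('v recsys \<Rightarrow> 'v set \<times> 'v set) \<Rightarrow>
     'v recsys \<Rightarrow> 'v rel list \<Rightarrow> (nat \<Rightarrow> nat) \<Rightarrow> 'v recsys \<Rightarrow> bool" where
  "translation G \<P> pr X t \<pi> Y \<longleftrightarrow>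
     X \<noteq> Y \<and> word_over \<P> t \<and> \<pi> permutes {0, 1} \<and>
     (\<forall>i\<in>{0, 1}. \<forall>v\<in>representatives G X (coord i (pr X)).
        \<exists>w. word_rel G t `` {v} = {w} \<and> w \<in> record_support G Y \<and>
            kappa G \<P> w = coord (\<pi> i) (pr Y))"

definition gain :: "(nat \<Rightarrow> nat) \<Rightarrow> bit" where
  "gain \<pi> = (if evenperm \<pi> then 0 else 1)"

text \<open>
  An arc \<open>(X, t, g, Y)\<close> is the translation from \<open>X\<close> to \<open>Y\<close> induced by the word \<open>t\<close>, labelled by its
  gain \<open>g\<close>.
\<close>

definition translation_graph ::
    "'v pair_pre_digraph \<Rightarrow> 'v rel set \<Rightarrow> ('v recsys \<Rightarrow> 'v set \<times> 'v set) \<Rightarrow> 'v recsys set \<Rightarrow>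
     ('v recsys, 'v recsys \<times> 'v rel list \<times> bit \<times> 'v recsys) pre_digraph" where
  "translation_graph G \<P> pr F =
     \<lparr> verts = F,
       arcs = {(X, t, gain \<pi>, Y) |X t \<pi> Y. X \<in> F \<and> Y \<in> F \<and> translation G \<P> pr X t \<pi> Y},
       tail = (\<lambda>(X, t, g, Y). X),
       head = (\<lambda>(X, t, g, Y). Y) \<rparr>"

section \<open>The WPU-parity property\<close>

definition two_way_cond ::
    "'v pair_pre_digraph \<Rightarrow> 'v rel set \<Rightarrow> ('v recsys \<Rightarrow> 'v set \<times> 'v set) \<Rightarrow> 'v recsys set \<Rightarrow> bool" where
  "two_way_cond G \<P> pr F \<longleftrightarrow> (\<exists>X\<in>F. \<exists>Y\<in>F. X \<noteq> Y \<and>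
     (\<exists>t \<pi>. translation G \<P> pr X t \<pi> Y) \<and> (\<exists>t \<pi>. translation G \<P> pr Y t \<pi> X))"

definition overlap_cond :: "'v pair_pre_digraph \<Rightarrow> 'v recsys set \<Rightarrow> bool" where
  "overlap_cond G F \<longleftrightarrow> (\<exists>X\<in>F. \<exists>Y\<in>F. X \<noteq> Y \<and>
     (let S = record_support G X; S' = record_support G Y in
      S \<subset> S' \<or> S' \<subset> S \<or> (S \<inter> S' \<noteq> {} \<and> \<not> S \<subseteq> S' \<and> \<not> S' \<subseteq> S)))"

definition periodic_read_cond :: "'v pair_pre_digraph \<Rightarrow> 'v rel set \<Rightarrow> 'v recsys set \<Rightarrow> bool" where
  "periodic_read_cond G \<P> F \<longleftrightarrow>
     (\<exists>X\<in>F. \<exists>Y\<in>F. X \<noteq> Y \<and> (\<exists>c\<in>X. let m = eventual_period G c in 1 < m \<and>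
       (\<exists>j\<in>{0, 1}. \<exists>r y. word_over \<P> r \<and>
          (\<forall>h<m. word_rel G r `` {coord j (the (pair_orbit G c (preperiod G c + h)))} = {y h} \<and>
                 y h \<in> record_support G Y \<and> kappa G \<P> (y h) \<in> record_pair G \<P> Y) \<and>
          (\<exists>h<m. \<exists>h'<m. kappa G \<P> (y h) \<noteq> kappa G \<P> (y h')))))"

definition odd_cycle_cond ::
    "'v pair_pre_digraph \<Rightarrow> 'v rel set \<Rightarrow> ('v recsys \<Rightarrow> 'v set \<times> 'v set) \<Rightarrow> 'v recsys set \<Rightarrow> bool" where
  "odd_cycle_cond G \<P> pr F \<longleftrightarrow>
     (\<exists>X walk. pre_digraph.awalk (translation_graph G \<P> pr F) X walk X \<and>
        (\<Sum>(_, _, g, _)\<leftarrow>walk. g) = 1)"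

definition wpu_parity :: "'v pair_pre_digraph \<Rightarrow> 'v rel set \<Rightarrow> nat" where
  "wpu_parity G \<P> = of_bool (\<exists>F pr.
     finite F \<and> (\<forall>X\<in>F. record_system G \<P> X) \<and> presentation G \<P> F pr \<and>
     2 \<le> card F \<and> two_way_cond G \<P> pr F \<and> overlap_cond G F \<and>
     periodic_read_cond G \<P> F \<and> odd_cycle_cond G \<P> pr F)"

end

theory Submission
  imports Defs
begin

text \<open>
  If a word \<open>z\<close> swaps two inequivalent states \<open>p\<close> and \<open>q\<close> that a fork and an offload can write, then
  the record system of this orbit and a copy of it with use word \<open>zzz\<close> are translated into each other
  by \<open>z\<close> (odd) and \<open>zz\<close> (even), and \<open>z\<close> reads one off the period-two orbit of the other. Adding any
  record system whose support meets \<open>{p, q}\<close> and leaves it yields the property \<open>H\<close>. In each of the four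
  graphs a single swap of two arcs produces such a word. Class inequalities already hold in the first
  refinement round, because the states in question enable different blocks.

  For the second half, a partition with the profile of the opposite-diamond partition that breaks no
  opposite pair is a coarsening of it with equally many blocks, hence equal to it; and the
  opposite-diamond partition is invariant under automorphisms, so its orbit is a single point.
\<close>

section \<open>Strong components\<close>

text \<open>Record systems are sets of certificates, so one orbit already supplies two distinct
  systems once a certificate is varied without touching its orbit. The use word can be varied:
  \<open>zzz\<close> acts on \<open>{p, q}\<close> like \<open>z\<close> but is a longer word. With
  the same ordered class pair for both copies, going out by \<open>z\<close> and back by
  \<open>zz\<close> has total gain 1. Equal supports do not qualify for the overlap condition, which
  is why a third system is needed.

  The main obstacle is the graph itself: a strong component selected by a definite description among
  multisets of terms, numbered through strings. This is reduced to checks on finite lists that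
  \<open>code_simp\<close> evaluates. Sorted term lists stand for states. The core is not searched
  for but listed, together with a layering of the other sources that bounds every competing
  component. A state that is not a source has no outgoing explored transition, so it forms a
  component by itself and need not be listed.\<close>

definition mutual_class :: "'v rel \<Rightarrow> 'v \<Rightarrow> 'v set" where
  "mutual_class R u = {v. (u, v) \<in> R\<^sup>* \<and> (v, u) \<in> R\<^sup>*}"

lemma mutual_class_self: "u \<in> mutual_class R u"
  by (simp add: mutual_class_def)

lemma mutual_class_eq_iff: "mutual_class R u = mutual_class R v \<longleftrightarrow> v \<in> mutual_class R u"
  unfolding mutual_class_def by (auto intro: rtrancl_trans)

text \<open>Library reachability requires the start to be a vertex, whereas the reflexive closure
  relates every element to itself. The extra conjunct accounts for this difference.\<close>

lemma reachable_with_proj_iff: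
  assumes "parcs H \<subseteq> pverts H \<times> pverts H"
  shows "u \<rightarrow>\<^sup>*\<^bsub>with_proj H\<^esub> v \<longleftrightarrow> u \<in> pverts H \<and> (u, v) \<in> (parcs H)\<^sup>*"
proof -
  interpret pair_wf_digraph H
    using assms by unfold_locales auto
  show ?thesis
  proof
    assume *: "u \<rightarrow>\<^sup>*\<^bsub>with_proj H\<^esub> v"
    then show "u \<in> pverts H \<and> (u, v) \<in> (parcs H)\<^sup>*"
      using reachable_in_verts(1)[OF *] reachable_rtranclI[OF *] by simp
  next
    assume "u \<in> pverts H \<and> (u, v) \<in> (parcs H)\<^sup>*"
    then have "(u, v) \<in> (parcs H)\<^sup>*" "u \<in> pverts H" by auto
    then show "u \<rightarrow>\<^sup>*\<^bsub>with_proj H\<^esub> v"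
    proof (induction rule: rtrancl_induct)
      case base
      then show ?case by (rule reachable_refl)
    next
      case (step y z)
      then show ?case
        by (meson reachable_adj_trans with_proj_simps(3))
    qed
  qed
qed

text \<open>Used for the opposite graph and for the explored transition graph, so that both can be
  treated with plain relational closures.\<close>

lemma sccs_verts_eq_mutual_classes:
  assumes wf: "parcs H \<subseteq> pverts H \<times> pverts H"
  shows "pre_digraph.sccs_verts (with_proj H) = mutual_class (parcs H) ` pverts H"
proof -
  note reach = reachable_with_proj_iff[OF wf]
  have dom: "v \<in> pverts H" if "(u, v) \<in> (parcs H)\<^sup>*" "u \<in> pverts H" for u v
    using that wf by (induction rule: rtrancl_induct) auto
  show ?thesis
    unfolding pre_digraph.sccs_verts_def reach
  proof (intro set_eqI iffI)
    fix S
    assume S: "S \<in> {S. S \<noteq> {} \<and>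
      (\<forall>u\<in>S. \<forall>v\<in>S. u \<in> pverts H \<and> (u, v) \<in> (parcs H)\<^sup>*) \<and>
      (\<forall>u\<in>S. \<forall>v. v \<notin> S \<longrightarrow>
        \<not> (u \<in> pverts H \<and> (u, v) \<in> (parcs H)\<^sup>*) \<or> \<not> (v \<in> pverts H \<and> (v, u) \<in> (parcs H)\<^sup>*))}"
    then obtain u where u: "u \<in> S" by auto
    then have uV: "u \<in> pverts H" using S by auto
    have "S = mutual_class (parcs H) u"
      unfolding mutual_class_def using S u uV dom by blast
    then show "S \<in> mutual_class (parcs H) ` pverts H" using uV by auto
  next
    fix S
    assume "S \<in> mutual_class (parcs H) ` pverts H"
    then obtain u where u: "u \<in> pverts H" and S: "S = mutual_class (parcs H) u" by auto
    have in_S: "v \<in> S \<longleftrightarrow> (u, v) \<in> (parcs H)\<^sup>* \<and> (v, u) \<in> (parcs H)\<^sup>*" for v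
      unfolding S mutual_class_def by simp
    have "S \<noteq> {}" using in_S[of u] by auto
    moreover have "v \<in> pverts H \<and> (v, w) \<in> (parcs H)\<^sup>*" if "v \<in> S" "w \<in> S" for v w
      using that in_S[of v] in_S[of w] dom[of u v] u by (auto intro: rtrancl_trans[of v u])
    moreover have "w \<in> S" if "v \<in> S" "(v, w) \<in> (parcs H)\<^sup>*" "(w, v) \<in> (parcs H)\<^sup>*" for v w
      using that in_S[of v] in_S[of w] rtrancl_trans[of u v _ w] rtrancl_trans[of w v _ u] by blast
    ultimately show "S \<in> {S. S \<noteq> {} \<and>
      (\<forall>u\<in>S. \<forall>v\<in>S. u \<in> pverts H \<and> (u, v) \<in> (parcs H)\<^sup>*) \<and>
      (\<forall>u\<in>S. \<forall>v. v \<notin> S \<longrightarrow>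
        \<not> (u \<in> pverts H \<and> (u, v) \<in> (parcs H)\<^sup>*) \<or> \<not> (v \<in> pverts H \<and> (v, u) \<in> (parcs H)\<^sup>*))}"
      by blast
  qed
qed

lemma partition_on_mutual_classes:
  assumes "\<And>u. u \<in> V \<Longrightarrow> mutual_class R u \<subseteq> V"
  shows "partition_on V (mutual_class R ` V)"
proof (rule partition_onI)
  show "\<Union>(mutual_class R ` V) = V"
    using assms mutual_class_self by fast
  show "disjnt p q" if "p \<in> mutual_class R ` V" "q \<in> mutual_class R ` V" "p \<noteq> q" for p q
    using that by (auto simp: disjnt_iff mutual_class_eq_iff[symmetric])
  show "{} \<notin> mutual_class R ` V"
    using mutual_class_self by fast
qed

section \<open>Components of the opposite graph\<close>

lemma opposite_graph_wf: "parcs (opposite_graph G) \<subseteq> pverts (opposite_graph G) \<times> pverts (opposite_graph G)"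
  by (auto simp: opposite_graph_def opposite_pairs_def diamond_pattern_def doubleton_eq_iff)

lemma sym_opposite_graph: "sym (parcs (opposite_graph G))"
  by (auto simp: opposite_graph_def sym_def insert_commute)

lemma mutual_class_opposite_graph:
  "mutual_class (parcs (opposite_graph G)) e = (parcs (opposite_graph G))\<^sup>* `` {e}"
  using sym_rtrancl[OF sym_opposite_graph, of G] by (auto simp: mutual_class_def sym_def)

lemma opposite_partition_eq:
  "opposite_partition G = (\<lambda>e. (parcs (opposite_graph G))\<^sup>* `` {e}) ` parcs G"
  unfolding opposite_partition_def sccs_verts_eq_mutual_classes[OF opposite_graph_wf]
  by (simp add: mutual_class_opposite_graph) (simp add: opposite_graph_def)

lemma opposite_reachable_in_arcs:
  assumes "(e, f) \<in> (parcs (opposite_graph G))\<^sup>*" "e \<in> parcs G"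
  shows "f \<in> parcs G"
proof -
  have "pverts (opposite_graph G) = parcs G" by (simp add: opposite_graph_def)
  then have "parcs (opposite_graph G) \<subseteq> parcs G \<times> parcs G" using opposite_graph_wf[of G] by simp
  with assms show ?thesis by (induction rule: rtrancl_induct) auto
qed

lemma partition_on_opposite_partition: "partition_on (parcs G) (opposite_partition G)"
proof -
  have "partition_on (parcs G) (mutual_class (parcs (opposite_graph G)) ` parcs G)"
    by (rule partition_on_mutual_classes)
      (auto simp: mutual_class_opposite_graph opposite_reachable_in_arcs)
  then show ?thesis
    by (simp add: opposite_partition_eq mutual_class_opposite_graph)
qed

text \<open>A way to recognise a proposed list of blocks: reachability from one root puts a block
  inside a component, and closedness puts the component inside the block. One root is enough because
  symmetry makes any member reach the root back.\<close>

lemma opposite_partition_unique: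
  assumes part: "partition_on (parcs G) \<P>"
    and conn: "\<And>C. C \<in> \<P> \<Longrightarrow> \<exists>e\<in>C. C \<subseteq> (parcs (opposite_graph G))\<^sup>* `` {e}"
    and closed: "\<And>C. C \<in> \<P> \<Longrightarrow> parcs (opposite_graph G) `` C \<subseteq> C"
  shows "opposite_partition G = \<P>"
proof -
  let ?R = "parcs (opposite_graph G)"
  have sym: "(f, e) \<in> ?R\<^sup>*" if "(e, f) \<in> ?R\<^sup>*" for e f
    using that sym_rtrancl[OF sym_opposite_graph] by (rule symD[rotated])
  have cl: "?R\<^sup>* `` {e} = C" if C: "C \<in> \<P>" and e: "e \<in> C" for C e
  proof
    have "?R\<^sup>* `` C \<subseteq> C"
      using Image_closed_trancl[OF closed[OF C]] by simp
    then show "?R\<^sup>* `` {e} \<subseteq> C" using e by auto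
    obtain e0 where e0: "e0 \<in> C" "C \<subseteq> ?R\<^sup>* `` {e0}" using conn[OF C] by auto
    then have "(e, e0) \<in> ?R\<^sup>*" using e sym by blast
    then show "C \<subseteq> ?R\<^sup>* `` {e}" using e0 by (auto intro: rtrancl_trans)
  qed
  have U: "\<Union>\<P> = parcs G" and ne: "{} \<notin> \<P>"
    using part by (auto simp: partition_on_def)
  show ?thesis
    unfolding opposite_partition_eq
  proof (intro set_eqI iffI)
    fix C assume "C \<in> (\<lambda>e. ?R\<^sup>* `` {e}) ` parcs G"
    then show "C \<in> \<P>" using U cl by auto
  next
    fix C assume C: "C \<in> \<P>"
    then obtain e where "e \<in> C" using ne by (metis ex_in_conv)
    then show "C \<in> (\<lambda>e. ?R\<^sup>* `` {e}) ` parcs G" using cl[OF C] U C by blast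
  qed
qed

section \<open>Swaps and the orbit of the opposite-diamond partition\<close>

text \<open>The arc is needed from the new partition to the old one, so besides counting the proof
  exhibits the reverse swap.\<close>

lemma swapped_partition:
  assumes part: "partition_on E P" and fin: "finite E"
    and A: "A \<in> P" and B: "B \<in> P" and AB: "A \<noteq> B" and e: "e \<in> A" and f: "f \<in> B"
    and P': "P' = (P - {A, B}) \<union> {(A - {e}) \<union> {f}, (B - {f}) \<union> {e}}"
  shows "partition_on E P'" "profile P' = profile P"
    "P' \<noteq> P \<Longrightarrow> (P', P) \<in> parcs (swap_graph (profile P) E)"
proof -
  let ?A = "(A - {e}) \<union> {f}" and ?B = "(B - {f}) \<union> {e}"
  let ?R = "P - {A, B}"
  have U: "\<Union>P = E" and ne: "{} \<notin> P" and dis: "\<And>X Y. X \<in> P \<Longrightarrow> Y \<in> P \<Longrightarrow> X \<noteq> Y \<Longrightarrow> X \<inter> Y = {}"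
    using part by (auto simp: partition_on_def disjoint_def)
  have dAB: "A \<inter> B = {}" by (rule dis[OF A B AB])
  have dA: "X \<inter> A = {}" and dB: "X \<inter> B = {}" if "X \<in> ?R" for X
    using that dis[OF _ A] dis[OF _ B] by auto
  have fB: "f \<notin> A" and eA: "e \<notin> B" using dAB e f by auto
  have ef: "e \<noteq> f" using e fB by auto
  have AB': "?A \<inter> ?B = {}" using dAB ef by auto
  have dA': "X \<inter> ?A = {}" and dB': "X \<inter> ?B = {}" if "X \<in> ?R" for X
    using dA[OF that] dB[OF that] e f by auto
  \<comment> \<open>Partitions are sets, so a new block equal to a remaining one would merge with it
    and spoil the profile. Being nonempty and disjoint from the remaining blocks excludes
    this.\<close>
  have A'R: "?A \<notin> ?R" and B'R: "?B \<notin> ?R"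
    using dA' dB' by blast+
  have AB'n: "?A \<noteq> ?B" using AB' by blast
  show part': "partition_on E P'"
    unfolding P'
  proof (rule partition_onI)
    show "\<Union>(?R \<union> {?A, ?B}) = E"
    proof -
      have "\<Union>(?R \<union> {?A, ?B}) = \<Union>?R \<union> (?A \<union> ?B)" by auto
      also have "?A \<union> ?B = A \<union> B" using e f ef by auto
      also have "\<Union>?R \<union> (A \<union> B) = \<Union>P" using A B by auto
      finally show ?thesis using U by simp
    qed
    show "disjnt p q" if "p \<in> ?R \<union> {?A, ?B}" "q \<in> ?R \<union> {?A, ?B}" "p \<noteq> q" for p q
    proof -
      note pq = that
      consider "p \<in> ?R" "q \<in> ?R" | "p \<in> ?R" "q \<in> {?A, ?B}" | "p \<in> {?A, ?B}" "q \<in> ?R"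
        | "p \<in> {?A, ?B}" "q \<in> {?A, ?B}"
        using pq(1,2) unfolding Un_iff by metis
      then show ?thesis
      proof cases
        case 1
        then show ?thesis using dis[of p q] pq(3) by (simp add: disjnt_def)
      next
        case 2
        then show ?thesis using dA'[of p] dB'[of p] by (fastforce simp: disjnt_def)
      next
        case 3
        then show ?thesis using dA'[of q] dB'[of q] by (fastforce simp: disjnt_def Int_commute)
      next
        case 4
        then show ?thesis using AB' pq(3) by (fastforce simp: disjnt_def)
      qed
    qed
    show "{} \<notin> ?R \<union> {?A, ?B}"
      using ne by auto
  qed
  have finP: "finite P"
    using finite_elements[OF fin part] .
  then have finR: "finite ?R" by simp
  have finX: "finite X" if "X \<in> P" for X
    using that U fin by (metis Union_upper finite_subset)
  have cA: "card ?A = card A"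
    using fB finX[OF A] card_Suc_Diff1[OF finX[OF A] e] by simp
  have cB: "card ?B = card B"
    using eA finX[OF B] card_Suc_Diff1[OF finX[OF B] f] by simp
  have "profile P' = profile ?R + {#card ?A, card ?B#}"
  proof -
    have P'': "P' = insert ?A (insert ?B ?R)" unfolding P' by blast
    show ?thesis
      unfolding profile_def P'' using finR A'R B'R AB'n
      by (subst mset_set.insert; simp)+
  qed
  moreover have "profile P = profile ?R + {#card A, card B#}"
  proof -
    have P'': "P = insert A (insert B ?R)" using A B by blast
    have "mset_set (insert A (insert B ?R)) = add_mset A (add_mset B (mset_set ?R))"
      using finR AB by simp
    then show ?thesis
      unfolding profile_def by (subst P'') simp
  qed
  ultimately show prof: "profile P' = profile P"
    using cA cB by simp
  have undo: "P = (P' - {?A, ?B}) \<union> {(?A - {f}) \<union> {e}, (?B - {e}) \<union> {f}}"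
  proof -
    have "(?A - {f}) \<union> {e} = A" "(?B - {e}) \<union> {f} = B" using e f fB eA by auto
    moreover have "P' - {?A, ?B} = ?R" unfolding P' using A'R B'R by auto
    ultimately show ?thesis using A B by auto
  qed
  show "(P', P) \<in> parcs (swap_graph (profile P) E)" if "P' \<noteq> P"
  proof -
    have ex: "\<exists>A\<in>P'. \<exists>B\<in>P'. A \<noteq> B \<and> (\<exists>e\<in>A. \<exists>f\<in>B.
        P = (P' - {A, B}) \<union> {(A - {e}) \<union> {f}, (B - {f}) \<union> {e}})"
    proof (intro bexI conjI)
      show "P = (P' - {?A, ?B}) \<union> {(?A - {f}) \<union> {e}, (?B - {e}) \<union> {f}}" by (rule undo)
      show "?A \<noteq> ?B" by (rule AB'n)
      show "?A \<in> P'" "?B \<in> P'" unfolding P' by simp_all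
    qed simp_all
    have "P' \<in> edge_partitions (profile P) E" "P \<in> edge_partitions (profile P) E"
      using part part' prof by (simp_all only: edge_partitions_def mem_Collect_eq simp_thms)
    with ex show ?thesis
      unfolding swap_graph_def pair_pre_digraph.select_convs mem_Collect_eq prod.case
      using that by (intro conjI) (assumption | rule not_sym)+
  qed
qed

section \<open>Refinements with equally many blocks\<close>

lemma size_profile: "finite P \<Longrightarrow> size (profile P) = card P"
  by (simp add: profile_def)

text \<open>Sending a block of \<open>P\<close> to the block of \<open>Q\<close> around it is onto,
  since every block of \<open>Q\<close> has a point and that point lies in some block of
  \<open>P\<close>. Equal cardinality makes it injective, so no block of \<open>Q\<close> can absorb
  points of two blocks of \<open>P\<close>.\<close>

lemma refinement_eq_if_card_eq:
  assumes P: "partition_on E P" and Q: "partition_on E Q" and fin: "finite E"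
    and ref: "\<And>C. C \<in> P \<Longrightarrow> \<exists>D\<in>Q. C \<subseteq> D" and card: "card P = card Q"
  shows "P = Q"
proof -
  obtain h where h: "h C \<in> Q" "C \<subseteq> h C" if "C \<in> P" for C
    using ref by metis
  have fP: "finite P" using finite_elements[OF fin P] .
  have pP: "\<Union>P = E" "{} \<notin> P" and pQ: "\<Union>Q = E" "{} \<notin> Q"
    and dQ: "\<And>X Y. X \<in> Q \<Longrightarrow> Y \<in> Q \<Longrightarrow> X \<noteq> Y \<Longrightarrow> X \<inter> Y = {}"
    using P Q by (auto simp: partition_on_def disjoint_def)
  have inter: "h C = D" if "C \<in> P" "D \<in> Q" "x \<in> C" "x \<in> D" for C D x
    using dQ[of "h C" D] h[OF that(1)] that by blast
  have "Q \<subseteq> h ` P"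
  proof
    fix D assume D: "D \<in> Q"
    then obtain x where x: "x \<in> D" using pQ by fastforce
    then obtain C where C: "C \<in> P" "x \<in> C" using D pP pQ by blast
    then show "D \<in> h ` P" using inter[OF C(1) D C(2) x] by blast
  qed
  moreover have "h ` P \<subseteq> Q" using h by auto
  ultimately have hP: "h ` P = Q" by simp
  then have inj: "inj_on h P"
    using card eq_card_imp_inj_on[OF fP] by metis
  have "h C = C" if C: "C \<in> P" for C
  proof
    show "C \<subseteq> h C" by (rule h(2)[OF C])
    show "h C \<subseteq> C"
    proof
      fix x assume x: "x \<in> h C"
      then have "x \<in> E" using h(1)[OF C] pQ by auto
      then obtain C' where C': "C' \<in> P" "x \<in> C'" using pP by auto
      have "h C' = h C" by (rule inter[OF C'(1) h(1)[OF C] C'(2) x])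
      then show "x \<in> C" using inj C C' by (auto dest: inj_onD)
    qed
  qed
  then show ?thesis using hP by simp
qed

lemma breaks_opposite_pair_if_neq:
  assumes fin: "finite (parcs G)" and P': "partition_on (parcs G) P'"
    and prof: "profile P' = profile (opposite_partition G)" and neq: "P' \<noteq> opposite_partition G"
  shows "breaks_opposite_pair G P'"
proof (rule ccontr)
  assume nb: "\<not> breaks_opposite_pair G P'"
  let ?R = "parcs (opposite_graph G)"
  note part = partition_on_opposite_partition[of G]
  have U': "\<Union>P' = parcs G"
    and d': "\<And>X Y. X \<in> P' \<Longrightarrow> Y \<in> P' \<Longrightarrow> X \<noteq> Y \<Longrightarrow> X \<inter> Y = {}"
    using P' by (auto simp: partition_on_def disjoint_def)
  have together: "\<exists>C\<in>P'. {e, f} \<subseteq> C" if ef: "(e, f) \<in> ?R" for e f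
  proof -
    obtain x a b y where d: "diamond_pattern G x a b y" "{e, f} \<in> opposite_pairs x a b y"
      using ef by (auto simp: opposite_graph_def)
    then show ?thesis using nb unfolding breaks_opposite_pair_def by metis
  qed
  \<comment> \<open>Each step of the opposite graph is an unbroken pair, so membership in a block of
    \<open>P'\<close> spreads along paths.\<close>
  have stay: "f \<in> D" if ef: "(e, f) \<in> ?R\<^sup>*" and D: "D \<in> P'" "e \<in> D" for e f D
    using ef
  proof (induction rule: rtrancl_induct)
    case base
    then show ?case using D by simp
  next
    case (step y z)
    then obtain C where "C \<in> P'" "y \<in> C" "z \<in> C" using together by blast
    then show ?case using d'[of C D] D step by blast
  qed
  have "\<exists>D\<in>P'. C \<subseteq> D" if "C \<in> opposite_partition G" for C
  proof -
    from that obtain e where e: "e \<in> parcs G" "C = ?R\<^sup>* `` {e}"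
      unfolding opposite_partition_eq by auto
    then obtain D where "D \<in> P'" "e \<in> D" using U' by auto
    then show ?thesis using stay e by blast
  qed
  moreover have "card (opposite_partition G) = card P'"
    using prof size_profile finite_elements[OF fin] part P' by metis
  ultimately have "opposite_partition G = P'"
    by (intro refinement_eq_if_card_eq[OF part P' fin])
  with neq show False by simp
qed

section \<open>Invariance under automorphisms\<close>

lemma automorphism_arcs:
  assumes \<phi>: "\<phi> \<in> automorphisms G" and wf: "parcs G \<subseteq> pverts G \<times> pverts G"
  shows "map_prod \<phi> \<phi> ` parcs G = parcs G"
proof -
  have p: "\<phi> permutes pverts G"
    and a: "\<And>u v. u \<in> pverts G \<Longrightarrow> v \<in> pverts G \<Longrightarrow> (\<phi> u, \<phi> v) \<in> parcs G \<longleftrightarrow> (u, v) \<in> parcs G"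
    using \<phi> by (auto simp: automorphisms_def)
  have img: "\<phi> ` pverts G = pverts G" using p by (rule permutes_image)
  show ?thesis
  proof
    show "map_prod \<phi> \<phi> ` parcs G \<subseteq> parcs G" using a wf by auto
    show "parcs G \<subseteq> map_prod \<phi> \<phi> ` parcs G"
    proof
      fix x assume x: "x \<in> parcs G"
      obtain u v where uv: "x = (u, v)" by (cases x)
      then have "u \<in> \<phi> ` pverts G" "v \<in> \<phi> ` pverts G" using x wf img by auto
      then obtain u' v' where "u' \<in> pverts G" "v' \<in> pverts G" "u = \<phi> u'" "v = \<phi> v'" by auto
      then show "x \<in> map_prod \<phi> \<phi> ` parcs G" using x uv a by (force simp: image_iff)
    qed
  qed
qed

lemma automorphism_diamond_pattern:
  assumes \<phi>: "\<phi> \<in> automorphisms G" and d: "diamond_pattern G x a b y"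
  shows "diamond_pattern G (\<phi> x) (\<phi> a) (\<phi> b) (\<phi> y)"
proof -
  have p: "\<phi> permutes pverts G"
    and a: "\<And>u v. u \<in> pverts G \<Longrightarrow> v \<in> pverts G \<Longrightarrow> (\<phi> u, \<phi> v) \<in> parcs G \<longleftrightarrow> (u, v) \<in> parcs G"
    using \<phi> by (auto simp: automorphisms_def)
  have "inj \<phi>" using p by (rule permutes_inj)
  moreover have "\<phi> v \<in> pverts G \<longleftrightarrow> v \<in> pverts G" for v using p by (rule permutes_in_image)
  ultimately show ?thesis
    using d a by (auto simp: diamond_pattern_def inj_eq)
qed

lemma automorphism_opposite_step:
  assumes \<phi>: "\<phi> \<in> automorphisms G" and s: "(e, f) \<in> parcs (opposite_graph G)"
  shows "(map_prod \<phi> \<phi> e, map_prod \<phi> \<phi> f) \<in> parcs (opposite_graph G)"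
proof -
  obtain x a b y where d: "diamond_pattern G x a b y" and ef: "{e, f} \<in> opposite_pairs x a b y"
    using s by (auto simp: opposite_graph_def)
  have "{map_prod \<phi> \<phi> e, map_prod \<phi> \<phi> f} = map_prod \<phi> \<phi> ` {e, f}" by simp
  also have "\<dots> \<in> opposite_pairs (\<phi> x) (\<phi> a) (\<phi> b) (\<phi> y)"
  proof -
    have "{e, f} = {(x, a), (b, y)} \<or> {e, f} = {(x, b), (a, y)}"
      using ef by (simp add: opposite_pairs_def)
    then show ?thesis
      by (elim disjE)
        (simp_all only: opposite_pairs_def image_insert image_empty map_prod_simp insert_iff simp_thms)
  qed
  finally show ?thesis
    using automorphism_diamond_pattern[OF \<phi> d] by (auto simp: opposite_graph_def)
qed

lemma aut_orbit_opposite_partition: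
  assumes wf: "parcs G \<subseteq> pverts G \<times> pverts G"
  shows "aut_orbit G (opposite_partition G) \<subseteq> {opposite_partition G}"
proof
  fix P' assume "P' \<in> aut_orbit G (opposite_partition G)"
  then obtain \<phi> where \<phi>: "\<phi> \<in> automorphisms G"
    and P': "P' = (\<lambda>C. map_prod \<phi> \<phi> ` C) ` opposite_partition G"
    by (auto simp: aut_orbit_def)
  let ?R = "parcs (opposite_graph G)" and ?\<psi> = "inv \<phi>"
  have p: "\<phi> permutes pverts G" using \<phi> by (auto simp: automorphisms_def)
  \<comment> \<open>The inverse is again an automorphism; pulling paths back along it yields the
    second inclusion of \<open>cls\<close>.\<close>
  have \<psi>: "?\<psi> \<in> automorphisms G"
    using \<phi> permutes_inv[OF p] permutes_inverses[OF p] permutes_in_image[OF permutes_inv[OF p]]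
    unfolding automorphisms_def by simp (metis)
  have fwd: "(map_prod \<phi> \<phi> e, map_prod \<phi> \<phi> f) \<in> ?R\<^sup>*" if "(e, f) \<in> ?R\<^sup>*" "\<phi> \<in> automorphisms G" for e f \<phi>
    using that(1)
    by (induction rule: rtrancl_induct)
      (auto intro: rtrancl_into_rtrancl automorphism_opposite_step[OF that(2)])
  have inv: "map_prod \<phi> \<phi> (map_prod ?\<psi> ?\<psi> e) = e" "map_prod ?\<psi> ?\<psi> (map_prod \<phi> \<phi> e) = e" for e
    using permutes_inverses[OF p] by (cases e; simp)+
  have cls: "map_prod \<phi> \<phi> ` (?R\<^sup>* `` {e}) = ?R\<^sup>* `` {map_prod \<phi> \<phi> e}" for e
  proof
    show "map_prod \<phi> \<phi> ` (?R\<^sup>* `` {e}) \<subseteq> ?R\<^sup>* `` {map_prod \<phi> \<phi> e}" using fwd[OF _ \<phi>] by auto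
    show "?R\<^sup>* `` {map_prod \<phi> \<phi> e} \<subseteq> map_prod \<phi> \<phi> ` (?R\<^sup>* `` {e})"
    proof
      fix f assume "f \<in> ?R\<^sup>* `` {map_prod \<phi> \<phi> e}"
      then have "(map_prod ?\<psi> ?\<psi> (map_prod \<phi> \<phi> e), map_prod ?\<psi> ?\<psi> f) \<in> ?R\<^sup>*" using fwd[OF _ \<psi>] by blast
      then have "map_prod ?\<psi> ?\<psi> f \<in> ?R\<^sup>* `` {e}" by (simp add: inv)
      then show "f \<in> map_prod \<phi> \<phi> ` (?R\<^sup>* `` {e})" using inv(1)[of f] by (metis imageI)
    qed
  qed
  have "P' = (\<lambda>e. ?R\<^sup>* `` {e}) ` map_prod \<phi> \<phi> ` parcs G"
    unfolding P' opposite_partition_eq image_image cls ..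
  then show "P' \<in> {opposite_partition G}"
    unfolding automorphism_arcs[OF \<phi> wf] opposite_partition_eq by simp
qed

section \<open>Behavioural classes\<close>

lemma behavioural_eq_subset: "behavioural_eq G \<P> t \<subseteq> pverts G \<times> pverts G"
  by (cases t) auto

lemma equiv_behavioural_eq: "equiv (pverts G) (behavioural_eq G \<P> t)"
proof (cases t)
  case 0
  then show ?thesis by (auto simp: equiv_def refl_on_def sym_def trans_def)
next
  case (Suc n)
  then show ?thesis by (auto simp: equiv_def refl_on_def sym_def trans_def)
qed

text \<open>If round \<open>Suc t\<close> refines round \<open>t\<close>, the coarse class of a
  state is determined by its fine class. Hence the set of coarse successor classes is an image of
  the set of fine ones, and equality of the fine sets passes to the coarse sets.\<close>

lemma behavioural_eq_Suc_mono:
  assumes "behavioural_eq G \<P> (Suc t) \<subseteq> behavioural_eq G \<P> t"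
  shows "behavioural_eq G \<P> (Suc (Suc t)) \<subseteq> behavioural_eq G \<P> (Suc t)"
proof -
  let ?B = "behavioural_eq G \<P>"
  have sat: "?B t `` {w} = ?B t `` (?B (Suc t) `` {w})" if "w \<in> pverts G" for w
  proof
    show "?B t `` {w} \<subseteq> ?B t `` (?B (Suc t) `` {w})"
      using equiv_class_self[OF equiv_behavioural_eq that] by blast
    show "?B t `` (?B (Suc t) `` {w}) \<subseteq> ?B t `` {w}"
      using assms equivE[OF equiv_behavioural_eq[of G \<P> t]] unfolding trans_def by blast
  qed
  \<comment> \<open>Blocks are not assumed to stay inside the vertex set here; a target outside it
    has the empty class in both rounds.\<close>
  have out: "?B t `` {w} = {}" "?B (Suc t) `` {w} = {}" if "w \<notin> pverts G" for w
    using that behavioural_eq_subset[of G \<P>] by blast+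
  have sat': "(\<lambda>w. ?B t `` {w}) ` X = (\<lambda>Z. ?B t `` Z) ` (\<lambda>w. ?B (Suc t) `` {w}) ` X" for X
    unfolding image_image
  proof (rule image_cong[OF refl])
    fix w assume "w \<in> X"
    show "?B t `` {w} = ?B t `` (?B (Suc t) `` {w})"
      using sat[of w] out[of w] by (cases "w \<in> pverts G") simp_all
  qed
  show ?thesis
  proof (rule subrelI)
    fix u v assume uv: "(u, v) \<in> ?B (Suc (Suc t))"
    then have V: "u \<in> pverts G" "v \<in> pverts G" and
      eq: "\<And>C. C \<in> \<P> \<Longrightarrow> (\<lambda>w. ?B (Suc t) `` {w}) ` (C `` {u}) = (\<lambda>w. ?B (Suc t) `` {w}) ` (C `` {v})"
      by (auto simp only: behavioural_eq.simps(2)[of G \<P> "Suc t"])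
    have "(\<lambda>w. ?B t `` {w}) ` (C `` {u}) = (\<lambda>w. ?B t `` {w}) ` (C `` {v})" if "C \<in> \<P>" for C
      unfolding sat' eq[OF that] ..
    then show "(u, v) \<in> ?B (Suc t)"
      using V by (simp only: behavioural_eq.simps(2)[of G \<P> t]) blast
  qed
qed

lemma behavioural_eq_decreasing: "behavioural_eq G \<P> (Suc t) \<subseteq> behavioural_eq G \<P> t"
proof (induction t)
  case 0
  then show ?case by (simp add: behavioural_eq_subset del: behavioural_eq.simps(2))
next
  case (Suc t)
  then show ?case by (rule behavioural_eq_Suc_mono)
qed

lemma behavioural_eq_antimono: "s \<le> t \<Longrightarrow> behavioural_eq G \<P> t \<subseteq> behavioural_eq G \<P> s"
  using lift_Suc_antimono_le[of "behavioural_eq G \<P>"] behavioural_eq_decreasing by metis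

lemma behavioural_eq_stabilizes:
  assumes "finite (pverts G)"
  shows "\<exists>t. behavioural_eq G \<P> (Suc t) = behavioural_eq G \<P> t"
proof (rule ccontr)
  let ?B = "behavioural_eq G \<P>"
  assume "\<nexists>t. ?B (Suc t) = ?B t"
  then have less: "?B (Suc t) \<subset> ?B t" for t
    using behavioural_eq_decreasing[of G \<P> t] by blast
  have fin: "finite (?B t)" for t
    using finite_subset[OF behavioural_eq_subset finite_cartesian_product] assms by blast
  \<comment> \<open>Every strict step loses at least one pair, so there cannot be more steps than
    pairs in round 0.\<close>
  have "card (?B t) + t \<le> card (?B 0)" for t
  proof (induction t)
    case (Suc t)
    then show ?case using psubset_card_mono[OF fin less[of t]] by linarith
  qed simp
  from this[of "Suc (card (?B 0))"] show False by simp
qed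

text \<open>Lets classes be told apart without computing the stable equivalence: two states
  separated in any single round have different classes.\<close>

lemma stable_eq_subset:
  assumes fin: "finite (pverts G)"
  shows "stable_eq G \<P> \<subseteq> behavioural_eq G \<P> t"
proof -
  let ?B = "behavioural_eq G \<P>"
  define L where "L = (LEAST t. ?B (Suc t) = ?B t)"
  have L: "?B (Suc L) = ?B L"
    unfolding L_def using behavioural_eq_stabilizes[OF fin] by (rule LeastI_ex)
  have const: "?B (L + k) = ?B L" for k
  proof (induction k)
    case (Suc k)
    then have "?B (Suc (L + k)) = ?B (Suc L)" by simp
    then show ?case using L by simp
  qed simp
  have "?B L \<subseteq> ?B t"
    using const[of t] behavioural_eq_antimono[of t "L + t" G \<P>] by simp
  then show ?thesis by (simp add: stable_eq_def L_def)
qed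

lemma kappa_self: "v \<in> pverts G \<Longrightarrow> v \<in> kappa G \<P> v"
  unfolding kappa_def stable_eq_def by (rule equiv_class_self[OF equiv_behavioural_eq])

lemma kappa_eq_if_in: "w \<in> kappa G \<P> v \<Longrightarrow> kappa G \<P> w = kappa G \<P> v"
  unfolding kappa_def stable_eq_def using equiv_class_eq[OF equiv_behavioural_eq] by fastforce

text \<open>Round 0 has only one class, so for blocks inside the vertex set the first refinement
  round records exactly which blocks are enabled at a state.\<close>

definition enabled_differ :: "'v rel set \<Rightarrow> 'v \<Rightarrow> 'v \<Rightarrow> bool" where
  "enabled_differ \<P> u v \<longleftrightarrow> (\<exists>C\<in>\<P>. (C `` {u} = {}) \<noteq> (C `` {v} = {}))"

lemma kappa_neq_if_enabled_differ:
  assumes fin: "finite (pverts G)" and v: "v \<in> pverts G" and d: "enabled_differ \<P> u v"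
  shows "kappa G \<P> u \<noteq> kappa G \<P> v"
proof
  assume "kappa G \<P> u = kappa G \<P> v"
  then have "v \<in> kappa G \<P> u" using kappa_self[OF v] by simp
  then have "(u, v) \<in> behavioural_eq G \<P> (Suc 0)"
    using stable_eq_subset[OF fin, of \<P> "Suc 0"] unfolding kappa_def by blast
  \<comment> \<open>Equal sets of successor classes are empty together, and an image is empty
    exactly when the set it comes from is.\<close>
  then have "(C `` {u} = {}) = (C `` {v} = {})" if "C \<in> \<P>" for C
    using that by (simp add: image_is_empty[symmetric] del: image_is_empty) (metis image_is_empty)
  then show False using d by (auto simp: enabled_differ_def)
qed

section \<open>Words\<close>

lemma word_rel_Nil [simp]: "word_rel G [] = Id_on (pverts G)"
  and word_rel_Cons [simp]: "word_rel G (C # w) = C O word_rel G w"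
  by (simp_all add: word_rel_def)

text \<open>Runs a word by successive images instead of composing relations, which is the form that
  can be evaluated on lists of arcs.\<close>

definition word_image :: "'v rel list \<Rightarrow> 'v set \<Rightarrow> 'v set" where
  "word_image w X = fold (\<lambda>C Y. C `` Y) w X"

lemma word_image_append [simp]: "word_image (w @ w') X = word_image w' (word_image w X)"
  by (simp add: word_image_def)

text \<open>\<open>word_rel\<close> ends in the identity on the vertices and would cut off images
  outside them, so blocks must stay inside. Finiteness makes the refinement stabilise.\<close>

locale labelled_graph =
  fixes G :: "'v pair_pre_digraph" and \<P> :: "'v rel set"
  assumes finite_pverts: "finite (pverts G)"
    and block_subset: "\<And>C. C \<in> \<P> \<Longrightarrow> C \<subseteq> pverts G \<times> pverts G"
begin

lemma word_rel_Image:
  assumes "set w \<subseteq> \<P>" "X \<subseteq> pverts G"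
  shows "word_rel G w `` X = word_image w X"
  using assms
proof (induction w arbitrary: X)
  case Nil
  then show ?case by (auto simp: word_image_def)
next
  case (Cons C w)
  have "C `` X \<subseteq> pverts G" using block_subset[of C] Cons.prems by auto
  then have "word_rel G w `` (C `` X) = word_image w (C `` X)" using Cons by simp
  then show ?case by (simp add: relcomp_Image word_image_def)
qed

lemma word_image_in_pverts:
  assumes "set w \<subseteq> \<P>" "X \<subseteq> pverts G"
  shows "word_image w X \<subseteq> pverts G"
  using assms
proof (induction w arbitrary: X)
  case (Cons C w)
  have "C `` X \<subseteq> pverts G" using block_subset[of C] Cons.prems by auto
  then have "word_image w (C `` X) \<subseteq> pverts G" using Cons by simp
  then show ?case by (simp add: word_image_def)
qed (simp add: word_image_def)

lemma kappa_neq: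
  assumes "v \<in> pverts G" "enabled_differ \<P> u v"
  shows "kappa G \<P> u \<noteq> kappa G \<P> v"
  by (rule kappa_neq_if_enabled_differ[OF finite_pverts assms])

section \<open>Certificates\<close>

lemma pair_step_Some:
  assumes "set z \<subseteq> \<P>" "u \<in> pverts G" "v \<in> pverts G" "word_image z {u} = {u'}" "word_image z {v} = {v'}"
  shows "pair_step G z (u, v) = Some (u', v')"
  using word_rel_Image[of z "{u}"] word_rel_Image[of z "{v}"] assms by (simp add: pair_step_def)

lemma pair_orbit_0: "pair_orbit G c 0 = Some (state_p c, state_q c)"
  and pair_orbit_Suc: "pair_orbit G c (Suc n) = Option.bind (pair_orbit G c n) (pair_step G (orbit_word c))"
  by (simp_all add: pair_orbit_def)

text \<open>
  The set \<open>T\<close> collects the pairs visited by the persistent orbit. Class inequalities are read off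
  from the first refinement round, i.e. from which blocks are enabled.
\<close>

definition certificate_data :: "'v certificate \<Rightarrow> ('v \<times> 'v) set \<Rightarrow> 'v \<Rightarrow> 'v \<Rightarrow> bool" where
  "certificate_data c T p' q' \<longleftrightarrow>
     fork_state c \<in> pverts G \<and> channel_A c \<in> \<P> \<and> channel_B c \<in> \<P> \<and>
     (fork_state c, fork_l c) \<in> channel_A c \<and> (fork_state c, fork_r c) \<in> channel_B c \<and>
     enabled_differ \<P> (fork_l c) (fork_r c) \<and>
     set (offload_word c) \<subseteq> \<P> \<and>
     word_image (offload_word c) {fork_l c} = {state_p c} \<and>
     word_image (offload_word c) {fork_r c} = {state_q c} \<and>
     (\<forall>C\<in>{channel_A c, channel_B c}. C `` {state_p c} \<noteq> {} \<longleftrightarrow> C `` {state_q c} \<noteq> {}) \<and>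
     word_over \<P> (orbit_word c) \<and> word_over \<P> (use_word c) \<and>
     (state_p c, state_q c) \<in> T \<and> (p', q') \<in> T \<and>
     (\<forall>(u, v)\<in>T. enabled_differ \<P> u v \<and>
        (\<exists>u' v'. word_image (orbit_word c) {u} = {u'} \<and> word_image (orbit_word c) {v} = {v'} \<and> (u', v') \<in> T)) \<and>
     word_image (orbit_word c) {state_p c} = {p'} \<and> word_image (orbit_word c) {state_q c} = {q'} \<and>
     word_image (use_word c) {state_p c} = {p'} \<and> word_image (use_word c) {state_q c} = {q'} \<and>
     (enabled_differ \<P> (state_p c) p' \<or> enabled_differ \<P> (state_q c) q')"

lemma certificate_dataD:
  assumes "certificate_data c T p' q'"
  shows "fork_state c \<in> pverts G" "channel_A c \<in> \<P>" "channel_B c \<in> \<P>"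
    and "(fork_state c, fork_l c) \<in> channel_A c" "(fork_state c, fork_r c) \<in> channel_B c"
    and certificate_data_fork: "enabled_differ \<P> (fork_l c) (fork_r c)"
    and certificate_data_offload: "set (offload_word c) \<subseteq> \<P>"
      "word_image (offload_word c) {fork_l c} = {state_p c}"
      "word_image (offload_word c) {fork_r c} = {state_q c}"
      "\<forall>C\<in>{channel_A c, channel_B c}. C `` {state_p c} \<noteq> {} \<longleftrightarrow> C `` {state_q c} \<noteq> {}"
    and certificate_data_words: "word_over \<P> (orbit_word c)" "word_over \<P> (use_word c)"
    and certificate_data_in: "(state_p c, state_q c) \<in> T" "(p', q') \<in> T"
    and certificate_data_step: "\<forall>(u, v)\<in>T. enabled_differ \<P> u v \<and>
        (\<exists>u' v'. word_image (orbit_word c) {u} = {u'} \<and> word_image (orbit_word c) {v} = {v'} \<and> (u', v') \<in> T)"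
    and certificate_data_first: "word_image (orbit_word c) {state_p c} = {p'}"
      "word_image (orbit_word c) {state_q c} = {q'}"
    and certificate_data_use: "word_image (use_word c) {state_p c} = {p'}"
      "word_image (use_word c) {state_q c} = {q'}"
    and certificate_data_move: "enabled_differ \<P> (state_p c) p' \<or> enabled_differ \<P> (state_q c) q'"
  using assms unfolding certificate_data_def by - (elim conjE, assumption)+

lemma certificate_data_sets:
  assumes "certificate_data c T p' q'"
  shows "set (orbit_word c) \<subseteq> \<P>" "set (use_word c) \<subseteq> \<P>"
  using certificate_data_words[OF assms] by (simp_all add: word_over_def)

lemma word_image_singleton_pverts:
  assumes "set w \<subseteq> \<P>" "v \<in> pverts G" "word_image w {v} = {v'}"
  shows "v' \<in> pverts G"
  using word_image_in_pverts[OF assms(1), of "{v}"] assms(2,3) by simp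

lemma word_rel_Image_singleton:
  assumes "set w \<subseteq> \<P>" "v \<in> pverts G"
  shows "word_rel G w `` {v} = word_image w {v}"
  using word_rel_Image[OF assms(1)] assms(2) by simp

lemma certificate_data_pverts:
  assumes "certificate_data c T p' q'"
  shows "fork_l c \<in> pverts G" "fork_r c \<in> pverts G" "state_p c \<in> pverts G" "state_q c \<in> pverts G"
    "p' \<in> pverts G" "q' \<in> pverts G"
proof -
  note off = certificate_data_offload[OF assms] and z = certificate_data_sets(1)[OF assms]
    and first = certificate_data_first[OF assms]
  show l: "fork_l c \<in> pverts G"
    using certificate_dataD(2,4)[OF assms] block_subset by blast
  show r: "fork_r c \<in> pverts G"
    using certificate_dataD(3,5)[OF assms] block_subset by blast
  show p: "state_p c \<in> pverts G" by (rule word_image_singleton_pverts[OF off(1) l off(2)])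
  show q: "state_q c \<in> pverts G" by (rule word_image_singleton_pverts[OF off(1) r off(3)])
  show "p' \<in> pverts G" by (rule word_image_singleton_pverts[OF z p first(1)])
  show "q' \<in> pverts G" by (rule word_image_singleton_pverts[OF z q first(2)])
qed

lemma pair_orbit_first:
  assumes "certificate_data c T p' q'"
  shows "pair_orbit G c (Suc 0) = Some (p', q')"
  using pair_step_Some[OF certificate_data_sets(1)[OF assms] certificate_data_pverts(3,4)[OF assms]
      certificate_data_first[OF assms]]
  by (simp add: pair_orbit_Suc pair_orbit_0)

text \<open>\<open>T\<close> contains the initial pair and is closed under the orbit word, so
  infinitely many conditions on iterates reduce to a check on the pairs of \<open>T\<close>.\<close>

lemma pair_orbit_in:
  assumes "certificate_data c T p' q'"
  shows "\<exists>u v. pair_orbit G c n = Some (u, v) \<and> (u, v) \<in> T \<and> u \<in> pverts G \<and> v \<in> pverts G"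
proof (induction n)
  case 0
  show ?case
    using certificate_data_in(1)[OF assms] certificate_data_pverts(3,4)[OF assms] by (simp add: pair_orbit_0)
next
  case (Suc n)
  then obtain u v where uv: "pair_orbit G c n = Some (u, v)" "(u, v) \<in> T" "u \<in> pverts G" "v \<in> pverts G"
    by blast
  note z = certificate_data_sets(1)[OF assms]
  obtain u' v' where u'v': "word_image (orbit_word c) {u} = {u'}"
    "word_image (orbit_word c) {v} = {v'}" "(u', v') \<in> T"
    using bspec[OF certificate_data_step[OF assms] uv(2)] unfolding prod.case by blast
  have "pair_orbit G c (Suc n) = Some (u', v')"
    using uv(1) pair_step_Some[OF z uv(3,4) u'v'(1,2)] by (simp add: pair_orbit_Suc)
  with u'v'(3) word_image_singleton_pverts[OF z uv(3) u'v'(1)] word_image_singleton_pverts[OF z uv(4) u'v'(2)]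
  show ?case by blast
qed

lemma certificate_data_kappa_neq:
  assumes d: "certificate_data c T p' q'" and "(u, v) \<in> T" "v \<in> pverts G"
  shows "kappa G \<P> u \<noteq> kappa G \<P> v"
  using bspec[OF certificate_data_step[OF d] assms(2)] kappa_neq[OF assms(3)] unfolding prod.case by blast

text \<open>The orbit word and the use word both send \<open>(p, q)\<close> to
  \<open>(p', q')\<close>, and some coordinate changes its class. This one fact makes both words
  different from the identity, makes the first iterate differ from its predecessor, and makes the
  use profile differ from the current class pair.\<close>

lemma wpu_certificate_if_data:
  assumes d: "certificate_data c T p' q'"
  shows "wpu_certificate G \<P> c"
proof -
  note V = certificate_data_pverts[OF d] and off = certificate_data_offload[OF d]
    and use = certificate_data_use[OF d]
  have pq: "kappa G \<P> (state_p c) \<noteq> kappa G \<P> (state_q c)"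
    by (rule certificate_data_kappa_neq[OF d certificate_data_in(1)[OF d] V(4)])
  have p'q': "kappa G \<P> p' \<noteq> kappa G \<P> q'"
    by (rule certificate_data_kappa_neq[OF d certificate_data_in(2)[OF d] V(6)])
  have move: "kappa G \<P> (state_p c) \<noteq> kappa G \<P> p' \<or> kappa G \<P> (state_q c) \<noteq> kappa G \<P> q'"
    using certificate_data_move[OF d] kappa_neq[OF V(5)] kappa_neq[OF V(6)] by blast
  \<comment> \<open>A word acting as the identity would fix both states and could not change the
    class of either.\<close>
  have nonid: "word_rel G w \<noteq> Id_on (pverts G)"
    if "set w \<subseteq> \<P>" "word_image w {state_p c} = {p'}" "word_image w {state_q c} = {q'}" for w
  proof
    assume *: "word_rel G w = Id_on (pverts G)"
    have id: "Id_on (pverts G) `` {v} = {v}" if "v \<in> pverts G" for v using that by auto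
    have "p' = state_p c" "q' = state_q c"
      using word_rel_Image_singleton[OF that(1) V(3)] word_rel_Image_singleton[OF that(1) V(4)] that(2,3)
        id[OF V(3)] id[OF V(4)] unfolding * by simp_all
    then show False using move by simp
  qed
  have "fork_cond G \<P> c"
    unfolding fork_cond_def Image_singleton_iff
    using certificate_dataD(1-5)[OF d] kappa_neq[OF V(2) certificate_data_fork[OF d]] by blast
  moreover have "offload_cond G \<P> c"
  proof -
    have "state_p c \<noteq> state_q c" using pq by metis
    then show ?thesis
      unfolding offload_cond_def word_rel_Image_singleton[OF off(1) V(1)] word_rel_Image_singleton[OF off(1) V(2)]
      using off pq by blast
  qed
  moreover have "orbit_cond G \<P> c"
    unfolding orbit_cond_def
  proof (intro conjI allI)
    show "word_over \<P> (orbit_word c)" by (rule certificate_data_words[OF d])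
    show "word_rel G (orbit_word c) \<noteq> Id_on (pverts G)"
      by (rule nonid[OF certificate_data_sets(1)[OF d] certificate_data_first[OF d]])
    show "\<exists>u v. pair_orbit G c n = Some (u, v) \<and> kappa G \<P> u \<noteq> kappa G \<P> v" for n
      using pair_orbit_in[OF d, of n] certificate_data_kappa_neq[OF d] by blast
    show "\<exists>n. pair_orbit G c (Suc n) \<noteq> pair_orbit G c n"
      using pair_orbit_first[OF d] move by (intro exI[of _ 0]) (auto simp: pair_orbit_0)
  qed
  moreover have "use_cond G \<P> c"
  proof -
    have "use_profile G \<P> (use_word c) (state_p c) = {kappa G \<P> p'}"
      "use_profile G \<P> (use_word c) (state_q c) = {kappa G \<P> q'}"
      using use word_rel_Image_singleton[OF certificate_data_sets(2)[OF d]] V(3,4)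
      by (simp_all add: use_profile_def)
    moreover have "({kappa G \<P> p'}, {kappa G \<P> q'}) \<noteq> ({kappa G \<P> (state_p c)}, {kappa G \<P> (state_q c)})"
      using move by auto
    ultimately show ?thesis
      unfolding use_cond_def Let_def
      using nonid[OF certificate_data_sets(2)[OF d] use] certificate_data_words(2)[OF d] p'q'
      by (simp only:) simp
  qed
  ultimately show ?thesis by (simp add: wpu_certificate_def)
qed

lemma operational_support_contains:
  assumes d: "certificate_data c T p' q'"
  shows "{state_p c, state_q c, p', q'} \<subseteq> operational_support G c"
  using pair_orbit_first[OF d] pair_orbit_0[of c] unfolding operational_support_def by blast

lemma record_pair_singleton: "record_pair G \<P> {c} = {kappa G \<P> (state_p c), kappa G \<P> (state_q c)}"
  by (simp add: record_pair_def class_pair_def)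

lemma record_support_singleton: "record_support G {c} = operational_support G c"
  by (simp add: record_support_def)

lemma record_system_singleton:
  assumes d: "certificate_data c T p' q'"
  shows "record_system G \<P> {c}"
proof -
  have "representatives G {c} k \<noteq> {}" if "k \<in> class_pair G \<P> c" for k
    using that operational_support_contains[OF d] kappa_self[OF certificate_data_pverts(3)[OF d], of \<P>]
      kappa_self[OF certificate_data_pverts(4)[OF d], of \<P>]
    unfolding representatives_def record_support_singleton class_pair_def by blast
  then show ?thesis
    using wpu_certificate_if_data[OF d] by (auto simp: record_system_def)
qed

section \<open>A swapped pair\<close>

lemma pair_orbit_swap:
  assumes d: "certificate_data c {(p, q), (q, p)} q p" and pq: "state_p c = p" "state_q c = q"
  shows "pair_orbit G c n = Some (if even n then (p, q) else (q, p))"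
proof (induction n)
  case 0
  then show ?case using pq by (simp add: pair_orbit_0)
next
  case (Suc n)
  have z: "set (orbit_word c) \<subseteq> \<P>" "word_image (orbit_word c) {p} = {q}" "word_image (orbit_word c) {q} = {p}"
    using certificate_data_sets(1)[OF d] certificate_data_first[OF d] pq by simp_all
  have V: "p \<in> pverts G" "q \<in> pverts G" using certificate_data_pverts(3,4)[OF d] pq by simp_all
  show ?case
    using Suc pair_step_Some[OF z(1) V z(2,3)] pair_step_Some[OF z(1) V(2,1) z(3,2)]
    by (simp add: pair_orbit_Suc)
qed

lemma operational_support_swap:
  assumes d: "certificate_data c {(p, q), (q, p)} q p" and pq: "state_p c = p" "state_q c = q"
  shows "operational_support G c = {p, q}"
proof
  show "{p, q} \<subseteq> operational_support G c" using operational_support_contains[OF d] pq by auto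
  show "operational_support G c \<subseteq> {p, q}"
    by (auto simp: operational_support_def pair_orbit_swap[OF assms] split: if_splits)
qed

lemma eventual_period_swap:
  assumes d: "certificate_data c {(p, q), (q, p)} q p" and pq: "state_p c = p" "state_q c = q"
  shows "preperiod G c = 0" "eventual_period G c = 2"
proof -
  note orb = pair_orbit_swap[OF assms]
  have ne: "p \<noteq> q" using certificate_data_move[OF d] pq by (auto simp: enabled_differ_def)
  show pre: "preperiod G c = 0"
    unfolding preperiod_def
  proof (rule Least_equality)
    show "\<exists>m>0. pair_orbit G c (0 + m) = pair_orbit G c 0"
      by (rule exI[of _ 2]) (simp add: orb)
  qed simp
  show "eventual_period G c = 2"
    unfolding eventual_period_def pre
  proof (rule Least_equality)
    show "0 < (2::nat) \<and> pair_orbit G c (0 + 2) = pair_orbit G c 0" by (simp add: orb)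
    \<comment> \<open>Period 1 would mean \<open>(q, p) = (p, q)\<close>, which \<open>ne\<close>
      excludes.\<close>
    show "2 \<le> m" if "0 < m \<and> pair_orbit G c (0 + m) = pair_orbit G c 0" for m
      using that ne by (cases "m = 1") (auto simp: orb)
  qed
qed

text \<open>
  The swapping word \<open>z\<close> and its square translate the system of \<open>c\<close> to a copy of itself, which differs
  only in its use word, with gains \<open>1\<close> and \<open>0\<close>; the system of \<open>d\<close> only serves the overlap condition.
\<close>

theorem wpu_parity_if_swap:
  assumes c: "certificate_data c {(p, q), (q, p)} q p" and pq: "state_p c = p" "state_q c = q"
    and cu: "use_word c = orbit_word c"
    and d: "certificate_data d T p' q'"
    and meet: "{state_p d, state_q d, p', q'} \<inter> {p, q} \<noteq> {}"
    and leave: "\<not> {state_p d, state_q d, p', q'} \<subseteq> {p, q}"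
  shows "wpu_parity G \<P> = 1"
proof -
  let ?\<kappa> = "kappa G \<P>"
  define z where "z = orbit_word c"
  \<comment> \<open>An odd power of \<open>z\<close> acts on \<open>{p, q}\<close> as
    \<open>z\<close> does, so the use condition survives. As \<open>z\<close> is nonempty, the new
    use word is longer, and the certificates differ.\<close>
  define c' where "c' = c\<lparr>use_word := z @ z @ z\<rparr>"
  have z: "set z \<subseteq> \<P>" "z \<noteq> []" "word_image z {p} = {q}" "word_image z {q} = {p}"
    using certificate_data_words(1)[OF c] certificate_data_first[OF c] pq by (simp_all add: word_over_def z_def)
  have c': "certificate_data c' {(p, q), (q, p)} q p" "state_p c' = p" "state_q c' = q"
    using c pq z unfolding c'_def certificate_data_def by (simp_all add: word_over_def)
  have V: "p \<in> pverts G" "q \<in> pverts G" using certificate_data_pverts(3,4)[OF c] pq by simp_all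
  have k: "?\<kappa> p \<noteq> ?\<kappa> q"
    using certificate_data_kappa_neq[OF c _ V(2)] by simp
  \<comment> \<open>Within the support \<open>{p, q}\<close> each class thus has a single
    representative, and a translation only has to be checked at \<open>p\<close> and at
    \<open>q\<close>.\<close>
  have notin: "q \<notin> ?\<kappa> p" "p \<notin> ?\<kappa> q" using k kappa_eq_if_in by metis+
  have "use_word c' \<noteq> use_word c" using z cu by (simp add: c'_def z_def)
  then have cc': "c \<noteq> c'" by metis
  have supp: "operational_support G c = {p, q}" "operational_support G c' = {p, q}"
    using operational_support_swap c pq c' by auto
  have suppd: "operational_support G d \<inter> {p, q} \<noteq> {}" "\<not> operational_support G d \<subseteq> {p, q}"
    using operational_support_contains[OF d] meet leave by blast+
  \<comment> \<open>The support of \<open>d\<close> leaves \<open>{p, q}\<close>, so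
    \<open>d\<close> is neither \<open>c\<close> nor its copy.\<close>
  have cd: "c \<noteq> d" "c' \<noteq> d" using supp suppd by auto
  define F where "F = {{c}, {c'}, {d}}"
  \<comment> \<open>Both copies get the same ordered pair \<open>(?\<kappa> p, ?\<kappa> q)\<close>;
    this makes interchanging \<open>p\<close> and \<open>q\<close> an odd translation.\<close>
  define pr where "pr X = (if X = {d} then (?\<kappa> (state_p d), ?\<kappa> (state_q d)) else (?\<kappa> p, ?\<kappa> q))" for X
  have pres: "presentation G \<P> F pr"
    using cd pq c' by (auto simp: presentation_def F_def pr_def record_pair_singleton)
  have rec: "\<forall>X\<in>F. record_system G \<P> X"
    using record_system_singleton[OF c] record_system_singleton[OF c'(1)] record_system_singleton[OF d]
    by (simp add: F_def)
  note im = word_rel_Image_singleton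
  have reps: "representatives G {e} (?\<kappa> p) = {p}" "representatives G {e} (?\<kappa> q) = {q}"
    if "operational_support G e = {p, q}" for e
    using that notin kappa_self[OF V(1)] kappa_self[OF V(2)]
    by (auto simp: representatives_def record_support_singleton)
  have odd: "translation G \<P> pr {e} z (transpose 0 1) {e'}"
    if "e \<noteq> e'" "operational_support G e = {p, q}" "operational_support G e' = {p, q}" "e \<noteq> d" "e' \<noteq> d" for e e'
    using that z V im[OF z(1)] reps
    by (simp add: translation_def word_over_def pr_def coord_def record_support_singleton
        permutes_swap_id)
  have even: "translation G \<P> pr {e} (z @ z) id {e'}"
    if "e \<noteq> e'" "operational_support G e = {p, q}" "operational_support G e' = {p, q}" "e \<noteq> d" "e' \<noteq> d" for e e'
    using that z V im[of "z @ z"] reps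
    by (simp add: translation_def word_over_def pr_def coord_def record_support_singleton
        permutes_id)
  note odd1 = odd[OF cc' supp cd] and even2 = even[OF cc'[symmetric] supp(2,1) cd(2,1)]
  have "two_way_cond G \<P> pr F"
    unfolding two_way_cond_def
  proof (intro bexI conjI exI)
    show "translation G \<P> pr {c} z (transpose 0 1) {c'}" by (rule odd1)
    show "translation G \<P> pr {c'} (z @ z) id {c}" by (rule even2)
  qed (use cc' in \<open>simp_all add: F_def\<close>)
  moreover have "overlap_cond G F"
    unfolding overlap_cond_def Let_def
  proof (intro bexI conjI)
    show "{c} \<noteq> {d}" using cd by simp
    show "record_support G {c} \<subset> record_support G {d} \<or> record_support G {d} \<subset> record_support G {c} \<or>
      record_support G {c} \<inter> record_support G {d} \<noteq> {} \<and>
      \<not> record_support G {c} \<subseteq> record_support G {d} \<and> \<not> record_support G {d} \<subseteq> record_support G {c}"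
      unfolding record_support_singleton supp(1) using suppd by blast
  qed (simp_all add: F_def)
  moreover have "periodic_read_cond G \<P> F"
  proof -
    \<comment> \<open>The first coordinate of the orbit is \<open>p\<close> at even times and
      \<open>q\<close> at odd times, and \<open>z\<close> is read from it, so the values appear
      interchanged.\<close>
    define y where "y h = (if even h then q else p)" for h :: nat
    have "word_over \<P> z" using z by (simp add: word_over_def)
    moreover have "word_rel G z `` {coord 0 (the (pair_orbit G c (preperiod G c + h)))} = {y h} \<and>
                 y h \<in> record_support G {c'} \<and> kappa G \<P> (y h) \<in> record_pair G \<P> {c'}" for h
      using z V im[OF z(1)] supp c'
      by (simp add: eventual_period_swap[OF c pq] pair_orbit_swap[OF c pq] coord_def y_def
          record_support_singleton record_pair_singleton)
    moreover have "\<exists>h<2. \<exists>h'<2. ?\<kappa> (y h) \<noteq> ?\<kappa> (y h')"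
    proof (intro exI conjI)
      show "?\<kappa> (y 0) \<noteq> ?\<kappa> (y 1)" using k by (auto simp: y_def)
    qed simp_all
    ultimately have "let m = eventual_period G c in 1 < m \<and>
       (\<exists>j\<in>{0, 1}. \<exists>r y. word_over \<P> r \<and>
          (\<forall>h<m. word_rel G r `` {coord j (the (pair_orbit G c (preperiod G c + h)))} = {y h} \<and>
                 y h \<in> record_support G {c'} \<and> kappa G \<P> (y h) \<in> record_pair G \<P> {c'}) \<and>
          (\<exists>h<m. \<exists>h'<m. kappa G \<P> (y h) \<noteq> kappa G \<P> (y h')))"
      unfolding Let_def eventual_period_swap(2)[OF c pq]
      by (intro conjI bexI[of _ 0] exI[of _ z] exI[of _ y]) simp_all
    then show ?thesis
      unfolding periodic_read_cond_def using cc' by (auto simp: F_def)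
  qed
  moreover have "odd_cycle_cond G \<P> pr F"
  proof -
    let ?TG = "translation_graph G \<P> pr F"
    \<comment> \<open>Out by the odd word \<open>z\<close>, back by the even word \<open>zz\<close>:
      returning by \<open>z\<close> as well would make the total gain 0 in Z_2.\<close>
    let ?walk = "[({c}, z, gain (transpose 0 1), {c'}), ({c'}, z @ z, gain id, {c})]"
    have "({c}, z, gain (transpose 0 1), {c'}) \<in> arcs ?TG" "({c'}, z @ z, gain id, {c}) \<in> arcs ?TG"
      unfolding translation_graph_def F_def using odd1 even2 by fastforce+
    then have "pre_digraph.awalk ?TG {c} ?walk {c}"
      by (simp add: pre_digraph.awalk_def pre_digraph.cas.simps)
        (simp add: translation_graph_def F_def)
    moreover have "(\<Sum>(_, _, g, _)\<leftarrow>?walk. g) = 1"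
      by (simp add: gain_def evenperm_swap)
    ultimately show ?thesis unfolding odd_cycle_cond_def by blast
  qed
  moreover have "2 \<le> card F" using cc' cd by (simp add: F_def)
  ultimately show ?thesis
    unfolding wpu_parity_def using pres rec by (auto simp: F_def intro!: exI[of _ F] exI[of _ pr])
qed

end

section \<open>Canonical strings\<close>

text \<open>The order of the head letters is that of their character codes, A < P < R < V. For equal
  heads the first differing argument decides.\<close>

fun trm_less :: "trm \<Rightarrow> trm \<Rightarrow> bool" where
  "trm_less TmA t = (case t of TmA \<Rightarrow> False | _ \<Rightarrow> True)"
| "trm_less (TmP a b) t = (case t of TmA \<Rightarrow> False
     | TmP c d \<Rightarrow> (if a = c then trm_less b d else trm_less a c) | _ \<Rightarrow> True)"
| "trm_less (TmR a b) t = (case t of TmV \<Rightarrow> True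
     | TmR c d \<Rightarrow> (if a = c then trm_less b d else trm_less a c) | _ \<Rightarrow> False)"
| "trm_less TmV t = False"

text \<open>Term strings are prefix-free, so their comparison can be read off the leading strings alone.\<close>

lemma term_string_append_less_iff:
  "term_string s @ u < term_string t @ v \<longleftrightarrow> trm_less s t \<or> s = t \<and> u < v"
proof (induction s arbitrary: t u v)
  case TmA
  then show ?case by (cases t) (auto simp: less_char_def)
next
  case TmV
  then show ?case by (cases t) (auto simp: less_char_def)
next
  case (TmP a b)
  then show ?case by (cases t) (auto simp: less_char_def)
next
  case (TmR a b)
  then show ?case by (cases t) (auto simp: less_char_def)
qed

lemma term_string_append_eq_iff: "term_string s @ u = term_string t @ v \<longleftrightarrow> s = t \<and> u = v"
proof (induction s arbitrary: t u v)
  case TmA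
  then show ?case by (cases t) auto
next
  case TmV
  then show ?case by (cases t) auto
next
  case (TmP a b)
  then show ?case by (cases t) auto
next
  case (TmR a b)
  then show ?case by (cases t) auto
qed

lemma term_string_less_iff: "term_string s < term_string t \<longleftrightarrow> trm_less s t"
  using term_string_append_less_iff[of s "[]" t "[]"] by simp

lemma inj_term_string: "inj term_string"
  using term_string_append_eq_iff[of _ "[]" _ "[]"] by (auto intro!: injI)

fun trms_less :: "trm list \<Rightarrow> trm list \<Rightarrow> bool" where
  "trms_less (x # xs) (y # ys) = (if x = y then trms_less xs ys else trm_less x y)"
| "trms_less _ _ = False"

lemma trm_less_irrefl: "\<not> trm_less t t"
  by (induction t) auto

lemma trms_less_irrefl: "\<not> trms_less xs xs"
  by (induction xs) auto

text \<open>With equal lengths the separators line up until the first differing components, and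
  prefix-freeness lets these decide. Equal length is guaranteed later because a rewrite replaces one
  component by one component. The tails \<open>u\<close> and \<open>v\<close> carry the induction
  and finally the closing brace.\<close>

lemma join_semicolon_less_iff:
  assumes "length xs = length ys"
  shows "join_semicolon (map term_string xs) @ u < join_semicolon (map term_string ys) @ v \<longleftrightarrow>
    trms_less xs ys \<or> xs = ys \<and> u < v"
  using assms
proof (induction xs arbitrary: ys u v)
  case Nil
  then show ?case by simp
next
  case (Cons x xs)
  then obtain y ys' where ys: "ys = y # ys'" by (cases ys) auto
  show ?case
  proof (cases xs)
    case Nil
    then show ?thesis using Cons.prems ys by (auto simp: term_string_append_less_iff trm_less_irrefl)
  next
    case (Cons x' xs')
    then obtain y' ys'' where ys'': "ys' = y' # ys''" using Cons.prems ys by (cases ys') auto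
    show ?thesis
      using Cons.IH[of ys' u v] Cons.prems Cons ys ys''
      by (auto simp: term_string_append_less_iff trm_less_irrefl)
  qed
qed

section \<open>States as sorted lists\<close>

text \<open>Since \<open>term_string\<close> is injective, a multiset has just one list sorted in
  this sense; such lists serve as normal forms of states.\<close>

definition trms_sorted :: "trm list \<Rightarrow> bool" where
  "trms_sorted xs \<longleftrightarrow> sorted (map term_string xs)"

lemma component_strings_mset:
  "trms_sorted xs \<Longrightarrow> component_strings (mset xs) = map term_string xs"
  by (simp add: component_strings_def trms_sorted_def sorted_list_of_multiset_mset sorted_sort_id
      flip: mset_map)

lemma mset_eq_iff_if_sorted:
  assumes "trms_sorted xs" "trms_sorted ys"
  shows "mset xs = mset ys \<longleftrightarrow> xs = ys"
  using component_strings_mset[OF assms(1)] component_strings_mset[OF assms(2)] inj_term_string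
  by (metis inj_map_eq_map)

lemma trms_sorted_filter: "trms_sorted xs \<Longrightarrow> trms_sorted (filter P xs)"
  unfolding trms_sorted_def
  by (induction xs) auto

lemma rule_signature_mset:
  "trms_sorted xs \<Longrightarrow> rule_signature (mset xs) = map term_string (filter is_rule xs)"
  by (simp add: rule_signature_def component_strings_mset trms_sorted_filter flip: mset_filter)

lemma data_signature_mset:
  "trms_sorted xs \<Longrightarrow> data_signature (mset xs) = map term_string (filter (\<lambda>c. \<not> is_rule c) xs)"
  by (simp add: data_signature_def component_strings_mset trms_sorted_filter flip: mset_filter)

lemma canonical_string_less_iff:
  assumes "trms_sorted xs" "trms_sorted ys" "length xs = length ys"
  shows "canonical_string (mset xs) < canonical_string (mset ys) \<longleftrightarrow> trms_less xs ys"
  using join_semicolon_less_iff[OF assms(3), of "''}''" "''}''"] assms(1,2)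
  by (simp add: canonical_string_def component_strings_mset)

fun insert_trm :: "trm \<Rightarrow> trm list \<Rightarrow> trm list" where
  "insert_trm x [] = [x]"
| "insert_trm x (y # ys) = (if trm_less y x then y # insert_trm x ys else x # y # ys)"

lemma mset_insert_trm [simp]: "mset (insert_trm x xs) = add_mset x (mset xs)"
  by (induction xs) auto

lemma trms_sorted_insert_trm: "trms_sorted xs \<Longrightarrow> trms_sorted (insert_trm x xs)"
proof (induction xs)
  case (Cons y ys)
  have "set (insert_trm x zs) = insert x (set zs)" for zs by (induction zs) auto
  then show ?case
    using Cons by (auto simp: trms_sorted_def term_string_less_iff[symmetric])
qed (simp add: trms_sorted_def)

section \<open>Executable rewriting\<close>

text \<open>Follows one path to a wildcard of the pattern and returns what stands there. This is
  only a candidate binding: other occurrences and the rigid part are verified by substituting it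
  back in \<open>root_rewrites\<close>.\<close>

fun wildcard_image :: "trm \<Rightarrow> trm \<Rightarrow> trm option" where
  "wildcard_image TmV t = Some t"
| "wildcard_image (TmP a b) (TmP c d) = (if has_wildcard a then wildcard_image a c else wildcard_image b d)"
| "wildcard_image (TmR a b) (TmR c d) = (if has_wildcard a then wildcard_image a c else wildcard_image b d)"
| "wildcard_image _ _ = None"

lemma wildcard_image_bind: "has_wildcard p \<Longrightarrow> wildcard_image p (bind_wildcard b p) = Some b"
  by (induction p) auto

lemma bind_wildcard_closed: "\<not> has_wildcard p \<Longrightarrow> bind_wildcard b p = p"
  by (induction p) auto

definition root_rewrites :: "trm \<Rightarrow> trm \<Rightarrow> trm \<Rightarrow> trm list" where
  "root_rewrites p q t =
     (if t = TmV then []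
      else if has_wildcard p then
        (case wildcard_image p t of None \<Rightarrow> []
         | Some b \<Rightarrow> if bind_wildcard b p = t then [bind_wildcard b q] else [])
      else if p = t then [q] else [])"

text \<open>If the left side has no wildcard, the binding \<open>b\<close> ranges over all terms;
  the hypothesis makes the right side ignore it, so the set of results is still finite.\<close>

lemma set_root_rewrites:
  assumes "has_wildcard q \<Longrightarrow> has_wildcard p"
  shows "set (root_rewrites p q t) = {bind_wildcard b q |b. t = bind_wildcard b p \<and> t \<noteq> TmV}"
proof (cases "has_wildcard p")
  case True
  then show ?thesis
    using wildcard_image_bind[OF True]
    by (auto simp: root_rewrites_def split: option.splits)
next
  case False
  then have "\<not> has_wildcard q" using assms by blast
  with False show ?thesis by (auto simp: root_rewrites_def bind_wildcard_closed)
qed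

primrec term_rewrites :: "trm \<Rightarrow> trm \<Rightarrow> trm \<Rightarrow> trm list" where
  "term_rewrites p q TmA = root_rewrites p q TmA"
| "term_rewrites p q TmV = root_rewrites p q TmV"
| "term_rewrites p q (TmP s t) = root_rewrites p q (TmP s t) @
     map (\<lambda>s'. TmP s' t) (term_rewrites p q s) @ map (TmP s) (term_rewrites p q t)"
| "term_rewrites p q (TmR s t) = root_rewrites p q (TmR s t) @
     map (\<lambda>s'. TmR s' t) (term_rewrites p q s) @ map (TmR s) (term_rewrites p q t)"

lemma rewrite_at_iff:
  assumes wf: "has_wildcard q \<Longrightarrow> has_wildcard p"
  shows "rewrite_at p q t t' \<longleftrightarrow> t' \<in> set (term_rewrites p q t)"
proof
  assume "rewrite_at p q t t'"
  then show "t' \<in> set (term_rewrites p q t)"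
  proof induction
    case (root t b)
    then have "bind_wildcard b q \<in> set (root_rewrites p q t)" by (auto simp: set_root_rewrites[OF wf])
    then show ?case by (cases t) auto
  qed auto
next
  have root: "rewrite_at p q t t'" if "t' \<in> set (root_rewrites p q t)" for t t'
    using that by (auto simp: set_root_rewrites[OF wf] intro: rewrite_at.root)
  assume "t' \<in> set (term_rewrites p q t)"
  then show "rewrite_at p q t t'"
    by (induction t arbitrary: t') (auto intro: rewrite_at.intros root)
qed

text \<open>List counterpart of removing one component from a multiset: keeping the remainder in
  order means that a rewrite only needs one insertion to be sorted again.\<close>

fun picks :: "'a list \<Rightarrow> ('a \<times> 'a list) list" where
  "picks [] = []"
| "picks (x # xs) = (x, xs) # map (\<lambda>(y, ys). (y, x # ys)) (picks xs)"

lemma picks_mset: "(y, ys) \<in> set (picks xs) \<Longrightarrow> mset xs = add_mset y (mset ys)"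
  by (induction xs arbitrary: ys) auto

lemma picks_ex: "y \<in> set xs \<Longrightarrow> \<exists>ys. (y, ys) \<in> set (picks xs)"
  by (induction xs) force+

lemma picks_sorted: "(y, ys) \<in> set (picks xs) \<Longrightarrow> trms_sorted xs \<Longrightarrow> trms_sorted ys"
proof (induction xs arbitrary: ys)
  case (Cons x xs)
  have "z \<in> set xs" if "(y, ys) \<in> set (picks xs)" "z \<in> set ys" for z ys
    using picks_mset[OF that(1)] that(2) by (metis insert_iff set_mset_add_mset_insert set_mset_mset)
  then show ?case using Cons by (fastforce simp: trms_sorted_def)
qed simp

definition valid_list :: "trm list \<Rightarrow> bool" where
  "valid_list xs = list_all (\<lambda>c. case c of TmR p q \<Rightarrow> has_wildcard q \<longrightarrow> has_wildcard p | _ \<Rightarrow> \<not> has_wildcard c) xs"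

lemma valid_list_iff: "valid_list xs \<longleftrightarrow> valid_state (mset xs)"
proof -
  have "(case c of TmR p q \<Rightarrow> has_wildcard q \<longrightarrow> has_wildcard p | _ \<Rightarrow> \<not> has_wildcard c) \<longleftrightarrow>
    (\<not> is_rule c \<longrightarrow> \<not> has_wildcard c) \<and> (\<forall>p q. c = TmR p q \<and> has_wildcard q \<longrightarrow> has_wildcard p)" for c
    by (cases c) auto
  then show ?thesis
    unfolding valid_list_def valid_state_def list_all_iff set_mset_mset by blast
qed

fun rule_rewrites :: "trm \<Rightarrow> trm \<Rightarrow> trm list" where
  "rule_rewrites (TmR p q) c = term_rewrites p q c"
| "rule_rewrites _ c = []"

definition successors :: "trm list \<Rightarrow> trm list list" where
  "successors xs = filter valid_list
     (concat (map (\<lambda>(c, ys). map (\<lambda>c'. insert_trm c' ys)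
       (filter (\<lambda>c'. tsize c' \<le> 255) (concat (map (\<lambda>r. rule_rewrites r c) xs)))) (picks xs)))"

lemma set_successors_iff:
  "zs \<in> set (successors xs) \<longleftrightarrow>
    (\<exists>c ys r c'. (c, ys) \<in> set (picks xs) \<and> r \<in> set xs \<and> c' \<in> set (rule_rewrites r c) \<and>
       tsize c' \<le> 255 \<and> valid_list zs \<and> zs = insert_trm c' ys)"
  unfolding successors_def set_filter set_concat set_map UN_iff mem_Collect_eq image_iff bex_simps
  by (auto simp: Bex_def)

lemma successors_sorted:
  assumes "trms_sorted xs" "ys \<in> set (successors xs)"
  shows "trms_sorted ys" "valid_state (mset ys)" "length ys = length xs"
proof -
  obtain c zs c' where *: "(c, zs) \<in> set (picks xs)" "ys = insert_trm c' zs"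
    and v: "valid_list ys"
    using assms(2) unfolding set_successors_iff by blast
  show "trms_sorted ys" using * assms(1) by (simp add: picks_sorted trms_sorted_insert_trm)
  show "valid_state (mset ys)" using v by (simp add: valid_list_iff)
  have "size (mset ys) = size (mset xs)" using *(2) picks_mset[OF *(1)] by simp
  then show "length ys = length xs" by simp
qed

text \<open>Validity of the source is essential: a rule introducing a wildcard on the right would
  have arbitrary instances, which no finite list of successors captures.\<close>

lemma retained_rewrites_iff:
  assumes val: "valid_state (mset xs)"
  shows "(mset xs, S') \<in> retained_rewrites \<longleftrightarrow> S' \<in> mset ` set (successors xs)"
proof -
  have wf: "has_wildcard p" if "TmR p q \<in> set xs" "has_wildcard q" for p q
    using val that by (auto simp: valid_state_def)
  have rr: "c' \<in> set (rule_rewrites r c) \<longleftrightarrow> (\<exists>p q. r = TmR p q \<and> rewrite_at p q c c')" if "r \<in> set xs" for r c c'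
    using rewrite_at_iff wf that by (cases r) auto
  have "S' \<in> mset ` set (successors xs) \<longleftrightarrow>
    (\<exists>c ys r c'. (c, ys) \<in> set (picks xs) \<and> r \<in> set xs \<and> c' \<in> set (rule_rewrites r c) \<and>
       tsize c' \<le> 255 \<and> valid_list (insert_trm c' ys) \<and> S' = mset (insert_trm c' ys))"
    unfolding image_iff Bex_def set_successors_iff by blast
  also have "\<dots> \<longleftrightarrow>
    (\<exists>c ys r c'. (c, ys) \<in> set (picks xs) \<and> r \<in> set xs \<and> c' \<in> set (rule_rewrites r c) \<and>
       tsize c' \<le> 255 \<and> valid_state S' \<and> S' = mset xs - {#c#} + {#c'#})"
  proof -
    have "valid_list (insert_trm c' ys) \<and> S' = mset (insert_trm c' ys) \<longleftrightarrow>
      valid_state S' \<and> S' = mset xs - {#c#} + {#c'#}" if "(c, ys) \<in> set (picks xs)" for c ys c'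
      using picks_mset[OF that] by (auto simp: valid_list_iff)
    then show ?thesis by blast
  qed
  also have "\<dots> \<longleftrightarrow>
    (\<exists>c r c'. c \<in> set xs \<and> r \<in> set xs \<and> c' \<in> set (rule_rewrites r c) \<and>
       tsize c' \<le> 255 \<and> valid_state S' \<and> S' = mset xs - {#c#} + {#c'#})"
  proof -
    have "(\<exists>ys. (c, ys) \<in> set (picks xs)) \<longleftrightarrow> c \<in> set xs" for c
      using picks_ex[of c xs] picks_mset[of c _ xs] by (metis set_mset_mset union_single_eq_member)
    then show ?thesis by metis
  qed
  also have "\<dots> \<longleftrightarrow> (mset xs, S') \<in> retained_rewrites"
    unfolding retained_rewrites_def mem_Collect_eq prod.case set_mset_mset using rr by blast
  finally show ?thesis by simp
qed

section \<open>Certifying the selected core\<close>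

primrec avoids :: "trm list list \<Rightarrow> trm list list \<Rightarrow> bool" where
  "avoids [] X \<longleftrightarrow> True"
| "avoids (x # xs) X \<longleftrightarrow> x \<notin> set X \<and> avoids xs X"

primrec covered :: "trm list list \<Rightarrow> trm list list \<Rightarrow> bool" where
  "covered [] X \<longleftrightarrow> True"
| "covered (x # xs) X \<longleftrightarrow> x \<in> set X \<and> covered xs X"

primrec successors_avoid :: "trm list list \<Rightarrow> trm list list \<Rightarrow> bool" where
  "successors_avoid [] X \<longleftrightarrow> True"
| "successors_avoid (x # xs) X \<longleftrightarrow> avoids (successors x) X \<and> successors_avoid xs X"

primrec successors_covered :: "trm list list \<Rightarrow> trm list list \<Rightarrow> bool" where
  "successors_covered [] X \<longleftrightarrow> True"
| "successors_covered (x # xs) X \<longleftrightarrow> covered (remdups (successors x)) X \<and> successors_covered xs X"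

text \<open>A topological order in which transitions may stay inside a group or fall back to an
  earlier group. Groups may be larger than strong components, as only their sizes matter.\<close>

primrec descending :: "trm list list \<Rightarrow> trm list list list \<Rightarrow> bool" where
  "descending Cs [] \<longleftrightarrow> True"
| "descending Cs (L # Ls) \<longleftrightarrow> length L < length Cs \<and>
     successors_avoid L (Cs @ concat Ls) \<and> descending Cs Ls"

primrec edge_row :: "trm list list \<Rightarrow> nat \<Rightarrow> nat \<Rightarrow> trm list list \<Rightarrow> nat list" where
  "edge_row ss i j [] = []"
| "edge_row ss i j (c # cs) =
     (if i \<noteq> j \<and> c \<in> set ss then j # edge_row ss i (Suc j) cs else edge_row ss i (Suc j) cs)"

primrec edge_rows :: "trm list list \<Rightarrow> nat \<Rightarrow> trm list list \<Rightarrow> nat list list" where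
  "edge_rows Cs i [] = []"
| "edge_rows Cs i (c # cs) = edge_row (successors c) i 0 Cs # edge_rows Cs (Suc i) cs"

lemma avoids_iff: "avoids xs X \<longleftrightarrow> set xs \<inter> set X = {}"
  by (induction xs) auto

lemma covered_iff: "covered xs X \<longleftrightarrow> set xs \<subseteq> set X"
  by (induction xs) auto

lemma successors_avoid_iff: "successors_avoid xs X \<longleftrightarrow> (\<forall>x\<in>set xs. set (successors x) \<inter> set X = {})"
  by (induction xs) (auto simp: avoids_iff)

lemma successors_covered_iff: "successors_covered xs X \<longleftrightarrow> (\<forall>x\<in>set xs. set (successors x) \<subseteq> set X)"
  by (induction xs) (auto simp: covered_iff)

lemma set_edge_row: "set (edge_row ss i j cs) = {j + k |k. k < length cs \<and> j + k \<noteq> i \<and> cs ! k \<in> set ss}"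
proof (induction cs arbitrary: j)
  case (Cons c cs)
  have *: "(\<exists>k. P k) \<longleftrightarrow> P 0 \<or> (\<exists>k. P (Suc k))" for P :: "nat \<Rightarrow> bool"
    by (metis not0_implies_Suc)
  show ?case
    unfolding set_eq_iff mem_Collect_eq by (subst *) (auto simp: Cons.IH)
qed simp

lemma nth_edge_rows:
  "k < length cs \<Longrightarrow> edge_rows Cs i cs ! k = edge_row (successors (cs ! k)) (i + k) 0 Cs"
  by (induction cs arbitrary: i k) (auto simp: nth_Cons split: nat.splits)

text \<open>Backward search from \<open>s0\<close>. Filtering the index list keeps each stage
  sorted, so that covering the whole core can be tested as an equality of lists.\<close>

primrec back_closure :: "nat list list \<Rightarrow> nat \<Rightarrow> nat \<Rightarrow> nat list" where
  "back_closure E s0 0 = [s0]"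
| "back_closure E s0 (Suc k) = (let B = back_closure E s0 k in
     filter (\<lambda>i. i \<in> set B \<or> list_ex (\<lambda>j. j \<in> set B) (E ! i)) [0..<length E])"

text \<open>
  \<open>Cs\<close> lists the core in canonical order. The other explored sources are split into groups \<open>Ls\<close>
  smaller than the core such that no transition leads from a group to a later one or to the core;
  hence every strong component other than the core lies inside one group.
\<close>

definition core_check :: "trm list \<Rightarrow> trm list list \<Rightarrow> trm list list list \<Rightarrow> nat list list \<Rightarrow> nat \<Rightarrow> bool" where
  "core_check l0 Cs Ls E s0 \<longleftrightarrow>
     sorted_wrt (\<lambda>x y. \<not> trm_less y x) l0 \<and> valid_list l0 \<and>
     length E = length Cs \<and> s0 < length Cs \<and> Cs ! s0 = l0 \<and> sorted_wrt trms_less Cs \<and>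
     edge_rows Cs 0 Cs = E \<and>
     list_all (\<lambda>i. i = s0 \<or> list_ex (\<lambda>m. i = m \<or> i \<in> set (E ! m)) (E ! s0)) [0..<length Cs] \<and>
     back_closure E s0 3 = [0..<length Cs] \<and>
     successors_covered (remdups (l0 # successors l0)) (Cs @ concat Ls) \<and>
     descending Cs Ls \<and>
     list_ex (\<lambda>j. filter is_rule (Cs ! j) \<noteq> filter is_rule l0) (E ! s0) \<and>
     list_ex (\<lambda>c. filter (\<lambda>t. \<not> is_rule t) c \<noteq> filter (\<lambda>t. \<not> is_rule t) l0) Cs"

lemma trms_sorted_iff: "trms_sorted xs \<longleftrightarrow> sorted_wrt (\<lambda>x y. \<not> trm_less y x) xs"
  unfolding trms_sorted_def sorted_map
  by (simp add: term_string_less_iff[symmetric] not_less)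

section \<open>Components of the explored transition graph\<close>

locale core_data =
  fixes l0 :: "trm list" and Cs :: "trm list list" and Ls :: "trm list list list"
    and E :: "nat list list" and s0 :: nat
  assumes check: "core_check l0 Cs Ls E s0"
begin

abbreviation "n \<equiv> length Cs"
abbreviation "seed \<equiv> mset l0"
abbreviation "R \<equiv> explored_transitions seed"
abbreviation "core \<equiv> mset ` set Cs"

lemma length_E: "length E = n" and s0: "s0 < n" "Cs ! s0 = l0"
  and l0_sorted: "trms_sorted l0" and l0_valid: "valid_state (mset l0)"
  and Cs_sorted: "sorted_wrt trms_less Cs" and desc: "descending Cs Ls"
  using check by (simp_all add: core_check_def trms_sorted_iff valid_list_iff)

text \<open>The invariant under which lists represent states faithfully: sortedness makes
  \<open>mset\<close> injective, validity makes \<open>successors\<close> exact, and constant length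
  makes the string comparison applicable. Rewriting preserves all three.\<close>

definition good :: "trm list \<Rightarrow> bool" where
  "good l \<longleftrightarrow> trms_sorted l \<and> valid_state (mset l) \<and> length l = length l0"

lemma good_l0: "good l0"
  using l0_sorted l0_valid by (simp add: good_def)

lemma good_successors: "good l \<Longrightarrow> l' \<in> set (successors l) \<Longrightarrow> good l'"
  using successors_sorted[of l l'] by (simp add: good_def)

lemma good_mset_eq: "good l \<Longrightarrow> good l' \<Longrightarrow> mset l = mset l' \<longleftrightarrow> l = l'"
  by (simp add: good_def mset_eq_iff_if_sorted)

lemma retained_good: "good l \<Longrightarrow> (mset l, S) \<in> retained_rewrites \<longleftrightarrow> S \<in> mset ` set (successors l)"
  by (simp add: good_def retained_rewrites_iff)

lemma set_E: "i < n \<Longrightarrow> set (E ! i) = {j. j < n \<and> j \<noteq> i \<and> Cs ! j \<in> set (successors (Cs ! i))}"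
proof -
  have "edge_rows Cs 0 Cs = E" using check by (simp add: core_check_def)
  then show "i < n \<Longrightarrow> ?thesis" using nth_edge_rows[of i Cs Cs 0] by (auto simp: set_edge_row)
qed

definition sources :: "state set" where
  "sources = {S. \<exists>k<3. (seed, S) \<in> retained_rewrites ^^ k}"

lemma R_iff: "(S, S') \<in> R \<longleftrightarrow> S \<in> sources \<and> (S, S') \<in> retained_rewrites"
  by (auto simp: explored_transitions_def sources_def)

lemma sources_eq:
  "sources = mset ` ({l0} \<union> set (successors l0) \<union> (\<Union>l\<in>set (successors l0). set (successors l)))"
proof -
  have 1: "(seed, S) \<in> retained_rewrites ^^ Suc 0 \<longleftrightarrow> S \<in> mset ` set (successors l0)" for S
    using retained_good[OF good_l0] by simp
  have 2: "(seed, S) \<in> retained_rewrites ^^ Suc (Suc 0) \<longleftrightarrow>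
    (\<exists>l\<in>set (successors l0). S \<in> mset ` set (successors l))" for S
    using retained_good[OF good_l0] retained_good[OF good_successors[OF good_l0]]
    by (auto simp: relcomp.simps)
  have k: "(\<exists>k<3. P k) \<longleftrightarrow> P 0 \<or> P (Suc 0) \<or> P (Suc (Suc 0))" for P
    by (auto simp: numeral_3_eq_3 less_Suc_eq)
  show ?thesis
    unfolding sources_def k 1 2 by auto
qed

text \<open>A source is at most two rewrites from the seed, so it is enough to cover the successors
  of the seed and of its successors. States first met at distance three are only targets.\<close>

lemma sources_good:
  assumes "S \<in> sources"
  shows "\<exists>l. good l \<and> S = mset l \<and> (l \<in> set Cs \<or> (\<exists>L\<in>set Ls. l \<in> set L))"
proof -
  have l0: "l0 \<in> set Cs" using s0 by (metis nth_mem)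
  have ball: "l' \<in> set Cs \<or> (\<exists>L\<in>set Ls. l' \<in> set L)"
    if "l = l0 \<or> l \<in> set (successors l0)" "l' \<in> set (successors l)" for l l'
  proof -
    have "successors_covered (remdups (l0 # successors l0)) (Cs @ concat Ls)"
      using check by (simp only: core_check_def)
    then have "\<forall>l\<in>set (l0 # successors l0). set (successors l) \<subseteq> set Cs \<union> \<Union> (set ` set Ls)"
      by (simp add: successors_covered_iff)
    then have "set (successors l) \<subseteq> set Cs \<union> \<Union> (set ` set Ls)"
      using that(1) by (metis list.set_intros)
    with that(2) show ?thesis by blast
  qed
  from assms consider l where "l = l0" "S = mset l" | l where "l \<in> set (successors l0)" "S = mset l"
    | l l' where "l \<in> set (successors l0)" "l' \<in> set (successors l)" "S = mset l'"
    unfolding sources_eq by blast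
  then show ?thesis
  proof cases
    case 1
    then show ?thesis using good_l0 l0 by blast
  next
    case 2
    then show ?thesis using good_successors[OF good_l0] ball[of l0] by blast
  next
    case 3
    then show ?thesis using good_successors[OF good_successors[OF good_l0]] ball[of l] by blast
  qed
qed

lemma edge_retained:
  assumes "i < n" "good (Cs ! i)" "j \<in> set (E ! i)"
  shows "(mset (Cs ! i), mset (Cs ! j)) \<in> retained_rewrites" "good (Cs ! j)"
  using assms set_E[of i] good_successors[of "Cs ! i" "Cs ! j"] by (auto simp: retained_good)

text \<open>Two steps inside the core reach every core state, so all of them are sources and every
  rewrite between them is explored. Distances need no further attention.\<close>

lemma near_seed:
  assumes "i < n"
  shows "i = s0 \<or> i \<in> set (E ! s0) \<or> (\<exists>m\<in>set (E ! s0). i \<in> set (E ! m))"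
proof -
  have "list_all (\<lambda>i. i = s0 \<or> list_ex (\<lambda>m. i = m \<or> i \<in> set (E ! m)) (E ! s0)) [0..<length Cs]"
    using check by (simp add: core_check_def)
  then show ?thesis using assms by (auto simp: list_all_iff list_ex_iff)
qed

lemma E_bound: "i < n \<Longrightarrow> j \<in> set (E ! i) \<Longrightarrow> j < n"
  by (simp add: set_E)

lemma good_s0: "good (Cs ! s0)"
  using good_l0 s0 by simp

lemma Cs_good: "i < n \<Longrightarrow> good (Cs ! i)"
  using near_seed[of i] edge_retained(2) good_s0 s0 E_bound by blast

lemma Cs_source: "i < n \<Longrightarrow> mset (Cs ! i) \<in> sources"
proof -
  assume i: "i < n"
  have *: "Cs ! j \<in> set (successors (Cs ! i))" if "i < n" "j \<in> set (E ! i)" for i j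
    using that by (simp add: set_E)
  show ?thesis
    using near_seed[OF i] *[OF s0(1)] * E_bound[OF s0(1)] unfolding sources_eq s0(2)
    by (metis (mono_tags, lifting) UN_I UnCI imageI singletonI s0(2))
qed

lemma edge_R: "i < n \<Longrightarrow> j \<in> set (E ! i) \<Longrightarrow> (mset (Cs ! i), mset (Cs ! j)) \<in> R"
  by (simp add: R_iff Cs_source edge_retained(1) Cs_good)

lemma core_iff: "S \<in> core \<longleftrightarrow> (\<exists>i<n. S = mset (Cs ! i))"
  unfolding image_iff Bex_def in_set_conv_nth by blast

lemma R_core_iff:
  assumes "i < n" "j < n"
  shows "(mset (Cs ! i), mset (Cs ! j)) \<in> R \<and> mset (Cs ! i) \<noteq> mset (Cs ! j) \<longleftrightarrow> j \<in> set (E ! i)"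
proof -
  have dist: "Cs ! i = Cs ! j \<longleftrightarrow> i = j"
  proof -
    show ?thesis
      using trms_less_irrefl Cs_sorted assms by (metis linorder_less_linear sorted_wrt_nth_less)
  qed
  have "mset (Cs ! j) \<in> mset ` set (successors (Cs ! i)) \<longleftrightarrow> Cs ! j \<in> set (successors (Cs ! i))"
    using good_mset_eq[OF Cs_good[OF assms(2)] good_successors[OF Cs_good[OF assms(1)]]] by auto
  then show ?thesis
    using assms dist Cs_source[of i] Cs_good
    by (auto simp: R_iff retained_good set_E good_mset_eq)
qed

lemma seed_reaches: "i < n \<Longrightarrow> (seed, mset (Cs ! i)) \<in> R\<^sup>*"
  using near_seed[of i] edge_R[OF s0(1)] edge_R E_bound[OF s0(1)] s0(2)
  by (metis rtrancl.rtrancl_refl rtrancl.rtrancl_into_rtrancl)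

lemma reaches_seed: "i < n \<Longrightarrow> (mset (Cs ! i), seed) \<in> R\<^sup>*"
proof -
  have *: "i < n \<and> (mset (Cs ! i), seed) \<in> R\<^sup>*" if "i \<in> set (back_closure E s0 k)" for k i
    using that
  proof (induction k arbitrary: i)
    case 0
    then show ?case using s0 by simp
  next
    case (Suc k)
    then consider "i \<in> set (back_closure E s0 k)"
      | j where "i < n" "j \<in> set (E ! i)" "j \<in> set (back_closure E s0 k)"
      by (auto simp: Let_def list_ex_iff length_E)
    then show ?case
      by cases (use Suc.IH edge_R in \<open>auto intro: converse_rtrancl_into_rtrancl\<close>)
  qed
  have "back_closure E s0 3 = [0..<n]" using check by (simp add: core_check_def)
  then show "i < n \<Longrightarrow> (mset (Cs ! i), seed) \<in> R\<^sup>*" using *[of i 3] by simp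
qed

lemma descending_avoids_core:
  "descending Cs Ls' \<Longrightarrow> L \<in> set Ls' \<Longrightarrow> l \<in> set L \<Longrightarrow> l' \<in> set (successors l) \<Longrightarrow> l' \<notin> set Cs"
  by (induction Ls') (auto simp: successors_avoid_iff)

lemma core_eq: "core = mutual_class R seed"
proof
  show "core \<subseteq> mutual_class R seed"
    using seed_reaches reaches_seed by (auto simp: mutual_class_def in_set_conv_nth)
  show "mutual_class R seed \<subseteq> core"
  proof (rule subsetI, rule ccontr)
    fix T assume T: "T \<in> mutual_class R seed" and notin: "T \<notin> core"
    have seed: "seed \<in> core" using s0 by (metis image_eqI nth_mem)
    have "(T, seed) \<in> R\<^sup>*" using T by (simp add: mutual_class_def)
    \<comment> \<open>Being outside the core is preserved along explored transitions: the source of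
      one is then in a group, and the successors of groups avoid the core. So no outside state
      reaches the seed.\<close>
    then have "seed \<notin> core"
      using notin
    proof (induction rule: converse_rtrancl_induct)
      case (step y z)
      then have y: "y \<in> sources" "(y, z) \<in> retained_rewrites" by (simp_all add: R_iff)
      obtain l where l: "good l" "y = mset l" "l \<in> set Cs \<or> (\<exists>L\<in>set Ls. l \<in> set L)"
        using sources_good[OF y(1)] by blast
      then obtain L where L: "L \<in> set Ls" "l \<in> set L" using step.prems by blast
      obtain l' where l': "l' \<in> set (successors l)" "z = mset l'"
        using y(2) l by (auto simp: retained_good)
      have "l' \<notin> set Cs" by (rule descending_avoids_core[OF desc L l'(1)])
      have "z \<notin> core"
      proof
        assume "z \<in> core"
        then obtain i where i: "i < n" "z = mset (Cs ! i)" unfolding core_iff by blast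
        then have "l' = Cs ! i"
          using l'(2) good_mset_eq[OF good_successors[OF l(1) l'(1)] Cs_good[OF i(1)]] by simp
        then show False using i(1) \<open>l' \<notin> set Cs\<close> by simp
      qed
      then show ?case by (rule step.IH)
    qed
    with seed show False by simp
  qed
qed

lemma card_core: "card core = n"
proof -
  have "inj_on mset (set Cs)"
    using good_mset_eq Cs_good by (auto simp: inj_on_def in_set_conv_nth)
  moreover have "distinct Cs"
  proof -
    show ?thesis
      using trms_less_irrefl Cs_sorted by (metis distinct_conv_nth linorder_less_linear sorted_wrt_nth_less)
  qed
  ultimately show ?thesis by (simp add: card_image distinct_card)
qed

text \<open>Consider the first group that the component meets. Transitions from it cannot enter
  later groups or the core, and no member lies in an earlier group, so the whole component is inside
  this group and is smaller than the core.\<close>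

lemma component_in_group:
  assumes D: "D = mutual_class R u" "D \<inter> core = {}" "D \<subseteq> sources"
    and Ls': "descending Cs Ls'" "\<And>l. good l \<Longrightarrow> mset l \<in> D \<Longrightarrow> \<exists>L\<in>set Ls'. l \<in> set L"
  shows "card D < n"
  using Ls'
proof (induction Ls')
  case Nil
  then have "D = {}" using sources_good D(3) by fastforce
  then show ?case using mutual_class_self D(1) by fastforce
next
  case (Cons L Ls')
  show ?case
  proof (cases "\<exists>l\<in>set L. good l \<and> mset l \<in> D")
    case False
    have "\<exists>L\<in>set Ls'. l \<in> set L" if "good l" "mset l \<in> D" for l
      using Cons.prems(2)[OF that] False that by auto
    then show ?thesis using Cons.IH Cons.prems(1) by simp
  next
    case True
    then obtain l where l: "l \<in> set L" "good l" "mset l \<in> D" by blast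
    have "S \<in> mset ` set L" if S: "S \<in> D" for S
    proof -
      have "(mset l, S) \<in> R\<^sup>*"
        using l(3) S unfolding D(1) mutual_class_def by (auto intro: rtrancl_trans)
      then have "S \<in> D \<longrightarrow> (\<exists>m\<in>set L. good m \<and> S = mset m)"
      proof (induction rule: rtrancl_induct)
        case base
        then show ?case using l by blast
      next
        case (step y z)
        show ?case
        proof
          assume z: "z \<in> D"
          have yz: "(y, z) \<in> R\<^sup>*" "(mset l, y) \<in> R\<^sup>*" using step.hyps by auto
          \<comment> \<open>Every state on a path between two members of a strong component is
            itself a member, so the path can be followed inside \<open>D\<close>.\<close>
          have "y \<in> D"
            using l(3) z yz unfolding D(1) mutual_class_def by (auto intro: rtrancl_trans)
          then obtain m where m: "m \<in> set L" "good m" "y = mset m" using step.IH by blast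
          have "(y, z) \<in> retained_rewrites" using step.hyps(2) by (simp add: R_iff)
          then obtain m' where m': "m' \<in> set (successors m)" "z = mset m'"
            using m by (auto simp: retained_good)
          have "good m'" by (rule good_successors[OF m(2) m'(1)])
          moreover have "\<forall>L'\<in>set Ls'. m' \<notin> set L'"
          proof -
            have "\<forall>l\<in>set L. \<forall>l'\<in>set (successors l). l' \<notin> set Cs \<and> (\<forall>L'\<in>set Ls'. l' \<notin> set L')"
              using Cons.prems(1) by (auto simp: successors_avoid_iff)
            then show ?thesis using m(1) m'(1) by blast
          qed
          ultimately show "\<exists>m\<in>set L. good m \<and> z = mset m"
            using Cons.prems(2)[of m'] z m'(2) unfolding list.set by blast
        qed
      qed
      then show ?thesis using S by blast
    qed
    then have "card D \<le> card (mset ` set L)" by (intro card_mono) auto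
    also have "\<dots> \<le> length L" using card_image_le[OF finite_set, of mset L] card_length[of L] by linarith
    also have "\<dots> < n" using Cons.prems(1) by simp
    finally show ?thesis .
  qed
qed

lemma two_le_n: "2 \<le> n"
proof -
  have "list_ex (\<lambda>j. filter is_rule (Cs ! j) \<noteq> filter is_rule l0) (E ! s0)"
    using check by (simp add: core_check_def)
  then obtain j where "j \<in> set (E ! s0)" by (auto simp: list_ex_iff)
  then have "j < n" "j \<noteq> s0" using set_E[OF s0(1)] by auto
  then show ?thesis using s0(1) by linarith
qed

lemma sccs_eq:
  "pre_digraph.sccs_verts (with_proj (transition_graph seed)) =
    mutual_class R ` insert seed (Field R)"
proof -
  have "parcs (transition_graph seed) \<subseteq> pverts (transition_graph seed) \<times> pverts (transition_graph seed)"
    by (auto simp: transition_graph_def Field_def)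
  then show ?thesis
    by (simp add: sccs_verts_eq_mutual_classes) (simp add: transition_graph_def)
qed

text \<open>Components of cardinality at most 1 are settled by \<open>two_le_n\<close>. In the
  remaining case every member has a transition towards another member, hence is a source, and the
  layering applies.\<close>

lemma other_component_smaller:
  assumes "D \<in> mutual_class R ` insert seed (Field R)" "D \<noteq> core"
  shows "card D < n"
proof (cases "card D \<le> 1")
  case True
  then show ?thesis using two_le_n by simp
next
  case False
  obtain u where D: "D = mutual_class R u" using assms(1) by blast
  have "D \<inter> core = {}"
    using assms(2) unfolding D core_eq by (metis (no_types, lifting) disjoint_iff mutual_class_eq_iff)
  moreover have "D \<subseteq> sources"
  proof
    fix S assume S: "S \<in> D"
    have "\<not> D \<subseteq> {S}" using False card_mono[of "{S}" D] by auto
    then obtain S' where "S' \<in> D" "S' \<noteq> S" by blast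
    then have "(S, S') \<in> R\<^sup>*" using S unfolding D mutual_class_def by (auto intro: rtrancl_trans)
    then have "\<exists>T. (S, T) \<in> R" using \<open>S' \<noteq> S\<close> by (metis converse_rtranclE)
    then show "S \<in> sources" by (auto simp: R_iff)
  qed
  moreover have "\<exists>L\<in>set Ls. l \<in> set L" if l: "good l" "mset l \<in> D" for l
  proof -
    obtain l' where l': "good l'" "mset l = mset l'" "l' \<in> set Cs \<or> (\<exists>L\<in>set Ls. l' \<in> set L)"
      using sources_good l calculation(2) by blast
    then have "l = l'" using good_mset_eq l by blast
    then show ?thesis using l' l calculation(1) by blast
  qed
  ultimately show ?thesis using component_in_group[OF D _ _ desc] by blast
qed

section \<open>Selection and numbering of the core\<close>

lemma selected_core: "selected_core seed = core"
proof -
  have seed: "seed \<in> core" using s0 by (metis image_eqI nth_mem)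
  have scc: "core \<in> mutual_class R ` insert seed (Field R)" by (simp add: core_eq)
  have fin: "finite core" by simp
  \<comment> \<open>One state whose signature differs from that of the seed gives two signatures;
    this serves rules and data alike.\<close>
  have sig: "2 \<le> card (f ` core)" if "S \<in> core" "f S \<noteq> f seed" for f :: "state \<Rightarrow> string list" and S
  proof -
    have "card {f S, f seed} \<le> card (f ` core)" using that seed by (intro card_mono) auto
    then show ?thesis using that by simp
  qed
  obtain j where j: "j \<in> set (E ! s0)" "filter is_rule (Cs ! j) \<noteq> filter is_rule l0"
    using check by (auto simp: core_check_def list_ex_iff)
  have jn: "j < n" by (rule E_bound[OF s0(1) j(1)])
  obtain c where c: "c \<in> set Cs" "filter (\<lambda>t. \<not> is_rule t) c \<noteq> filter (\<lambda>t. \<not> is_rule t) l0"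
    using check by (auto simp: core_check_def list_ex_iff)
  have gc: "good c" using c(1) Cs_good by (auto simp: in_set_conv_nth)
  have rj: "rule_signature (mset (Cs ! j)) \<noteq> rule_signature seed"
    using j(2) Cs_good[OF jn] good_l0 by (simp add: good_def rule_signature_mset inj_map_eq_map[OF inj_term_string])
  have dc: "data_signature (mset c) \<noteq> data_signature seed"
    using c(2) gc good_l0 by (simp add: good_def data_signature_mset inj_map_eq_map[OF inj_term_string])
  have edge: "(seed, mset (Cs ! j)) \<in> R" using edge_R[OF s0(1) j(1)] s0(2) by simp
  have "(seed, seed) \<in> R\<^sup>+" using edge reaches_seed[OF jn] by (rule rtrancl_into_trancl2)
  then have qual: "qualifying_core seed core"
    unfolding qualifying_core_def sccs_eq
    using scc seed jn edge rj sig[of "mset (Cs ! j)" rule_signature] sig[of "mset c" data_signature] dc c(1)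
    by (metis imageI nth_mem)
  have less: "card C' < card core" if "qualifying_core seed C'" "C' \<noteq> core" for C'
    using that other_component_smaller card_core by (simp add: qualifying_core_def sccs_eq)
  show ?thesis
    unfolding selected_core_def
  proof (rule the_equality)
    show "qualifying_core seed core \<and>
        (\<forall>C'. qualifying_core seed C' \<and> C' \<noteq> core \<longrightarrow> card C' < card core)"
      using qual less by simp
    show "C = core" if "qualifying_core seed C \<and>
        (\<forall>C'. qualifying_core seed C' \<and> C' \<noteq> C \<longrightarrow> card C' < card C)" for C
      using that qual less by (metis less_asym)
  qed
qed

lemma core_eq_image: "core = (\<lambda>i. mset (Cs ! i)) ` {..<n}"
  by (rule set_eqI) (unfold core_iff, auto simp: image_iff)

lemma state_number_core: "i < n \<Longrightarrow> state_number core (mset (Cs ! i)) = i"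
proof -
  assume i: "i < n"
  have less: "canonical_string (mset (Cs ! j)) < canonical_string (mset (Cs ! i)) \<longleftrightarrow> j < i"
    if "j < n" "i < n" for i j
  proof -
    have *: "canonical_string (mset (Cs ! j)) < canonical_string (mset (Cs ! i)) \<longleftrightarrow> trms_less (Cs ! j) (Cs ! i)"
      if "j < n" "i < n" for i j
      using that Cs_good by (intro canonical_string_less_iff) (auto simp: good_def)
    show ?thesis
      using that * sorted_wrt_nth_less[OF Cs_sorted] trms_less_irrefl by (metis less_asym linorder_less_linear)
  qed
  have "{S' \<in> core. canonical_string S' < canonical_string (mset (Cs ! i))} = (\<lambda>j. mset (Cs ! j)) ` {..<i}"
    unfolding core_eq_image using less i by auto
  moreover have "inj_on (\<lambda>j. mset (Cs ! j)) {..<i}"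
  proof (rule inj_onI)
    fix j k assume "j \<in> {..<i}" "k \<in> {..<i}" "mset (Cs ! j) = mset (Cs ! k)"
    then show "j = k" using less[of j k] less[of k j] i by (metis lessThan_iff less_irrefl less_trans linorder_less_linear)
  qed
  ultimately show ?thesis unfolding state_number_def by (simp add: card_image)
qed

theorem core_graph_eq:
  "core_graph seed = \<lparr>pverts = {..<n}, parcs = {(i, j). i < n \<and> j \<in> set (E ! i)}\<rparr>"
proof -
  have "state_number core ` core = {..<n}"
    by (subst (2) core_eq_image) (simp add: image_image state_number_core)
  moreover have "{(state_number core S, state_number core S') |S S'.
         S \<in> core \<and> S' \<in> core \<and> S \<noteq> S' \<and> (S, S') \<in> R} = {(i, j). i < n \<and> j \<in> set (E ! i)}"
    (is "?A = ?B")
  proof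
    show "?A \<subseteq> ?B"
    proof
      fix x assume "x \<in> ?A"
      then obtain S S' where x: "x = (state_number core S, state_number core S')"
        "S \<in> core" "S' \<in> core" "S \<noteq> S'" "(S, S') \<in> R" by blast
      obtain i j where "i < n" "j < n" "S = mset (Cs ! i)" "S' = mset (Cs ! j)"
        using x(2,3) unfolding core_iff by blast
      then show "x \<in> ?B" using x R_core_iff[of i j] by (simp add: state_number_core)
    qed
    show "?B \<subseteq> ?A"
    proof
      fix x assume "x \<in> ?B"
      then obtain i j where x: "x = (i, j)" "i < n" "j \<in> set (E ! i)" by blast
      have jn: "j < n" by (rule E_bound[OF x(2,3)])
      have "x = (state_number core (mset (Cs ! i)), state_number core (mset (Cs ! j)))"
        using x jn by (simp add: state_number_core)
      then show "x \<in> ?A" using R_core_iff[OF x(2) jn] x(2,3) jn unfolding core_iff by blast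
    qed
  qed
  ultimately show ?thesis unfolding core_graph_def Let_def selected_core by simp
qed

end

section \<open>Certifying the opposite-diamond partition\<close>

definition arcs_of :: "nat list list \<Rightarrow> nat pair_pre_digraph" where
  "arcs_of E = \<lparr>pverts = {..<length E}, parcs = {(i, j). i < length E \<and> j \<in> set (E ! i)}\<rparr>"

definition blocks_of :: "(nat \<times> nat) list list \<Rightarrow> nat rel set" where
  "blocks_of Bs = set ` set Bs"

lemma blocks_of_eq_image: "blocks_of Bs = (\<lambda>c. set (Bs ! c)) ` {..<length Bs}"
  unfolding blocks_of_def by (force simp: in_set_conv_nth)

text \<open>
  A row \<open>A ! x\<close> lists the successors of \<open>x\<close>, each with the index in \<open>Bs\<close> of the block of the arc.
\<close>

definition labels_check :: "(nat \<times> nat) list list \<Rightarrow> (nat \<times> nat) list list \<Rightarrow> bool" where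
  "labels_check A Bs \<longleftrightarrow>
     list_all (\<lambda>row. distinct (map fst row) \<and> list_all (\<lambda>(y, c). y < length A \<and> c < length Bs) row) A \<and>
     list_all (\<lambda>(c, B). B \<noteq> [] \<and> list_all (\<lambda>(x, y). x < length A \<and> (y, c) \<in> set (A ! x)) B)
       (zip [0..<length Bs] Bs) \<and>
     list_all (\<lambda>(x, row). list_all (\<lambda>(y, c). (x, y) \<in> set (Bs ! c)) row) (zip [0..<length A] A)"

text \<open>Only the pair \<open>(x, a)\<close>, \<open>(b, y)\<close> is examined, since
  \<open>a\<close> and \<open>b\<close> run over all successors of \<open>x\<close> and exchanging
  them gives the other opposite pair.\<close>

definition closed_check :: "(nat \<times> nat) list list \<Rightarrow> bool" where
  "closed_check A \<longleftrightarrow>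
     list_all (\<lambda>(x, row). list_all (\<lambda>(a, c). x = a \<or>
       list_all (\<lambda>(b, _). a = b \<or> x = b \<or>
         list_all (\<lambda>(y, d). c = d \<or> x = y \<or> a = y \<or> b = y \<or> y \<notin> set (map fst (A ! a))) (A ! b)) row) row)
       (zip [0..<length A] A)"

text \<open>Both arguments are arcs already, so only the two other sides of the diamond are looked
  up. The first arc must be the one that leaves the source of the diamond, which is why
  \<open>linked\<close> tries both orders.\<close>

fun opposite_arcs :: "(nat \<times> nat) list list \<Rightarrow> nat \<times> nat \<Rightarrow> nat \<times> nat \<Rightarrow> bool" where
  "opposite_arcs A (x, a) (b, y) \<longleftrightarrow> b \<in> set (map fst (A ! x)) \<and> y \<in> set (map fst (A ! a)) \<and> distinct [x, a, b, y]"

text \<open>The order in which a block is listed encodes a spanning tree: every arc is opposite to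
  one listed before it.\<close>

fun linked :: "(nat \<times> nat) list list \<Rightarrow> (nat \<times> nat) list \<Rightarrow> (nat \<times> nat) list \<Rightarrow> bool" where
  "linked A R [] \<longleftrightarrow> True"
| "linked A R (e # es) \<longleftrightarrow> list_ex (\<lambda>f. opposite_arcs A e f \<or> opposite_arcs A f e) R \<and> linked A (e # R) es"

definition opposite_check :: "(nat \<times> nat) list list \<Rightarrow> (nat \<times> nat) list list \<Rightarrow> bool" where
  "opposite_check A Bs \<longleftrightarrow> labels_check A Bs \<and> closed_check A \<and>
     list_all (\<lambda>B. linked A [hd B] (tl B)) Bs"

lemma set_zip_upt: "set (zip [0..<length xs] xs) = (\<lambda>i. (i, xs ! i)) ` {..<length xs}"
  by (auto simp: set_zip) (metis add_0 nth_upt)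

lemma list_all_pairD: "list_all (\<lambda>(x, y). P x y) xs \<Longrightarrow> (x, y) \<in> set xs \<Longrightarrow> P x y"
  by (auto simp: list_all_iff)

lemma list_all_zip_upt:
  "list_all (\<lambda>(i, x). P i x) (zip [0..<length xs] xs) \<longleftrightarrow> (\<forall>i<length xs. P i (xs ! i))"
  by (auto simp: list_all_iff set_zip_upt)

locale labelled_blocks =
  fixes A Bs :: "(nat \<times> nat) list list"
  assumes opposite_check: "opposite_check A Bs"
begin

definition "G = arcs_of (map (map fst) A)"

lemma labels: "labels_check A Bs" and closed: "closed_check A"
  and linked: "\<And>B. B \<in> set Bs \<Longrightarrow> linked A [hd B] (tl B)"
  using opposite_check by (auto simp: opposite_check_def list_all_iff)

lemma pverts_G: "pverts G = {..<length A}"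
  by (simp add: G_def arcs_of_def)

lemma parcs_G: "(x, y) \<in> parcs G \<longleftrightarrow> x < length A \<and> y \<in> set (map fst (A ! x))"
  by (force simp: G_def arcs_of_def)

lemma labels_rows:
  "\<forall>x<length A. distinct (map fst (A ! x)) \<and> (\<forall>(y, c)\<in>set (A ! x). y < length A \<and> c < length Bs)"
  using labels unfolding labels_check_def list_all_length[of _ A] by (elim conjE) (simp add: list_all_iff)

lemma labels_blocks:
  "\<forall>c<length Bs. Bs ! c \<noteq> [] \<and> (\<forall>(x, y)\<in>set (Bs ! c). x < length A \<and> (y, c) \<in> set (A ! x))"
  using labels unfolding labels_check_def list_all_zip_upt by (elim conjE) (simp add: list_all_iff)

lemma labels_back:
  "\<forall>x<length A. \<forall>(y, c)\<in>set (A ! x). (x, y) \<in> set (Bs ! c)"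
  using labels unfolding labels_check_def list_all_zip_upt by (elim conjE) (simp add: list_all_iff)

lemma row_distinct: "x < length A \<Longrightarrow> distinct (map fst (A ! x))"
  using labels_rows by blast

lemma row_bound: "x < length A \<Longrightarrow> (y, c) \<in> set (A ! x) \<Longrightarrow> y < length A \<and> c < length Bs"
  using labels_rows by blast

lemma block_ne: "B \<in> set Bs \<Longrightarrow> B \<noteq> []"
  using labels_blocks by (auto simp: in_set_conv_nth)

lemma label_iff: "c < length Bs \<Longrightarrow> (x, y) \<in> set (Bs ! c) \<longleftrightarrow> x < length A \<and> (y, c) \<in> set (A ! x)"
  using labels_blocks labels_back by blast

lemma label_unique:
  assumes "x < length A" "(y, c) \<in> set (A ! x)" "(y, d) \<in> set (A ! x)"
  shows "c = d"
  using row_distinct[OF assms(1)] assms(2,3) by (rule eq_key_imp_eq_value)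

lemma block_index_unique:
  assumes "c < length Bs" "d < length Bs" "e \<in> set (Bs ! c)" "e \<in> set (Bs ! d)"
  shows "c = d"
  using assms label_iff label_unique by (cases e) blast

lemma parcs_eq: "parcs G = \<Union>(blocks_of Bs)"
proof (intro set_eqI iffI)
  fix e assume e: "e \<in> parcs G"
  obtain x y where [simp]: "e = (x, y)" by (cases e)
  obtain c where "x < length A" "(y, c) \<in> set (A ! x)" using e by (auto simp: parcs_G)
  then show "e \<in> \<Union>(blocks_of Bs)"
    using row_bound[of x y c] label_iff[of c x y] unfolding blocks_of_eq_image by auto
next
  fix e assume "e \<in> \<Union>(blocks_of Bs)"
  then obtain c where "c < length Bs" "e \<in> set (Bs ! c)" unfolding blocks_of_eq_image by blast
  then show "e \<in> parcs G" using label_iff[of c] by (cases e) (force simp: parcs_G)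
qed

lemma partition_blocks: "partition_on (parcs G) (blocks_of Bs)"
proof (rule partition_onI)
  show "\<Union>(blocks_of Bs) = parcs G" by (simp add: parcs_eq)
  show "disjnt p q" if pq: "p \<in> blocks_of Bs" "q \<in> blocks_of Bs" "p \<noteq> q" for p q
  proof -
    obtain c d where "c < length Bs" "d < length Bs" "p = set (Bs ! c)" "q = set (Bs ! d)"
      using pq(1,2) unfolding blocks_of_eq_image by blast
    then show ?thesis using block_index_unique pq(3) unfolding disjnt_iff by metis
  qed
  show "{} \<notin> blocks_of Bs" using block_ne by (auto simp: blocks_of_def)
qed

lemma wf_G: "parcs G \<subseteq> pverts G \<times> pverts G"
  using row_bound by (fastforce simp: parcs_G pverts_G)

lemma finite_arcs: "finite (parcs G)"
  by (rule finite_subset[OF wf_G]) (simp add: pverts_G)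

lemma diamond_same_label:
  assumes d: "diamond_pattern G x a b y" and c: "(a, c) \<in> set (A ! x)" and d': "(y, d) \<in> set (A ! b)"
  shows "c = d"
proof -
  have x: "x < length A" and b: "b \<in> set (map fst (A ! x))" and a: "y \<in> set (map fst (A ! a))"
    and ne: "x \<noteq> a" "a \<noteq> b" "x \<noteq> b" "x \<noteq> y" "a \<noteq> y" "b \<noteq> y"
    using d by (auto simp: diamond_pattern_def parcs_G)
  obtain k where bk: "(b, k) \<in> set (A ! x)" using b by auto
  have "list_all (\<lambda>(a, c). x = a \<or> list_all (\<lambda>(b, _). a = b \<or> x = b \<or>
      list_all (\<lambda>(y, d). c = d \<or> x = y \<or> a = y \<or> b = y \<or> y \<notin> set (map fst (A ! a))) (A ! b))
      (A ! x)) (A ! x)"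
    using closed x unfolding closed_check_def list_all_zip_upt by simp
  from list_all_pairD[OF this c] ne(1) have "list_all (\<lambda>(b, _). a = b \<or> x = b \<or>
      list_all (\<lambda>(y, d). c = d \<or> x = y \<or> a = y \<or> b = y \<or> y \<notin> set (map fst (A ! a))) (A ! b))
      (A ! x)" by (simp only: simp_thms)
  from list_all_pairD[OF this bk] ne(2,3)
  have "list_all (\<lambda>(y, d). c = d \<or> x = y \<or> a = y \<or> b = y \<or> y \<notin> set (map fst (A ! a))) (A ! b)"
    by (simp only: simp_thms)
  from list_all_pairD[OF this d'] ne a show ?thesis by (simp only: simp_thms)
qed

lemma opposite_step_same_block:
  assumes d: "diamond_pattern G x a b y" and c: "c < length Bs"
  shows "(x, a) \<in> set (Bs ! c) \<longleftrightarrow> (b, y) \<in> set (Bs ! c)"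
proof -
  have "(x, a) \<in> parcs G" "(b, y) \<in> parcs G" using d by (auto simp: diamond_pattern_def)
  then obtain k k' where k: "x < length A" "(a, k) \<in> set (A ! x)" "b < length A" "(y, k') \<in> set (A ! b)"
    by (auto simp: parcs_G)
  have "k = k'" by (rule diamond_same_label[OF d k(2,4)])
  then show ?thesis
    using label_iff[OF c, of x a] label_iff[OF c, of b y] k label_unique[OF k(1,2)] label_unique[OF k(3,4)]
    by blast
qed

lemma opposite_arcs_step:
  assumes "opposite_arcs A e f" "e \<in> parcs G" "f \<in> parcs G"
  shows "(e, f) \<in> parcs (opposite_graph G)" "(f, e) \<in> parcs (opposite_graph G)"
proof -
  obtain x a b y where ef: "e = (x, a)" "f = (b, y)" by (cases e, cases f)
  have V: "{x, a, b, y} \<subseteq> pverts G" using assms(2,3) wf_G unfolding ef by blast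
  have "b \<in> set (map fst (A ! x))" "y \<in> set (map fst (A ! a))" "distinct [x, a, b, y]"
    using assms(1) unfolding ef by simp_all
  moreover have "x < length A" "a < length A" using V by (simp_all add: pverts_G)
  ultimately have "(x, b) \<in> parcs G" "(a, y) \<in> parcs G" unfolding parcs_G by blast+
  then have "diamond_pattern G x a b y"
    using assms(2,3) V \<open>distinct [x, a, b, y]\<close> unfolding ef diamond_pattern_def by blast
  then show "(e, f) \<in> parcs (opposite_graph G)"
    unfolding ef opposite_graph_def opposite_pairs_def by auto
  then show "(f, e) \<in> parcs (opposite_graph G)" using sym_opposite_graph by (auto dest: symD)
qed

lemma linked_reachable:
  assumes "linked A R es" "set R \<union> set es \<subseteq> parcs G"
    "\<forall>f\<in>set R. (e0, f) \<in> (parcs (opposite_graph G))\<^sup>*"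
  shows "\<forall>f\<in>set es. (e0, f) \<in> (parcs (opposite_graph G))\<^sup>*"
  using assms
proof (induction es arbitrary: R)
  case Nil
  then show ?case by simp
next
  case (Cons e es)
  then obtain f where f: "f \<in> set R" "opposite_arcs A e f \<or> opposite_arcs A f e"
    by (auto simp: list_ex_iff)
  then have "(f, e) \<in> parcs (opposite_graph G)"
    using opposite_arcs_step[of e f] opposite_arcs_step[of f e] Cons.prems(2) by auto
  then have e: "(e0, e) \<in> (parcs (opposite_graph G))\<^sup>*"
    using Cons.prems(3) f(1) by (auto intro: rtrancl_into_rtrancl)
  show ?case using Cons.IH[of "e # R"] Cons.prems e by simp
qed

lemma opposite_partition_eq_blocks: "opposite_partition G = blocks_of Bs"
proof (rule opposite_partition_unique[OF partition_blocks])
  fix C assume C: "C \<in> blocks_of Bs"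
  then obtain B where B: "B \<in> set Bs" "C = set B" by (auto simp: blocks_of_def)
  have BG: "set B \<subseteq> parcs G" using B parcs_eq by (auto simp: blocks_of_def)
  obtain e es where es: "B = e # es" using block_ne[OF B(1)] by (cases B) auto
  have "\<forall>f\<in>set es. (e, f) \<in> (parcs (opposite_graph G))\<^sup>*"
    using linked_reachable[of "[e]" es e] linked[OF B(1)] BG es by simp
  then show "\<exists>e\<in>C. C \<subseteq> (parcs (opposite_graph G))\<^sup>* `` {e}"
    unfolding B(2) es by (intro bexI[of _ e]) auto
next
  fix C assume "C \<in> blocks_of Bs"
  then obtain c where c: "c < length Bs" "C = set (Bs ! c)" unfolding blocks_of_eq_image by blast
  show "parcs (opposite_graph G) `` C \<subseteq> C"
  proof
    fix f assume "f \<in> parcs (opposite_graph G) `` C"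
    then obtain e where e: "e \<in> C" "(e, f) \<in> parcs (opposite_graph G)" by blast
    then obtain x a b y where d: "diamond_pattern G x a b y" and ef: "{e, f} \<in> opposite_pairs x a b y"
      by (auto simp: opposite_graph_def)
    \<comment> \<open>Exchanging the middle vertices covers the second opposite pair.\<close>
    have d': "diamond_pattern G x b a y" using d by (auto simp: diamond_pattern_def)
    have "e = (x, a) \<and> f = (b, y) \<or> e = (b, y) \<and> f = (x, a) \<or> e = (x, b) \<and> f = (a, y) \<or> e = (a, y) \<and> f = (x, b)"
      using ef by (auto simp: opposite_pairs_def doubleton_eq_iff)
    then show "f \<in> C"
      using e(1) opposite_step_same_block[OF d c(1)] opposite_step_same_block[OF d' c(1)]
      unfolding c(2) by blast
  qed
qed

end

section \<open>Executable certificates\<close>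

text \<open>Duplicates are removed so that a one-element image is literally a one-element list,
  which the checks then compare with \<open>[v']\<close>.\<close>

definition block_image :: "(nat \<times> nat) list list \<Rightarrow> nat \<Rightarrow> nat list \<Rightarrow> nat list" where
  "block_image Bs c X = remdups (concat (map (\<lambda>v. map snd (filter (\<lambda>e. fst e = v) (Bs ! c))) X))"

definition word_run :: "(nat \<times> nat) list list \<Rightarrow> nat list \<Rightarrow> nat list \<Rightarrow> nat list" where
  "word_run Bs w X = fold (block_image Bs) w X"

definition enabled_check :: "(nat \<times> nat) list list \<Rightarrow> nat \<Rightarrow> nat \<Rightarrow> bool" where
  "enabled_check Bs u v \<longleftrightarrow>
     list_ex (\<lambda>B. list_ex (\<lambda>e. fst e = u) B \<noteq> list_ex (\<lambda>e. fst e = v) B) Bs"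

record witness =
  w_state :: nat
  w_channels :: "nat \<times> nat"
  w_fork :: "nat \<times> nat"
  w_offload :: "nat list"
  w_word :: "nat list"
  w_orbit :: "(nat \<times> nat) list"

definition w_cert :: "(nat \<times> nat) list list \<Rightarrow> witness \<Rightarrow> nat certificate" where
  "w_cert Bs w = (let ch = (\<lambda>c. set (Bs ! c)) in
     \<lparr>fork_state = w_state w, channel_A = ch (fst (w_channels w)), channel_B = ch (snd (w_channels w)),
      fork_l = fst (w_fork w), fork_r = snd (w_fork w), offload_word = map ch (w_offload w),
      state_p = fst (w_orbit w ! 0), state_q = snd (w_orbit w ! 0),
      orbit_word = map ch (w_word w), use_word = map ch (w_word w)\<rparr>)"

text \<open>The listed orbit plays the role of \<open>T\<close>: entry 0 is the written pair, entry
  1 its first image, and every image must again be listed, so a transient part is allowed.\<close>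

definition witness_check :: "(nat \<times> nat) list list \<Rightarrow> nat \<Rightarrow> witness \<Rightarrow> bool" where
  "witness_check Bs n w \<longleftrightarrow> (let (a, b) = w_channels w; (l, r) = w_fork w;
       (p, q) = w_orbit w ! 0; (p', q') = w_orbit w ! 1 in
     w_state w < n \<and> a < length Bs \<and> b < length Bs \<and>
     list_all (\<lambda>c. c < length Bs) (w_offload w) \<and> list_all (\<lambda>c. c < length Bs) (w_word w) \<and>
     w_word w \<noteq> [] \<and> 1 < length (w_orbit w) \<and>
     (w_state w, l) \<in> set (Bs ! a) \<and> (w_state w, r) \<in> set (Bs ! b) \<and> enabled_check Bs l r \<and>
     word_run Bs (w_offload w) [l] = [p] \<and> word_run Bs (w_offload w) [r] = [q] \<and>
     list_all (\<lambda>c. list_ex (\<lambda>e. fst e = p) (Bs ! c) = list_ex (\<lambda>e. fst e = q) (Bs ! c)) [a, b] \<and>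
     list_all (\<lambda>(u, v). enabled_check Bs u v \<and>
       list_ex (\<lambda>(u', v'). word_run Bs (w_word w) [u] = [u'] \<and> word_run Bs (w_word w) [v] = [v'])
         (w_orbit w)) (w_orbit w) \<and>
     word_run Bs (w_word w) [p] = [p'] \<and> word_run Bs (w_word w) [q] = [q'] \<and>
     (enabled_check Bs p p' \<or> enabled_check Bs q q'))"

lemma set_block_image: "set (block_image Bs c X) = set (Bs ! c) `` set X"
  by (force simp: block_image_def)

lemma word_run_word_image: "set (word_run Bs w X) = word_image (map (\<lambda>c. set (Bs ! c)) w) (set X)"
proof (induction w arbitrary: X)
  case (Cons c w)
  show ?case
    using Cons[of "block_image Bs c X"] by (simp add: word_run_def word_image_def set_block_image)
qed (simp add: word_run_def word_image_def)

lemma word_run_singleton: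
  "word_run Bs w [v] = [v'] \<Longrightarrow> word_image (map (\<lambda>c. set (Bs ! c)) w) {v} = {v'}"
  using word_run_word_image[of Bs w "[v]"] by simp

lemma enabled_iff: "list_ex (\<lambda>e. fst e = v) B \<longleftrightarrow> set B `` {v} \<noteq> {}"
  by (force simp: list_ex_iff)

lemma enabled_check_differ: "enabled_check Bs u v \<Longrightarrow> enabled_differ (blocks_of Bs) u v"
  by (auto simp: enabled_check_def enabled_differ_def blocks_of_def enabled_iff list_ex_iff[of _ Bs])

lemma certificate_data_if_check:
  assumes G: "labelled_graph G (blocks_of Bs)" and n: "pverts G = {..<n}" and chk: "witness_check Bs n w"
  shows "labelled_graph.certificate_data G (blocks_of Bs) (w_cert Bs w) (set (w_orbit w)) (fst (w_orbit w ! 1)) (snd (w_orbit w ! 1))"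
proof -
  interpret labelled_graph G "blocks_of Bs" by (rule G)
  obtain a b where w1: "w_channels w = (a, b)" by (cases "w_channels w")
  obtain l r where w2: "w_fork w = (l, r)" by (cases "w_fork w")
  obtain p q where w3: "w_orbit w ! 0 = (p, q)" by (cases "w_orbit w ! 0")
  obtain p' q' where w4: "w_orbit w ! 1 = (p', q')" by (cases "w_orbit w ! 1")
  note w = w1 w2 w3 w4
  note chk' = chk[unfolded witness_check_def w Let_def prod.case]
  have blk: "set (Bs ! c) \<in> blocks_of Bs" if "c < length Bs" for c using that by (simp add: blocks_of_def)
  have over: "set (map (\<lambda>c. set (Bs ! c)) v) \<subseteq> blocks_of Bs" if "list_all (\<lambda>c. c < length Bs) v" for v
    using that blk by (auto simp: list_all_iff)
  have orb: "(p, q) \<in> set (w_orbit w)" "(p', q') \<in> set (w_orbit w)"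
  proof -
    have "1 < length (w_orbit w)" using chk' by (elim conjE)
    then have "w_orbit w ! 0 \<in> set (w_orbit w)" "w_orbit w ! 1 \<in> set (w_orbit w)"
      by (intro nth_mem; linarith)+
    then show "(p, q) \<in> set (w_orbit w)" "(p', q') \<in> set (w_orbit w)" unfolding w by simp_all
  qed
  have step: "\<forall>(u, v)\<in>set (w_orbit w). enabled_differ (blocks_of Bs) u v \<and>
    (\<exists>u' v'. word_image (map (\<lambda>c. set (Bs ! c)) (w_word w)) {u} = {u'} \<and>
       word_image (map (\<lambda>c. set (Bs ! c)) (w_word w)) {v} = {v'} \<and> (u', v') \<in> set (w_orbit w))"
  proof (clarify, intro conjI)
    fix u v assume "(u, v) \<in> set (w_orbit w)"
    then have uv: "enabled_check Bs u v" "list_ex (\<lambda>(u', v'). word_run Bs (w_word w) [u] = [u'] \<and>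
        word_run Bs (w_word w) [v] = [v']) (w_orbit w)"
      using chk' by (auto simp: list_all_iff)
    show "enabled_differ (blocks_of Bs) u v" by (rule enabled_check_differ[OF uv(1)])
    show "\<exists>u' v'. word_image (map (\<lambda>c. set (Bs ! c)) (w_word w)) {u} = {u'} \<and>
       word_image (map (\<lambda>c. set (Bs ! c)) (w_word w)) {v} = {v'} \<and> (u', v') \<in> set (w_orbit w)"
      using uv(2) word_run_singleton unfolding list_ex_iff by blast
  qed
  have chans: "\<forall>C\<in>{set (Bs ! a), set (Bs ! b)}. C `` {p} \<noteq> {} \<longleftrightarrow> C `` {q} \<noteq> {}"
    using chk' by (simp add: enabled_iff)
  have move: "enabled_differ (blocks_of Bs) p p' \<or> enabled_differ (blocks_of Bs) q q'"
    using chk' enabled_check_differ by blast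
  show ?thesis
    unfolding certificate_data_def w_cert_def Let_def w
    using chk' n blk over[of "w_offload w"] over[of "w_word w"] orb step chans move
      word_run_singleton enabled_check_differ
    by (simp add: word_over_def del: Image_singleton_iff)
qed

section \<open>Swapping two arcs\<close>

definition swap_blocks ::
  "(nat \<times> nat) list list \<Rightarrow> nat \<Rightarrow> nat \<Rightarrow> nat \<times> nat \<Rightarrow> nat \<times> nat \<Rightarrow> (nat \<times> nat) list list" where
  "swap_blocks Bs i j e f =
     Bs[i := f # filter (\<lambda>x. x \<noteq> e) (Bs ! i), j := e # filter (\<lambda>x. x \<noteq> f) (Bs ! j)]"

definition swapped_check :: "(nat \<times> nat) list list \<Rightarrow> nat \<Rightarrow> witness \<Rightarrow> witness \<Rightarrow> bool" where
  "swapped_check Bs n v w \<longleftrightarrow> witness_check Bs n v \<and> witness_check Bs n w \<and>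
     (let (p, q) = w_orbit v ! 0; (a, b) = w_orbit w ! 0; (a', b') = w_orbit w ! 1; S = [a, b, a', b'] in
       w_orbit v = [(p, q), (q, p)] \<and> (p \<in> set S \<or> q \<in> set S) \<and> list_ex (\<lambda>x. x \<noteq> p \<and> x \<noteq> q) S)"

text \<open>Demanding a second arc in block \<open>i\<close> rules out exchanging two singleton
  blocks, which would leave the partition unchanged.\<close>

definition swap_check ::
  "(nat \<times> nat) list list \<Rightarrow> nat \<Rightarrow> nat \<Rightarrow> nat \<Rightarrow> nat \<times> nat \<Rightarrow> nat \<times> nat \<Rightarrow> witness \<Rightarrow> witness \<Rightarrow> bool" where
  "swap_check Bs n i j e f v w \<longleftrightarrow> i < length Bs \<and> j < length Bs \<and> i \<noteq> j \<and>
     e \<in> set (Bs ! i) \<and> f \<in> set (Bs ! j) \<and> list_ex (\<lambda>x. x \<noteq> e) (Bs ! i) \<and>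
     swapped_check (swap_blocks Bs i j e f) n v w"

locale swap_data = labelled_blocks +
  fixes i j :: nat and e f :: "nat \<times> nat" and v w :: witness
  assumes swap_check: "swap_check Bs (length A) i j e f v w"
begin

abbreviation "Bs' \<equiv> swap_blocks Bs i j e f"

lemma indices: "i < length Bs" "j < length Bs" "i \<noteq> j" "e \<in> set (Bs ! i)" "f \<in> set (Bs ! j)"
  and other: "\<exists>x\<in>set (Bs ! i). x \<noteq> e" and swapped: "swapped_check Bs' (length A) v w"
  using swap_check by (auto simp: swap_check_def list_ex_iff)

lemma blocks_swapped:
  "blocks_of Bs' = (blocks_of Bs - {set (Bs ! i), set (Bs ! j)}) \<union>
     {(set (Bs ! i) - {e}) \<union> {f}, (set (Bs ! j) - {f}) \<union> {e}}"
proof -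
  let ?I = "{..<length Bs} - {i, j}"
  have len: "length Bs' = length Bs" by (simp add: swap_blocks_def)
  have I: "{..<length Bs} = insert i (insert j ?I)" using indices by auto
  have i: "set (Bs' ! i) = (set (Bs ! i) - {e}) \<union> {f}"
    and j: "set (Bs' ! j) = (set (Bs ! j) - {f}) \<union> {e}"
    and rest: "\<And>c. c \<in> ?I \<Longrightarrow> Bs' ! c = Bs ! c"
    using indices by (auto simp: swap_blocks_def)
  \<comment> \<open>Blocks at different indices are different sets, so deleting two indices is the
    same as deleting two blocks.\<close>
  have ne: "set (Bs ! c) \<noteq> set (Bs ! d)" if "c < length Bs" "d < length Bs" "c \<noteq> d" for c d
  proof -
    have "Bs ! c \<noteq> []" using block_ne that(1) by simp
    then have "hd (Bs ! c) \<in> set (Bs ! c)" by (rule hd_in_set)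
    then show ?thesis using block_index_unique that by blast
  qed
  have "(\<lambda>c. set (Bs' ! c)) ` ?I = (\<lambda>c. set (Bs ! c)) ` ?I"
    using rest by (intro image_cong) auto
  also have "\<dots> = blocks_of Bs - {set (Bs ! i), set (Bs ! j)}"
    unfolding blocks_of_eq_image using ne[of _ i] ne[of _ j] indices by auto
  finally have *: "(\<lambda>c. set (Bs' ! c)) ` ?I = blocks_of Bs - {set (Bs ! i), set (Bs ! j)}" .
  have "blocks_of Bs' = (\<lambda>c. set (Bs' ! c)) ` {..<length Bs}"
    unfolding blocks_of_eq_image len ..
  also have "\<dots> = insert (set (Bs' ! i)) (insert (set (Bs' ! j)) ((\<lambda>c. set (Bs' ! c)) ` ?I))"
    by (subst I) (simp only: image_insert)
  finally show ?thesis unfolding * i j by blast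
qed

text \<open>An arc kept in block \<open>i\<close> now shares a block with \<open>f\<close>, although
  the two were in different blocks before.\<close>

lemma blocks_swapped_neq: "blocks_of Bs' \<noteq> blocks_of Bs"
proof
  assume "blocks_of Bs' = blocks_of Bs"
  then have "(set (Bs ! i) - {e}) \<union> {f} \<in> blocks_of Bs" using blocks_swapped by blast
  then obtain c where c: "c < length Bs" "set (Bs ! c) = (set (Bs ! i) - {e}) \<union> {f}"
    unfolding blocks_of_eq_image by blast
  obtain x where x: "x \<in> set (Bs ! i)" "x \<noteq> e" using other by blast
  have "x \<in> set (Bs ! c)" "f \<in> set (Bs ! c)" using c(2) x by auto
  then have "c = i" "c = j" using block_index_unique c(1) indices x(1) by blast+
  then show False using indices(3) by simp
qed

lemma labelled_graph_swapped: "labelled_graph G (blocks_of Bs')"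
proof
  show "finite (pverts G)" by (simp add: pverts_G)
  have "\<Union>(blocks_of Bs') = parcs G"
    using swapped_partition(1)[OF partition_blocks finite_arcs _ _ _ indices(4,5) blocks_swapped]
      indices blocks_of_def block_index_unique by (metis image_eqI nth_mem partition_onD1)
  then show "C \<subseteq> pverts G \<times> pverts G" if "C \<in> blocks_of Bs'" for C
    using that wf_G by blast
qed

lemma wpu_parity_swapped: "wpu_parity G (blocks_of Bs') = 1"
proof -
  interpret L: labelled_graph G "blocks_of Bs'" by (rule labelled_graph_swapped)
  obtain p q where v0: "w_orbit v ! 0 = (p, q)" by (cases "w_orbit v ! 0")
  obtain a b where w0: "w_orbit w ! 0 = (a, b)" by (cases "w_orbit w ! 0")
  obtain a' b' where w1: "w_orbit w ! 1 = (a', b')" by (cases "w_orbit w ! 1")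
  note chk = swapped[unfolded swapped_check_def v0 w0 w1 Let_def prod.case]
  have orb: "w_orbit v = [(p, q), (q, p)]" using chk by blast
  have dv: "L.certificate_data (w_cert Bs' v) (set (w_orbit v)) (fst (w_orbit v ! 1)) (snd (w_orbit v ! 1))"
    by (rule certificate_data_if_check[OF labelled_graph_swapped pverts_G conjunct1[OF chk]])
  have dw: "L.certificate_data (w_cert Bs' w) (set (w_orbit w)) (fst (w_orbit w ! 1)) (snd (w_orbit w ! 1))"
    by (rule certificate_data_if_check[OF labelled_graph_swapped pverts_G conjunct1[OF conjunct2[OF chk]]])
  show ?thesis
  proof (rule L.wpu_parity_if_swap[OF _ _ _ _ dw])
    show "L.certificate_data (w_cert Bs' v) {(p, q), (q, p)} q p"
      using dv unfolding orb by simp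
    show "state_p (w_cert Bs' v) = p" "state_q (w_cert Bs' v) = q"
      by (simp_all add: w_cert_def Let_def v0)
    show "use_word (w_cert Bs' v) = orbit_word (w_cert Bs' v)"
      by (simp add: w_cert_def Let_def)
    have S: "{state_p (w_cert Bs' w), state_q (w_cert Bs' w), fst (w_orbit w ! 1), snd (w_orbit w ! 1)} =
        set [a, b, a', b']"
      by (simp add: w_cert_def Let_def w0 w1[unfolded One_nat_def])
    show "{state_p (w_cert Bs' w), state_q (w_cert Bs' w), fst (w_orbit w ! 1), snd (w_orbit w ! 1)} \<inter>
        {p, q} \<noteq> {}"
      unfolding S using chk by blast
    show "\<not> {state_p (w_cert Bs' w), state_q (w_cert Bs' w), fst (w_orbit w ! 1), snd (w_orbit w ! 1)} \<subseteq>
        {p, q}"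
      unfolding S using chk unfolding list_ex_iff by blast
  qed
qed

theorem swap_neighbour:
  "\<exists>P'. partition_on (parcs G) P' \<and> profile P' = profile (opposite_partition G) \<and>
     (P', opposite_partition G) \<in> parcs (swap_graph (profile (opposite_partition G)) (parcs G)) \<and>
     wpu_parity G P' = 1"
proof (intro exI conjI)
  have ij: "set (Bs ! i) \<in> blocks_of Bs" "set (Bs ! j) \<in> blocks_of Bs"
    using indices by (simp_all add: blocks_of_def)
  have ne: "set (Bs ! i) \<noteq> set (Bs ! j)"
    using block_index_unique[OF indices(1,2,4)] indices by blast
  note sw = swapped_partition[OF partition_blocks finite_arcs ij ne indices(4,5) blocks_swapped]
  show "partition_on (parcs G) (blocks_of Bs')" by (rule sw(1))
  show "profile (blocks_of Bs') = profile (opposite_partition G)"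
    unfolding opposite_partition_eq_blocks by (rule sw(2))
  show "(blocks_of Bs', opposite_partition G) \<in>
      parcs (swap_graph (profile (opposite_partition G)) (parcs G))"
    unfolding opposite_partition_eq_blocks by (rule sw(3)[OF blocks_swapped_neq])
  show "wpu_parity G (blocks_of Bs') = 1" by (rule wpu_parity_swapped)
qed

end

section \<open>The catalogue rows\<close>

lemma core_graph_eq_arcs_of: "core_check l0 Cs Ls E s0 \<Longrightarrow> core_graph (mset l0) = arcs_of E"
  using core_data.core_graph_eq[OF core_data.intro] core_data.length_E[OF core_data.intro]
  by (simp add: arcs_of_def)

text \<open>Hides the lists of a row, so that the final argument is carried out once for all four
  rows.\<close>

definition row_certified :: "nat pair_pre_digraph \<Rightarrow> bool" where
  "row_certified G \<longleftrightarrow> (\<exists>A Bs i j e f v w. swap_data A Bs i j e f v w \<and> G = labelled_blocks.G A)"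

lemma row_certifiedI:
  assumes "core_check l0 Cs Ls (map (map fst) A) s0" "opposite_check A Bs" "swap_check Bs (length A) i j e f v w"
  shows "row_certified (core_graph (mset l0))"
proof -
  interpret swap_data A Bs i j e f v w by unfold_locales (fact assms)+
  have "G = core_graph (mset l0)" by (simp add: G_def core_graph_eq_arcs_of[OF assms(1)])
  then show ?thesis unfolding row_certified_def using swap_data_axioms by metis
qed

section \<open>Row 226\<close>

definition core_226 :: "trm list list" where
  "core_226 = (let A = TmA; V = TmV; P = TmP; R = TmR in
    [[A, R A (R A A), R V A], [A, R A (R A (R A A)), R V A], [A, R A (R A (R A (R A (R A A)))),
    R V A], [A, R A (R A (R (R A (R A A)) A)), R V A], [A, R A (R (R A A) A), R V A], [A, R A (R
    (R A A) (R (R A A) A)), R V A], [A, R A (R (R A (R A A)) (R A A)), R V A], [A, R A (R (R A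
    (R (R A A) A)) A), R V A], [A, R A (R (R (R (R A A) A) A) A), R V A], [A, R (R A A) (R A A),
    R V A], [A, R (R A (R A A)) (R A (R A A)), R V A], [A, R (R (R A A) A) (R (R A A) A), R V
    A], [R A A, R A (R A A), R V A], [R A A, R A (R A (R A A)), R V A], [R A A, R A (R (R A A)
    A), R V A], [R A A, R (R A A) (R A A), R V A], [R A (R A A), R A (R A A), R V A], [R A (R A
    A), R A (R A (R A A)), R V A], [R A (R A A), R (R A A) A, R V A], [R A (R (R A A) A), R (R A
    A) A, R V A]])"

text \<open>Unrelated states are packed into one group as long as it stays smaller than the
  core.\<close>

definition groups_226 :: "trm list list list" where
  "groups_226 = (let A = TmA; V = TmV; P = TmP; R = TmR in
    [[[A, A, A], [A, A, R V A], [A, R A (R (R A A) A), R V (R (R A A) A)], [A, R A A, R A (R A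
    A)], [R A A, R A (R A A), R V (R A A)], [A, R A (R A A), R V (R A (R A A))], [A, R A (R A (R
    A A)), R V (R A (R A A))], [A, R A (R A A), R V (R (R A A) A)], [A, R A A, R V (R A A)], [A,
    R A (R A A), R V (R A A)], [A, R A (R A (R A A)), R V (R A A)], [A, R A (R (R A A) A), R V
    (R A A)], [A, R (R A A) (R A A), R V (R A A)], [A, A, R A (R (R A A) A)], [A, A, R (R A A)
    (R A A)], [A, A, R A (R A (R A A))], [A, A, R A (R A A)], [A, A, R A A], [A, R A A, R V A]],
    [[R A A, R A A, R V A], [A, R (R A A) A, R V A]]])"

definition arcs_226 :: "(nat \<times> nat) list list" where
  "arcs_226 =
    [[(1, 0), (4, 1), (9, 2), (12, 0)], [(0, 0), (2, 0), (3, 0), (6, 3), (10, 4), (17, 0)], [(0,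
    0), (1, 5)], [(0, 0), (1, 6)], [(0, 7), (5, 8), (7, 9), (8, 10), (11, 11), (19, 12)], [(4,
    13)], [(1, 14)], [(0, 10), (4, 15)], [(0, 9), (4, 16)], [(0, 17)], [(1, 18)], [(4, 19)],
    [(0, 0), (13, 0), (14, 1), (15, 2), (16, 20), (18, 0)], [(1, 0), (12, 0)], [(4, 0), (12,
    7)], [(9, 0), (12, 17)], [(0, 0), (12, 0), (17, 0)], [(0, 0), (1, 0), (12, 0), (13, 0), (16,
    0)], [(0, 20), (12, 21), (19, 1)], [(4, 20), (14, 21), (18, 7)]]"

text \<open>Inside a block the arcs stand in a linking order, as \<open>linked\<close>
  requires.\<close>

definition blocks_226 :: "(nat \<times> nat) list list" where
  "blocks_226 =
    [[(0, 1), (12, 13), (16, 17), (0, 12), (1, 17), (2, 0), (1, 3), (17, 0), (1, 2), (3, 0),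
    (13, 1), (12, 0), (14, 4), (15, 9), (17, 1), (16, 0), (12, 18), (17, 12), (1, 0), (13, 12),
    (17, 16), (16, 12), (17, 13)], [(0, 4), (12, 14), (18, 19)], [(0, 9), (12, 15)], [(1, 6)],
    [(1, 10)], [(2, 1)], [(3, 1)], [(4, 0), (14, 12), (19, 18)], [(4, 5)], [(4, 7), (8, 0)],
    [(4, 8), (7, 0)], [(4, 11)], [(4, 19)], [(5, 4)], [(6, 1)], [(7, 4)], [(8, 4)], [(9, 0),
    (15, 12)], [(10, 1)], [(11, 4)], [(12, 16), (18, 0), (19, 4)], [(18, 12), (19, 14)]]"

lemma core_check_226:
  "core_check [TmA, TmR TmA (TmR TmA TmA), TmR TmV TmA]
     core_226 groups_226 (map (map fst) arcs_226) 0"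
  by code_simp

lemma opposite_check_226: "opposite_check arcs_226 blocks_226"
  by code_simp

text \<open>After the swap \<open>(4, 7)\<close> is read in block 0 and \<open>(0, 12)\<close> in
  block 9, so the word runs through 0, 4, 7, 0, 12 and through 12, 14, 4, 8, 0. Moving its last
  letter to the front interchanges 0 and 8, the states before that letter, which gives a support
  overlapping \<open>{0, 12}\<close> in 0.\<close>

lemma swap_check_226:
  "swap_check blocks_226 (length arcs_226) 0 9 (0, 12) (4, 7)
     \<lparr>w_state = 16, w_channels = (0, 0), w_fork = (0, 12), w_offload = [], w_word = [1, 0, 10, 9],
       w_orbit = [(0, 12), (12, 0)]\<rparr>
     \<lparr>w_state = 4, w_channels = (7, 10), w_fork = (0, 8), w_offload = [], w_word = [9, 1, 0, 10],
       w_orbit = [(0, 8), (8, 0)]\<rparr>"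
  by code_simp

section \<open>Row 3388\<close>

definition core_3388 :: "trm list list" where
  "core_3388 = (let A = TmA; V = TmV; P = TmP; R = TmR in
    [[P A A, R A (P A A), R V (P A A)], [P A A, R A (P A (P A A)), R V (P A A)], [P A A, R A (P
    A (P A (P A A))), R V (P A A)], [P A A, R A (P A (P A (P A (P A A)))), R V (P A A)], [P A A,
    R A (P A (P (P A A) A)), R V (P A A)], [P A A, R A (P A (P (P A (P A A)) A)), R V (P A A)],
    [P A A, R A (P (P A A) A), R V (P A A)], [P A A, R A (P (P A A) (P A A)), R V (P A A)], [P A
    A, R A (P (P A A) (P (P A A) A)), R V (P A A)], [P A A, R A (P (P A (P A A)) A), R V (P A
    A)], [P A A, R A (P (P A (P A A)) (P A A)), R V (P A A)], [P A A, R A (P (P A (P (P A A) A))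
    A), R V (P A A)], [P A A, R A (P (P (P A A) A) A), R V (P A A)], [P A A, R A (P (P (P (P A
    A) A) A) A), R V (P A A)], [P A (P A A), R A (P A A), R V (P A A)], [P A (P A A), R A (P A
    (P A A)), R V (P A A)], [P A (P A A), R A (P (P A A) A), R V (P A A)], [P A (P A (P A A)), R
    A (P A A), R V (P A A)], [P A (P A (P A A)), R A (P A (P A A)), R V (P A A)], [P A (P (P A
    A) A), R A (P A A), R V (P A A)], [P A (P (P A A) A), R A (P (P A A) A), R V (P A A)], [P (P
    A A) A, R A (P A A), R V (P A A)], [P (P A A) A, R A (P A (P A A)), R V (P A A)], [P (P A A)
    A, R A (P (P A A) A), R V (P A A)], [P (P A A) (P A A), R A (P A A), R V (P A A)], [P (P A
    (P A A)) A, R A (P A A), R V (P A A)], [P (P A (P A A)) A, R A (P A (P A A)), R V (P A A)],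
    [P (P (P A A) A) A, R A (P A A), R V (P A A)], [P (P (P A A) A) A, R A (P (P A A) A), R V (P
    A A)]])"

definition groups_3388 :: "trm list list list" where
  "groups_3388 = (let A = TmA; V = TmV; P = TmP; R = TmR in
    [[[P A A, P A (P A A), R V (P A (P A A))], [P A A, P A A, P A A], [P A A, P (P A A) A, R V
    (P (P A A) A)], [P A A, P A A, R V (P (P A A) A)], [P A A, P A A, R V (P A (P A A))], [P A
    A, P A A, R V (P A A)], [P A A, P A (P A A), R V (P A A)], [P A A, P (P A A) A, R V (P A
    A)], [P A A, R A (P (P A A) A), R V (P (P (P A A) A) A)], [P A A, R A (P (P A A) A), R V (P
    (P A A) A)], [P A A, R A (P (P (P A A) A) A), R V (P (P A A) A)], [P A A, P (P A A) A, R A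
    (P A A)], [P A A, R A (P A A), R V (P (P A (P A A)) (P A A))], [P A A, R A (P A A), R V (P
    (P A A) (P (P A A) A))], [P A A, R A (P A A), R V (P (P A A) (P A A))], [P A A, R A (P A A),
    R V (P (P (P (P A A) A) A) A)], [P (P A A) A, R A (P A A), R V (P (P A A) A)], [P (P (P A A)
    A) A, R A (P A A), R V (P (P A A) A)], [P A (P (P A A) A), R A (P A A), R V (P (P A A) A)],
    [P A (P A A), R A (P A A), R V (P (P A A) A)], [P A A, P A A, R (P A A) (P A A)]], [[P A A,
    R (P A A) (P A A), R V (P A A)], [P A A, R (P A A) (P A A), R V (P A (P A A))], [P A A, R (P
    A A) (P A A), R V (P (P A A) A)], [P A A, R (P A A) (P A (P A A)), R V (P A A)], [P A A, R
    (P A A) (P (P A A) A), R V (P A A)], [P A A, R (P A (P A A)) (P A A), R V (P A A)], [P A A,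
    R (P A (P A A)) (P A A), R V (P A (P A A))], [P A A, R (P A (P A A)) (P A (P A A)), R V (P A
    A)], [P A A, R (P (P A A) A) (P A A), R V (P A A)], [P A A, R (P (P A A) A) (P A A), R V (P
    (P A A) A)], [P A A, R (P (P A A) A) (P (P A A) A), R V (P A A)], [P A (P A A), R (P A A) (P
    A A), R V (P A A)], [P (P A A) A, R (P A A) (P A A), R V (P A A)], [P A A, R A (P A A), R V
    (P (P (P A A) A) A)], [P A A, R A (P A (P A A)), R V (P (P A (P A A)) A)], [P A A, R A (P A
    A), R V (P (P A (P (P A A) A)) A)], [P A A, R A (P A A), R V (P (P A (P A A)) A)], [P A A, R
    A (P A (P (P A A) A)), R V (P (P A A) A)], [P A A, R A (P A (P A A)), R V (P (P A A) A)], [P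
    A A, R A (P A A), R V (P (P A A) A)], [P A A, P A A, R A (P (P A A) A)], [P A A, P A A, R A
    (P A (P A A))], [P A A, P A (P A A), R A (P A A)], [P A A, P A A, R A (P A A)], [P A A, R A
    (P A A), R V (P A (P A (P A (P A A))))], [P A A, R A (P A (P A A)), R V (P A (P A (P A
    A)))], [P A A, R A (P A A), R V (P A (P A (P A A)))]], [[P A A, R A (P A (P A A)), R V (P A
    (P A A))], [P A A, R A (P A (P A (P A A))), R V (P A (P A A))], [P A (P A A), R A (P A A), R
    V (P A (P A A))], [P A (P A (P A A)), R A (P A A), R V (P A (P A A))], [P (P A (P A A)) A, R
    A (P A A), R V (P A (P A A))], [P A A, R A (P (P A A) A), R V (P A (P (P A A) A))], [P A A,
    R A (P A A), R V (P A (P (P A (P A A)) A))], [P A A, R A (P A A), R V (P A (P (P A A) A))],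
    [P A A, R A (P (P A (P A A)) A), R V (P A (P A A))], [P A A, R A (P (P A A) A), R V (P A (P
    A A))], [P (P A A) A, R A (P A A), R V (P A (P A A))], [P A A, R A (P A A), R V (P A (P A
    A))]]])"

definition arcs_3388 :: "(nat \<times> nat) list list" where
  "arcs_3388 =
    [[(1, 0), (6, 0), (14, 1), (21, 1)], [(0, 0), (2, 0), (3, 0), (4, 0), (5, 0), (7, 0), (10,
    0), (15, 1), (18, 2), (22, 1), (26, 3)], [(0, 0), (1, 0), (3, 0)], [(0, 0), (1, 0), (2, 0)],
    [(0, 0), (1, 0), (5, 0), (8, 0)], [(0, 0), (1, 0), (4, 0)], [(0, 0), (7, 0), (8, 0), (9, 0),
    (11, 0), (12, 0), (13, 0), (16, 1), (20, 4), (23, 1), (28, 5)], [(0, 0), (8, 0), (10, 0)],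
    [(0, 0), (7, 0)], [(0, 0), (6, 0), (10, 0), (11, 0)], [(0, 0), (7, 0)], [(0, 0), (6, 0), (9,
    0)], [(0, 0), (6, 0), (13, 0)], [(0, 0), (6, 0), (12, 0)], [(0, 6), (15, 0), (16, 0), (17,
    1), (19, 1), (24, 1)], [(1, 6), (14, 0), (18, 1)], [(6, 6), (14, 0), (20, 1)], [(0, 1), (14,
    7), (18, 0)], [(1, 1), (15, 7), (17, 0)], [(0, 1), (14, 8), (20, 0)], [(6, 1), (16, 8), (19,
    0)], [(0, 9), (22, 0), (23, 0), (24, 1), (25, 1), (27, 1)], [(1, 9), (21, 0), (26, 1)], [(6,
    9), (21, 0), (28, 1)], [(0, 1)], [(0, 1), (21, 10), (26, 0)], [(1, 1), (22, 10), (25, 0)],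
    [(0, 1), (21, 11), (28, 0)], [(6, 1), (23, 11), (27, 0)]]"

definition blocks_3388 :: "(nat \<times> nat) list list" where
  "blocks_3388 =
    [[(0, 1), (2, 3), (1, 0), (3, 2), (4, 5), (8, 0), (4, 1), (5, 0), (1, 2), (3, 0), (1, 4),
    (2, 0), (1, 3), (4, 0), (1, 5), (7, 0), (1, 10), (6, 8), (9, 0), (6, 7), (9, 10), (6, 0),
    (9, 11), (0, 6), (1, 7), (4, 8), (10, 0), (7, 8), (9, 6), (10, 7), (11, 0), (6, 9), (7, 10),
    (12, 0), (6, 11), (13, 0), (6, 12), (12, 6), (6, 13), (13, 6), (11, 9), (12, 13), (13, 12),
    (14, 16), (19, 20), (21, 23), (27, 28), (16, 14), (20, 19), (23, 21), (28, 27), (11, 6), (5,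
    1), (3, 1), (2, 1), (8, 7), (5, 4), (15, 14), (18, 17), (22, 21), (26, 25), (14, 15), (17,
    18), (21, 22), (25, 26)], [(0, 14), (1, 15), (6, 16), (21, 24), (25, 0), (21, 27), (23, 28),
    (24, 0), (14, 17), (15, 18), (19, 0), (14, 24), (0, 21), (1, 22), (6, 23), (17, 0), (14,
    19), (16, 20), (18, 1), (20, 6), (21, 25), (22, 26), (27, 0), (28, 6), (26, 1)], [(1, 18)],
    [(1, 26)], [(6, 20)], [(6, 28)], [(14, 0), (15, 1), (16, 6)], [(17, 14), (18, 15)], [(19,
    14), (20, 16)], [(21, 0), (22, 1), (23, 6)], [(25, 21), (26, 22)], [(27, 21), (28, 23)]]"

lemma core_check_3388:
  "core_check [TmP TmA TmA, TmR TmA (TmP TmA TmA), TmR TmV (TmP TmA TmA)]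
     core_3388 groups_3388 (map (map fst) arcs_3388) 0"
  by code_simp

lemma opposite_check_3388: "opposite_check arcs_3388 blocks_3388"
  by code_simp

text \<open>Without \<open>(14, 15)\<close> block 0 is single-valued at 14 and interchanges 14 and
  16. That arc, now alone in block 2, also separates 14 from 16 in the first round. Block 0
  interchanges 17 and 18 too, so the second orbit has a support strictly containing
  \<open>{14, 16}\<close>.\<close>

lemma swap_check_3388:
  "swap_check blocks_3388 (length arcs_3388) 0 2 (14, 15) (1, 18)
     \<lparr>w_state = 9, w_channels = (0, 0), w_fork = (0, 6), w_offload = [1, 1, 8], w_word = [0],
       w_orbit = [(14, 16), (16, 14)]\<rparr>
     \<lparr>w_state = 15, w_channels = (0, 1), w_fork = (14, 18), w_offload = [], w_word = [0],
       w_orbit = [(14, 18), (16, 17)]\<rparr>"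
  by code_simp

section \<open>Row 4390\<close>

definition core_4390 :: "trm list list" where
  "core_4390 = (let A = TmA; V = TmV; P = TmP; R = TmR in
    [[A, R (P A V) V, R V (P A (P A V))], [A, R (P A V) V, R V (P A V)], [A, R (P A V) V, R V (P
    (P A A) V)], [P A A, R (P A V) V, R V (P A (P A V))], [P A A, R (P A V) V, R V (P A V)], [P
    A A, R (P A V) V, R V (P (P A A) V)], [P A (P A A), R (P A V) V, R V (P A (P A V))], [P A (P
    A A), R (P A V) V, R V (P A V)], [P A (P A A), R (P A V) V, R V (P (P A A) V)], [P A (P A (P
    A A)), R (P A V) V, R V (P A (P A V))], [P A (P A (P A A)), R (P A V) V, R V (P A V)], [P A
    (P (P A A) A), R (P A V) V, R V (P A V)], [P A (P (P A A) A), R (P A V) V, R V (P (P A A)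
    V)], [P (P A A) A, R (P A V) V, R V (P A (P A V))], [P (P A A) A, R (P A V) V, R V (P A V)],
    [P (P A A) A, R (P A V) V, R V (P (P A A) V)], [P (P A A) (P A A), R (P A V) V, R V (P A
    V)], [P (P A A) (P A A), R (P A V) V, R V (P (P A A) V)], [P (P A (P A A)) A, R (P A V) V, R
    V (P A (P A V))], [P (P A (P A A)) A, R (P A V) V, R V (P A V)], [P (P (P A A) A) A, R (P A
    V) V, R V (P A V)], [P (P (P A A) A) A, R (P A V) V, R V (P (P A A) V)]])"

definition groups_4390 :: "trm list list list" where
  "groups_4390 = (let A = TmA; V = TmV; P = TmP; R = TmR in
    [[[A, R (P A V) V, R V V], [P A A, R V V, R V V], [P A A, R (P A V) V, R V V], [P (P A A) A,
    R V (P A V), R V V], [P A A, R V (P A (P A V)), R V V], [P A (P A A), R V (P A V), R V V],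
    [P A A, R V (P (P A A) V), R V V], [P A A, R V (P A V), R V V], [P A A, R (P A (P A (P A
    V))) V, R V (P A (P A V))], [P A A, R (P A (P A (P A V))) V, R V (P A V)], [P A A, R (P A (P
    A V)) V, R V (P A (P A V))], [P (P A A) A, R (P A (P A V)) V, R V (P A V)], [P A A, R (P A
    (P A V)) V, R V (P (P A A) V)], [A, R V (P A V), R V V], [P A A, R (P (P A A) (P A V)) V, R
    V (P (P A A) V)], [P A A, R (P (P A A) (P A V)) V, R V (P A V)], [P A A, R (P A (P (P A A)
    V)) V, R V (P A V)], [A, R (P A (P A V)) V, R V (P A V)], [P A A, R (P A (P A V)) V, R V (P
    A V)], [P A (P A A), R (P A (P A V)) V, R V (P A V)], [P A A, R (P (P A A) V) V, R V (P A (P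
    A V))]], [[P A A, R (P (P A (P A A)) V) V, R V (P A (P A V))], [P A A, R (P (P A (P A A)) V)
    V, R V (P A V)], [P A A, R (P (P A A) V) V, R V (P (P A A) V)], [P A A, R (P (P (P A A) A)
    V) V, R V (P (P A A) V)], [P A A, R (P (P (P A A) A) V) V, R V (P A V)], [P A (P A A), R (P
    (P A A) V) V, R V (P A V)], [A, R (P (P A A) V) V, R V (P A V)], [P A A, R (P (P A A) V) V,
    R V (P A V)], [P (P A A) A, R (P (P A A) V) V, R V (P A V)], [P A A, R (P A V) V, R V (P (P
    (P (P A A) A) A) V)], [P A A, R (P A V) V, R V (P (P A (P (P A A) A)) V)], [P A A, R (P A V)
    V, R V (P (P (P A A) (P A A)) V)], [P A A, R (P A V) V, R V (P (P A A) (P (P A A) V))], [P A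
    (P A A), R (P A V) V, R V V], [P (P A A) A, R (P A V) V, R V V], [P A A, R (P A V) V, R V (P
    (P A (P A A)) (P A V))], [P A A, R (P A V) V, R V (P A (P (P A (P A A)) V))], [P A A, R (P A
    V) V, R V (P A (P A (P A (P A V))))]]])"

definition arcs_4390 :: "(nat \<times> nat) list list" where
  "arcs_4390 =
    [[(1, 0), (6, 1)], [(0, 2), (2, 3), (4, 4)], [(1, 5), (15, 6)], [(0, 6), (4, 0), (9, 1),
    (18, 7)], [(1, 6), (3, 2), (5, 3), (7, 6), (14, 6)], [(2, 6), (4, 5), (12, 6), (17, 6), (21,
    6)], [(3, 6), (7, 0)], [(4, 6), (6, 2), (8, 3), (10, 8), (11, 6), (16, 6)], [(5, 6), (7,
    5)], [(6, 6), (10, 0)], [(7, 6), (9, 2)], [(7, 6), (12, 3), (14, 6)], [(8, 6), (11, 5), (15,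
    6)], [(3, 6), (14, 0)], [(4, 6), (11, 6), (13, 2), (15, 3), (16, 6), (19, 9), (20, 10)],
    [(5, 6), (14, 5)], [(7, 6), (14, 6), (17, 3)], [(8, 6), (15, 6), (16, 5)], [(13, 11), (19,
    0)], [(14, 11), (18, 2)], [(14, 6), (21, 3)], [(15, 6), (20, 5)]]"

definition blocks_4390 :: "(nat \<times> nat) list list" where
  "blocks_4390 =
    [[(0, 1), (3, 4), (6, 7), (9, 10), (13, 14), (18, 19)], [(0, 6), (3, 9)], [(1, 0), (4, 3),
    (7, 6), (10, 9), (14, 13), (19, 18)], [(1, 2), (4, 5), (7, 8), (11, 12), (14, 15), (16, 17),
    (20, 21)], [(1, 4)], [(2, 1), (5, 4), (8, 7), (12, 11), (15, 14), (17, 16), (21, 20)], [(2,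
    15), (5, 12), (17, 8), (15, 5), (12, 8), (5, 17), (12, 15), (5, 2), (4, 1), (3, 0), (9, 6),
    (10, 7), (17, 15), (5, 21), (8, 5), (7, 4), (6, 3), (11, 14), (7, 16), (4, 14), (7, 11),
    (16, 14), (21, 15), (20, 14), (11, 7), (14, 4), (13, 3), (16, 7), (14, 11), (4, 7), (14,
    16)], [(3, 18)], [(7, 10)], [(14, 19)], [(14, 20)], [(18, 13), (19, 14)]]"

lemma core_check_4390:
  "core_check [TmP TmA TmA, TmR (TmP TmA TmV) TmV, TmR TmV (TmP TmA TmV)]
     core_4390 groups_4390 (map (map fst) arcs_4390) 4"
  by code_simp

lemma opposite_check_4390: "opposite_check arcs_4390 blocks_4390"
  by code_simp

text \<open>Block 0 contains \<open>(6, 7)\<close> and receives the reverse arc, hence interchanges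
  6 and 7; \<open>(0, 1)\<close> leaves it to keep the sizes. In the offload, 4 has the block-6
  successors 1, 7 and 14, but block 0 is defined only at 7. The second orbit starts with a transient
  pair and then alternates 6 and 4, so its support meets \<open>{6, 7}\<close> only in 6.\<close>

lemma swap_check_4390:
  "swap_check blocks_4390 (length arcs_4390) 0 2 (0, 1) (7, 6)
     \<lparr>w_state = 3, w_channels = (0, 1), w_fork = (4, 9), w_offload = [6, 0], w_word = [0],
       w_orbit = [(6, 7), (7, 6)]\<rparr>
     \<lparr>w_state = 14, w_channels = (6, 2), w_fork = (11, 13), w_offload = [], w_word = [6, 0],
       w_orbit = [(11, 13), (6, 4), (4, 6)]\<rparr>"
  by code_simp

section \<open>Row 4986\<close>

definition core_4986 :: "trm list list" where
  "core_4986 = (let A = TmA; V = TmV; P = TmP; R = TmR in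
    [[A, R (P V A) V, R V (P (P V A) A)], [A, R (P V A) V, R V (P V A)], [A, R (P V A) V, R V (P
    V (P A A))], [P A A, R (P V A) V, R V (P (P V A) A)], [P A A, R (P V A) V, R V (P V A)], [P
    A A, R (P V A) V, R V (P V (P A A))], [P A (P A A), R (P V A) V, R V (P (P V A) A)], [P A (P
    A A), R (P V A) V, R V (P V A)], [P A (P A A), R (P V A) V, R V (P V (P A A))], [P A (P A (P
    A A)), R (P V A) V, R V (P V A)], [P A (P A (P A A)), R (P V A) V, R V (P V (P A A))], [P A
    (P (P A A) A), R (P V A) V, R V (P (P V A) A)], [P A (P (P A A) A), R (P V A) V, R V (P V
    A)], [P (P A A) A, R (P V A) V, R V (P (P V A) A)], [P (P A A) A, R (P V A) V, R V (P V A)],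
    [P (P A A) A, R (P V A) V, R V (P V (P A A))], [P (P A A) (P A A), R (P V A) V, R V (P V
    A)], [P (P A A) (P A A), R (P V A) V, R V (P V (P A A))], [P (P A (P A A)) A, R (P V A) V, R
    V (P V A)], [P (P A (P A A)) A, R (P V A) V, R V (P V (P A A))], [P (P (P A A) A) A, R (P V
    A) V, R V (P (P V A) A)], [P (P (P A A) A) A, R (P V A) V, R V (P V A)]])"

definition groups_4986 :: "trm list list list" where
  "groups_4986 = (let A = TmA; V = TmV; P = TmP; R = TmR in
    [[[P (P A A) A, R V (P V A), R V V], [P A A, R V (P (P V A) A), R V V], [P A (P A A), R V (P
    V A), R V V], [P A A, R V (P V (P A A)), R V V], [P A A, R V (P V A), R V V], [P A A, R (P
    (P V A) (P A A)) V, R V (P V (P A A))], [P A A, R (P (P V A) (P A A)) V, R V (P V A)], [P A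
    (P A A), R (P (P V A) A) V, R V (P V A)], [P A A, R (P (P V (P A A)) A) V, R V (P V A)], [A,
    R V (P V A), R V V], [P A A, R (P (P V A) A) V, R V (P V (P A A))], [P A A, R (P (P (P V A)
    A) A) V, R V (P (P V A) A)], [P A A, R (P (P (P V A) A) A) V, R V (P V A)], [P A A, R (P (P
    V A) A) V, R V (P (P V A) A)], [A, R (P (P V A) A) V, R V (P V A)], [P A A, R (P (P V A) A)
    V, R V (P V A)], [P (P A A) A, R (P (P V A) A) V, R V (P V A)], [A, R (P V A) V, R V V], [P
    A A, R V V, R V V], [P A A, R (P V A) V, R V V], [P A A, R (P V (P A A)) V, R V (P (P V A)
    A)]], [[P A A, R (P V (P (P A A) A)) V, R V (P (P V A) A)], [P A A, R (P V (P (P A A) A)) V,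
    R V (P V A)], [P A A, R (P V (P A (P A A))) V, R V (P V (P A A))], [P A A, R (P V (P A (P A
    A))) V, R V (P V A)], [P (P A A) A, R (P V (P A A)) V, R V (P V A)], [P A A, R (P V (P A A))
    V, R V (P V (P A A))], [A, R (P V (P A A)) V, R V (P V A)], [P A A, R (P V (P A A)) V, R V
    (P V A)], [P A (P A A), R (P V (P A A)) V, R V (P V A)], [P (P A A) A, R (P V A) V, R V V],
    [P A A, R (P V A) V, R V (P V (P (P A A) (P A A)))], [P A A, R (P V A) V, R V (P V (P A (P A
    (P A A))))], [P A A, R (P V A) V, R V (P V (P (P A (P A A)) A))], [P A A, R (P V A) V, R V
    (P (P V (P A A)) (P A A))], [P A A, R (P V A) V, R V (P (P (P (P V A) A) A) A)], [P A A, R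
    (P V A) V, R V (P (P V A) (P (P A A) A))], [P A A, R (P V A) V, R V (P (P V (P (P A A) A))
    A)], [P A (P A A), R (P V A) V, R V V]]])"

definition arcs_4986 :: "(nat \<times> nat) list list" where
  "arcs_4986 =
    [[(1, 0), (13, 1)], [(0, 2), (2, 3), (4, 4)], [(1, 5), (8, 6)], [(0, 6), (4, 0), (11, 7),
    (20, 1)], [(1, 6), (3, 2), (5, 3), (7, 6), (14, 6)], [(2, 6), (4, 5), (10, 6), (17, 6), (19,
    6)], [(3, 6), (7, 0)], [(4, 6), (6, 2), (8, 3), (9, 8), (12, 9), (16, 6), (18, 6)], [(5, 6),
    (7, 5)], [(7, 6), (10, 3)], [(8, 6), (9, 5)], [(6, 10), (12, 0)], [(7, 10), (11, 2)], [(3,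
    6), (14, 0)], [(4, 6), (13, 2), (15, 3), (16, 6), (18, 6), (21, 11)], [(5, 6), (14, 5)],
    [(7, 6), (14, 6), (17, 3)], [(8, 6), (15, 6), (16, 5)], [(7, 6), (14, 6), (19, 3)], [(8, 6),
    (15, 6), (18, 5)], [(13, 6), (21, 0)], [(14, 6), (20, 2)]]"

definition blocks_4986 :: "(nat \<times> nat) list list" where
  "blocks_4986 =
    [[(0, 1), (3, 4), (6, 7), (11, 12), (13, 14), (20, 21)], [(0, 13), (3, 20)], [(1, 0), (4,
    3), (7, 6), (12, 11), (14, 13), (21, 20)], [(1, 2), (4, 5), (7, 8), (9, 10), (16, 17), (14,
    15), (18, 19)], [(1, 4)], [(2, 1), (5, 4), (8, 7), (10, 9), (17, 16), (15, 14), (19, 18)],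
    [(2, 8), (5, 10), (17, 8), (5, 2), (4, 1), (3, 0), (20, 13), (21, 14), (10, 8), (5, 17),
    (19, 8), (15, 5), (14, 4), (13, 3), (16, 7), (14, 18), (4, 7), (14, 16), (18, 7), (19, 15),
    (8, 5), (7, 4), (6, 3), (16, 14), (7, 18), (4, 14), (7, 16), (18, 14), (17, 15), (5, 19),
    (9, 7)], [(3, 11)], [(7, 9)], [(7, 12)], [(11, 6), (12, 7)], [(14, 21)]]"

lemma core_check_4986:
  "core_check [TmP TmA TmA, TmR (TmP TmV TmA) TmV, TmR TmV (TmP TmV TmA)]
     core_4986 groups_4986 (map (map fst) arcs_4986) 4"
  by code_simp

lemma opposite_check_4986: "opposite_check arcs_4986 blocks_4986"
  by code_simp

text \<open>Exchanging the arguments of every \<open>TmP\<close> turns row 4390 into this row and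
  its states 6, 7 into 13, 14; the swapped arcs correspond. The second support meets
  \<open>{13, 14}\<close> only in 13.\<close>

lemma swap_check_4986:
  "swap_check blocks_4986 (length arcs_4986) 0 2 (0, 1) (14, 13)
     \<lparr>w_state = 3, w_channels = (0, 1), w_fork = (4, 20), w_offload = [6, 0], w_word = [0],
       w_orbit = [(13, 14), (14, 13)]\<rparr>
     \<lparr>w_state = 7, w_channels = (2, 6), w_fork = (6, 16), w_offload = [], w_word = [6, 0],
       w_orbit = [(6, 16), (4, 13), (13, 4)]\<rparr>"
  by code_simp

theorem catalogue_graph_certified:
  assumes "s \<in> {226, 3388, 4390, 4986}"
  shows "row_certified (catalogue_graph s)"
proof -
  consider "s = 226" | "s = 3388" | "s = 4390" | "s = 4986" using assms by blast
  then show ?thesis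
  proof cases
    case 1
    show ?thesis
      using row_certifiedI[OF core_check_226 opposite_check_226 swap_check_226] 1
      by (simp add: catalogue_graph_def catalogue_seed_def)
  next
    case 2
    show ?thesis
      using row_certifiedI[OF core_check_3388 opposite_check_3388 swap_check_3388] 2
      by (simp add: catalogue_graph_def catalogue_seed_def)
  next
    case 3
    show ?thesis
      using row_certifiedI[OF core_check_4390 opposite_check_4390 swap_check_4390] 3
      by (simp add: catalogue_graph_def catalogue_seed_def)
  next
    case 4
    show ?thesis
      using row_certifiedI[OF core_check_4986 opposite_check_4986 swap_check_4986] 4
      by (simp add: catalogue_graph_def catalogue_seed_def)
  qed
qed

theorem theorem7p1:
  fixes s :: nat and G :: "nat pair_pre_digraph" and E :: "nat rel" and \<P>s :: "nat rel set"
    and lam :: "nat multiset"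
  assumes "s \<in> {226, 3388, 4390, 4986}"
    and "G = catalogue_graph s"
    and "E = parcs G"
    and "\<P>s = opposite_partition G"
    and "lam = profile \<P>s"
  shows "(\<exists>\<P>'. partition_on E \<P>' \<and> profile \<P>' = lam \<and>
             (\<P>', \<P>s) \<in> parcs (swap_graph lam E) \<and> wpu_parity G \<P>' = 1) \<and>
         (\<forall>\<P>'. partition_on E \<P>' \<and> profile \<P>' = lam \<and>
             (\<P>', \<P>s) \<in> parcs (swap_graph lam E) \<and> wpu_parity G \<P>' = 1 \<longrightarrow>
             \<P>' \<noteq> \<P>s \<and> breaks_opposite_pair G \<P>' \<and> \<P>' \<notin> aut_orbit G \<P>s)"
proof -
  obtain A Bs i j e f v w where sw: "swap_data A Bs i j e f v w" and G: "G = labelled_blocks.G A"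
    using catalogue_graph_certified[OF assms(1)] assms(2) unfolding row_certified_def by blast
  \<comment> \<open>The rewrite replaces the locale's graph by the fixed \<open>G\<close>, so that
    the facts of the locale speak about the catalogue graph directly.\<close>
  interpret swap_data A Bs i j e f v w
    rewrites "labelled_blocks.G A = G"
    using sw G by simp_all
  \<comment> \<open>The orbit is a single point, so leaving it means just being different, which
    adjacency in the swap graph provides.\<close>
  have orbit: "\<P>' \<noteq> opposite_partition G \<Longrightarrow> \<P>' \<notin> aut_orbit G (opposite_partition G)" for \<P>'
    using aut_orbit_opposite_partition[OF wf_G] by blast
  have neq: "\<P>' \<noteq> opposite_partition G" if "(\<P>', opposite_partition G) \<in> parcs (swap_graph lam E)" for \<P>'
    using that by (auto simp: swap_graph_def)
  show ?thesis
    unfolding assms(3-5)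
    using swap_neighbour neq orbit breaks_opposite_pair_if_neq[OF finite_arcs]
    unfolding assms(3-5) by blast
qed

end
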